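(* Let $\mathcal{C}$ be a rigid, pseudo-abelian, $\mathbb{Q}$-linear ACU tensor category with unit object $\mathbb{I}$, let $V\in\mathcal{C}$, and suppose that $V$ has symmetric rank $g\in\mathbb{N}_{\ge1}$. Then for every $0\le i\le g$ the morphisms $$D^{i,g}:\vee^iV\to\vee^{g-i}V^\vee\otimes\vee^gV^{\vee\vee},\quad D_{g-i,g}:\vee^{g-i}V^\vee\to\vee^{i}V\otimes\vee^gV^{\vee},$$ $$D^{g-i,g}:\vee^{g-i}V\to\vee^{i}V^\vee\otimes\vee^gV^{\vee\vee},\quad D_{i,g}:\vee^iV^\vee\to\vee^{g-i}V\otimes\vee^gV^\vee$$ are isomorphisms, and the multiplication maps $\varphi_{i,g-i}^V$, $\varphi_{g-i,i}^V$, $\varphi_{i,g-i}^{V^\vee}$, $\varphi_{g-i,i}^{V^\vee}$ of the symmetric algebras of $V$ and $V^\vee$ are perfect pairings, i.e. the associated morphisms $\vee^iV\to\hom(\vee^{g-i}V,\vee^gV)$, $\vee^{g-i}V\to\hom(\vee^{i}V,\vee^gV)$, and the same with $V^\vee$ in place of $V$, are isomorphisms. Furthermore, if $V$ has strong symmetric rank $g$, then $\binom{r+g-1}{g-i}=(-1)^{g-i}$ and $\binom{r+g-1}{i}=(-1)^i$ for every $0\le i\le g$, where $r=\mathrm{rank}(V)$.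
   Context: ACU tensor category: additive symmetric monoidal category with biadditive $\otimes$ and symmetry $\tau_{X,Y}$, with internal homs $\hom(X,Y)$; $X^\vee=\hom(X,\mathbb{I})$, $\mathrm{ev}_X:X^\vee\otimes X\to\mathbb{I}$, $\mathrm{ev}_X^\tau=\mathrm{ev}_X\circ\tau_{X,X^\vee}$. Rigid: the canonical maps $\bigotimes\hom(X_i,Y_i)\to\hom(\bigotimes X_i,\bigotimes Y_i)$ and $X\to X^{\vee\vee}$ are isomorphisms. Pseudo-abelian: idempotents split. $C_X:\mathbb{I}\to X\otimes X^\vee$ is the coevaluation, and $\mathrm{rank}(V)=\mathrm{ev}_V^\tau\circ C_V\in\mathrm{End}(\mathbb{I})$. $\alpha_{X,Y}:Y\otimes X^\vee\to\hom(X,Y)$ is the canonical isomorphism corresponding to $1_Y\otimes\mathrm{ev}_X$. $\binom{T}{k}=\frac1{k!}T(T-1)\cdots(T-k+1)\in\mathbb{Q}[T]$ for $k\ge1$, $\binom T0=1$. With $r=\mathrm{rank}(V)$: $V$ has symmetric rank $g\in\mathbb{N}_{\ge1}$ if $\vee^gV$ is an invertible object and $\binom{r+g-1}{g-i}$ and $\binom{r+g-1}{i}$ are invertible in $\mathrm{End}(\mathbb{I})$ for every $0\le i\le g$. $V$ has strong symmetric rank $g$ if $\vee^gV$ is invertible and $r=-g$ (this implies symmetric rank $g$). $\vee^iV$ is the direct factor of $\otimes^iV$ cut out by the symmetrizer $\frac1{i!}\sum_{\sigma\in S_i}\sigma$, with injection $i_V^i$ and projection $p_V^i$; the multiplication is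 $\varphi_{i,j}^V=p_V^{i+j}\circ(i_V^i\otimes i_V^j):\vee^iV\otimes\vee^jV\to\vee^{i+j}V$. $\mathrm{ev}_V^i:(\otimes^iV^\vee)\otimes(\otimes^iV)\to\mathbb{I}$ pairs the $k$-th factor $V^\vee$ with the $k$-th factor $V$ (after reordering by $\tau$), $\mathrm{ev}_V^{i,\tau}$ is its precomposition with the symmetry, and $\mathrm{ev}_V^i\circ(i_{V^\vee}^i\otimes i_V^i)$ makes $\vee^iV^\vee:=\vee^i(V^\vee)$ the dual of $\vee^iV$; likewise $\vee^iV^{\vee\vee}:=\vee^i(V^{\vee\vee})$ is the dual of $\vee^iV^\vee$. For $g\ge i$ let $\iota_{i,g}:\vee^iV\to\hom(\vee^gV^\vee,\vee^{g-i}V^\vee)$ and $\iota^*_{i,g}:\vee^iV^\vee\to\hom(\vee^gV,\vee^{g-i}V)$ correspond by adjunction to $p_{V^\vee}^{g-i}\circ(\mathrm{ev}_V^{i,\tau}\otimes1_{\otimes^{g-i}V^\vee})\circ(i_V^i\otimes i_{V^\vee}^g)$ and $p_V^{g-i}\circ(\mathrm{ev}_V^i\otimes1_{\otimes^{g-i}V})\circ(i_{V^\vee}^i\otimes i_V^g)$. Then $D^{i,g}=\alpha^{-1}\circ\iota_{i,g}$ and $D_{i,g}=\alpha^{-1}\circ\iota^*_{i,g}$. *)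

theory Defs
  imports Complex_Main "HOL-Algebra.Module" "HOL-Combinatorics.Permutations"
begin

text \<open>
  The objects are the elements of a type \<open>'o\<close>; \<open>Comp C g f\<close> is \<open>g\<close> after \<open>f\<close>. Neither the
  associativity nor the unit constraints are assumed to be identities.
  The evaluation is \<open>Ev C X Y : hom(X,Y) \<otimes> X \<rightarrow> Y\<close>. The field \<open>Scale\<close> is only constrained
  (and only meaningful) for rational-linear categories.
\<close>

record ('o, 'm) tensor_cat =
  Hom :: "'o \<Rightarrow> 'o \<Rightarrow> 'm set"
  Id :: "'o \<Rightarrow> 'm"  ("\<^bold>1\<index>")
  Comp :: "'m \<Rightarrow> 'm \<Rightarrow> 'm"  (infixr "\<cdot>\<index>" 60)
  Zero :: "'o \<Rightarrow> 'o \<Rightarrow> 'm"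
  Add :: "'m \<Rightarrow> 'm \<Rightarrow> 'm"  (infixl "\<^bold>+\<index>" 55)
  Scale :: "rat \<Rightarrow> 'm \<Rightarrow> 'm"
  TensorO :: "'o \<Rightarrow> 'o \<Rightarrow> 'o"  (infixr "\<otimes>\<^sub>o\<index>" 70)
  TensorM :: "'m \<Rightarrow> 'm \<Rightarrow> 'm"  (infixr "\<otimes>\<^sub>m\<index>" 70)
  Unit :: "'o"  ("\<I>\<index>")
  Assoc :: "'o \<Rightarrow> 'o \<Rightarrow> 'o \<Rightarrow> 'm"
  Lunit :: "'o \<Rightarrow> 'm"
  Runit :: "'o \<Rightarrow> 'm"
  Symm :: "'o \<Rightarrow> 'o \<Rightarrow> 'm"  ("\<tau>\<index>")
  IHom :: "'o \<Rightarrow> 'o \<Rightarrow> 'o"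
  Ev :: "'o \<Rightarrow> 'o \<Rightarrow> 'm"

definition rat_ring :: "rat ring" where
  "rat_ring = \<lparr>carrier = UNIV, monoid.mult = (*), one = 1, zero = 0, add = (+)\<rparr>"

text \<open>The multiplicative fields of this record play no role in the library's notions of abelian
  group and module.\<close>

definition hom_module :: "('o, 'm) tensor_cat \<Rightarrow> 'o \<Rightarrow> 'o \<Rightarrow> (rat, 'm) module" where
  "hom_module C X Y = \<lparr>carrier = Hom C X Y, monoid.mult = undefined, one = undefined,
     zero = Zero C X Y, add = Add C, smult = Scale C\<rparr>"

context
  fixes C :: "('o, 'm) tensor_cat" (structure)
begin

definition is_inverse :: "'o \<Rightarrow> 'o \<Rightarrow> 'm \<Rightarrow> 'm \<Rightarrow> bool" where
  "is_inverse X Y f h \<longleftrightarrow> f \<in> Hom C X Y \<and> h \<in> Hom C Y X \<and> h \<cdot> f = \<^bold>1 X \<and> f \<cdot> h = \<^bold>1 Y"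

definition is_isomorphism :: "'o \<Rightarrow> 'o \<Rightarrow> 'm \<Rightarrow> bool" where
  "is_isomorphism X Y f \<longleftrightarrow> (\<exists>h. is_inverse X Y f h)"

definition iso_inv :: "'o \<Rightarrow> 'o \<Rightarrow> 'm \<Rightarrow> 'm" where
  "iso_inv X Y f = (THE h. is_inverse X Y f h)"

end

locale category =
  fixes C :: "('o, 'm) tensor_cat" (structure)
  assumes Hom_disjoint: "f \<in> Hom C X Y \<Longrightarrow> f \<in> Hom C X' Y' \<Longrightarrow> X = X' \<and> Y = Y'"
    and Id_in: "\<^bold>1 X \<in> Hom C X X"
    and Comp_in: "f \<in> Hom C X Y \<Longrightarrow> g \<in> Hom C Y Z \<Longrightarrow> g \<cdot> f \<in> Hom C X Z"
    and Comp_Id: "f \<in> Hom C X Y \<Longrightarrow> f \<cdot> \<^bold>1 X = f"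
    and Id_Comp: "f \<in> Hom C X Y \<Longrightarrow> \<^bold>1 Y \<cdot> f = f"
    and Comp_assoc: "f \<in> Hom C W X \<Longrightarrow> g \<in> Hom C X Y \<Longrightarrow> h \<in> Hom C Y Z \<Longrightarrow>
      (h \<cdot> g) \<cdot> f = h \<cdot> (g \<cdot> f)"

locale additive_category = category +
  assumes Hom_abelian_group: "abelian_group (hom_module C X Y)"
    and Comp_Add: "f \<in> Hom C X Y \<Longrightarrow> f' \<in> Hom C X Y \<Longrightarrow> g \<in> Hom C Y Z \<Longrightarrow>
      g \<cdot> (f \<^bold>+ f') = g \<cdot> f \<^bold>+ g \<cdot> f'"
    and Add_Comp: "f \<in> Hom C X Y \<Longrightarrow> g \<in> Hom C Y Z \<Longrightarrow> g' \<in> Hom C Y Z \<Longrightarrow>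
      (g \<^bold>+ g') \<cdot> f = g \<cdot> f \<^bold>+ g' \<cdot> f"
    and zero_object: "\<exists>N. \<^bold>1 N = Zero C N N"
    and biproduct: "\<exists>P i1 i2 p1 p2. i1 \<in> Hom C X P \<and> i2 \<in> Hom C Y P \<and>
      p1 \<in> Hom C P X \<and> p2 \<in> Hom C P Y \<and>
      p1 \<cdot> i1 = \<^bold>1 X \<and> p2 \<cdot> i2 = \<^bold>1 Y \<and> p1 \<cdot> i2 = Zero C Y X \<and> p2 \<cdot> i1 = Zero C X Y \<and>
      i1 \<cdot> p1 \<^bold>+ i2 \<cdot> p2 = \<^bold>1 P"

locale symmetric_monoidal_category = category +
  assumes Tensor_in: "f \<in> Hom C X Y \<Longrightarrow> f' \<in> Hom C X' Y' \<Longrightarrow>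
      f \<otimes>\<^sub>m f' \<in> Hom C (X \<otimes>\<^sub>o X') (Y \<otimes>\<^sub>o Y')"
    and Tensor_Id: "\<^bold>1 X \<otimes>\<^sub>m \<^bold>1 Y = \<^bold>1 (X \<otimes>\<^sub>o Y)"
    and Tensor_Comp: "f \<in> Hom C X Y \<Longrightarrow> g \<in> Hom C Y Z \<Longrightarrow>
      f' \<in> Hom C X' Y' \<Longrightarrow> g' \<in> Hom C Y' Z' \<Longrightarrow>
      (g \<cdot> f) \<otimes>\<^sub>m (g' \<cdot> f') = (g \<otimes>\<^sub>m g') \<cdot> (f \<otimes>\<^sub>m f')"
    and Assoc_iso: "is_isomorphism C ((X \<otimes>\<^sub>o Y) \<otimes>\<^sub>o Z) (X \<otimes>\<^sub>o (Y \<otimes>\<^sub>o Z)) (Assoc C X Y Z)"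
    and Assoc_natural: "f \<in> Hom C X X' \<Longrightarrow> g \<in> Hom C Y Y' \<Longrightarrow> h \<in> Hom C Z Z' \<Longrightarrow>
      Assoc C X' Y' Z' \<cdot> ((f \<otimes>\<^sub>m g) \<otimes>\<^sub>m h) = (f \<otimes>\<^sub>m (g \<otimes>\<^sub>m h)) \<cdot> Assoc C X Y Z"
    and Lunit_iso: "is_isomorphism C (\<I> \<otimes>\<^sub>o X) X (Lunit C X)"
    and Lunit_natural: "f \<in> Hom C X Y \<Longrightarrow> Lunit C Y \<cdot> (\<^bold>1 \<I> \<otimes>\<^sub>m f) = f \<cdot> Lunit C X"
    and Runit_iso: "is_isomorphism C (X \<otimes>\<^sub>o \<I>) X (Runit C X)"
    and Runit_natural: "f \<in> Hom C X Y \<Longrightarrow> Runit C Y \<cdot> (f \<otimes>\<^sub>m \<^bold>1 \<I>) = f \<cdot> Runit C X"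
    and Symm_in: "\<tau> X Y \<in> Hom C (X \<otimes>\<^sub>o Y) (Y \<otimes>\<^sub>o X)"
    and Symm_natural: "f \<in> Hom C X X' \<Longrightarrow> g \<in> Hom C Y Y' \<Longrightarrow>
      \<tau> X' Y' \<cdot> (f \<otimes>\<^sub>m g) = (g \<otimes>\<^sub>m f) \<cdot> \<tau> X Y"
    and Symm_Symm: "\<tau> Y X \<cdot> \<tau> X Y = \<^bold>1 (X \<otimes>\<^sub>o Y)"
    and pentagon: "Assoc C W X (Y \<otimes>\<^sub>o Z) \<cdot> Assoc C (W \<otimes>\<^sub>o X) Y Z =
      (\<^bold>1 W \<otimes>\<^sub>m Assoc C X Y Z) \<cdot> Assoc C W (X \<otimes>\<^sub>o Y) Z \<cdot> (Assoc C W X Y \<otimes>\<^sub>m \<^bold>1 Z)"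
    and triangle: "(\<^bold>1 X \<otimes>\<^sub>m Lunit C Y) \<cdot> Assoc C X \<I> Y = Runit C X \<otimes>\<^sub>m \<^bold>1 Y"
    and hexagon: "Assoc C Y Z X \<cdot> \<tau> X (Y \<otimes>\<^sub>o Z) \<cdot> Assoc C X Y Z =
      (\<^bold>1 Y \<otimes>\<^sub>m \<tau> X Z) \<cdot> Assoc C Y X Z \<cdot> (\<tau> X Y \<otimes>\<^sub>m \<^bold>1 Z)"

locale acu_tensor_category = additive_category + symmetric_monoidal_category +
  assumes Tensor_Add_left: "f \<in> Hom C X Y \<Longrightarrow> f' \<in> Hom C X Y \<Longrightarrow> h \<in> Hom C X' Y' \<Longrightarrow>
      (f \<^bold>+ f') \<otimes>\<^sub>m h = (f \<otimes>\<^sub>m h) \<^bold>+ (f' \<otimes>\<^sub>m h)"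
    and Tensor_Add_right: "f \<in> Hom C X Y \<Longrightarrow> f' \<in> Hom C X Y \<Longrightarrow> h \<in> Hom C X' Y' \<Longrightarrow>
      h \<otimes>\<^sub>m (f \<^bold>+ f') = (h \<otimes>\<^sub>m f) \<^bold>+ (h \<otimes>\<^sub>m f')"
    and Ev_in: "Ev C X Y \<in> Hom C (IHom C X Y \<otimes>\<^sub>o X) Y"
    and Ev_universal: "f \<in> Hom C (Z \<otimes>\<^sub>o X) Y \<Longrightarrow>
      \<exists>!h. h \<in> Hom C Z (IHom C X Y) \<and> Ev C X Y \<cdot> (h \<otimes>\<^sub>m \<^bold>1 X) = f"

context
  fixes C :: "('o, 'm) tensor_cat" (structure)
begin

definition curry_mor :: "'o \<Rightarrow> 'o \<Rightarrow> 'o \<Rightarrow> 'm \<Rightarrow> 'm" where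
  "curry_mor Z X Y f = (THE h. h \<in> Hom C Z (IHom C X Y) \<and> Ev C X Y \<cdot> (h \<otimes>\<^sub>m \<^bold>1 X) = f)"

definition dual :: "'o \<Rightarrow> 'o" where
  "dual X = IHom C X \<I>"

definition dual_ev :: "'o \<Rightarrow> 'm" where
  "dual_ev X = Ev C X \<I>"

definition dual_ev_symm :: "'o \<Rightarrow> 'm" where
  "dual_ev_symm X = dual_ev X \<cdot> \<tau> X (dual X)"

definition bidual_map :: "'o \<Rightarrow> 'm" where
  "bidual_map X = curry_mor X (dual X) \<I> (dual_ev_symm X)"

definition inv_Assoc :: "'o \<Rightarrow> 'o \<Rightarrow> 'o \<Rightarrow> 'm" where
  "inv_Assoc X Y Z = iso_inv C ((X \<otimes>\<^sub>o Y) \<otimes>\<^sub>o Z) (X \<otimes>\<^sub>o (Y \<otimes>\<^sub>o Z)) (Assoc C X Y Z)"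

text \<open>The reordering \<open>(A \<otimes> B) \<otimes> (A' \<otimes> B') \<rightarrow> (A \<otimes> A') \<otimes> (B \<otimes> B')\<close>.\<close>

definition interchange :: "'o \<Rightarrow> 'o \<Rightarrow> 'o \<Rightarrow> 'o \<Rightarrow> 'm" where
  "interchange A B A' B' =
     inv_Assoc A A' (B \<otimes>\<^sub>o B') \<cdot>
     (\<^bold>1 A \<otimes>\<^sub>m (Assoc C A' B B' \<cdot> (\<tau> B A' \<otimes>\<^sub>m \<^bold>1 B') \<cdot> inv_Assoc B A' B')) \<cdot>
     Assoc C A B (A' \<otimes>\<^sub>o B')"

primrec tensor_list :: "'o list \<Rightarrow> 'o" where
  "tensor_list [] = \<I>"
| "tensor_list (X # Xs) = X \<otimes>\<^sub>o tensor_list Xs"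

text \<open>For a finite family of pairs \<open>(X\<^sub>k, Y\<^sub>k)\<close>, the morphism
  \<open>(\<Otimes> hom(X\<^sub>k,Y\<^sub>k)) \<otimes> (\<Otimes> X\<^sub>k) \<rightarrow> \<Otimes> Y\<^sub>k\<close> obtained by reordering and evaluating factorwise.\<close>

primrec family_ev :: "('o \<times> 'o) list \<Rightarrow> 'm" where
  "family_ev [] = Lunit C \<I>"
| "family_ev (p # ps) =
     (Ev C (fst p) (snd p) \<otimes>\<^sub>m family_ev ps) \<cdot>
     interchange (IHom C (fst p) (snd p)) (tensor_list (map (\<lambda>(X, Y). IHom C X Y) ps))
       (fst p) (tensor_list (map fst ps))"

definition family_hom_map :: "('o \<times> 'o) list \<Rightarrow> 'm" where
  "family_hom_map ps =
     curry_mor (tensor_list (map (\<lambda>(X, Y). IHom C X Y) ps))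
       (tensor_list (map fst ps)) (tensor_list (map snd ps)) (family_ev ps)"

text \<open>The canonical morphism \<open>Y \<otimes> X' \<rightarrow> hom(X,Y)\<close> corresponding to \<open>1\<^sub>Y \<otimes> e\<close>, where the
  object \<open>X'\<close> together with the pairing \<open>e : X' \<otimes> X \<rightarrow> \<I>\<close> plays the role of the dual of \<open>X\<close>.\<close>

definition alpha_via :: "'o \<Rightarrow> 'o \<Rightarrow> 'o \<Rightarrow> 'm \<Rightarrow> 'm" where
  "alpha_via X Y X' e =
     curry_mor (Y \<otimes>\<^sub>o X') X Y (Runit C Y \<cdot> (\<^bold>1 Y \<otimes>\<^sub>m e) \<cdot> Assoc C Y X' X)"

definition alpha :: "'o \<Rightarrow> 'o \<Rightarrow> 'm" where
  "alpha X Y = alpha_via X Y (dual X) (dual_ev X)"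

definition coev :: "'o \<Rightarrow> 'm" where
  "coev X = iso_inv C (X \<otimes>\<^sub>o dual X) (IHom C X X) (alpha X X) \<cdot> curry_mor \<I> X X (Lunit C X)"

definition tensor_rank :: "'o \<Rightarrow> 'm" where
  "tensor_rank X = dual_ev_symm X \<cdot> coev X"

definition invertible_object :: "'o \<Rightarrow> bool" where
  "invertible_object L \<longleftrightarrow> (\<exists>L' f. is_isomorphism C (L \<otimes>\<^sub>o L') \<I> f)"

definition is_splitting :: "'o \<Rightarrow> 'm \<Rightarrow> 'o \<times> 'm \<times> 'm \<Rightarrow> bool" where
  "is_splitting X e = (\<lambda>(S, j, p). j \<in> Hom C S X \<and> p \<in> Hom C X S \<and> p \<cdot> j = \<^bold>1 S \<and> j \<cdot> p = e)"

end

locale rigid_tensor_category = acu_tensor_category +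
  assumes family_hom_iso: "is_isomorphism C (tensor_list C (map (\<lambda>(X, Y). IHom C X Y) ps))
      (IHom C (tensor_list C (map fst ps)) (tensor_list C (map snd ps))) (family_hom_map C ps)"
    and bidual_iso: "is_isomorphism C X (dual C (dual C X)) (bidual_map C X)"

locale pseudo_abelian_category = additive_category +
  assumes idempotent_splits: "e \<in> Hom C X X \<Longrightarrow> e \<cdot> e = e \<Longrightarrow> \<exists>s. is_splitting C X e s"

text \<open>Together with biadditivity of the tensor product this forces the tensor product to be
  rational-bilinear.\<close>

locale rat_linear_category = additive_category +
  assumes Hom_module: "module rat_ring (hom_module C X Y)"
    and Comp_Scale: "f \<in> Hom C X Y \<Longrightarrow> g \<in> Hom C Y Z \<Longrightarrow> g \<cdot> Scale C q f = Scale C q (g \<cdot> f)"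
    and Scale_Comp: "f \<in> Hom C X Y \<Longrightarrow> g \<in> Hom C Y Z \<Longrightarrow> Scale C q g \<cdot> f = Scale C q (g \<cdot> f)"

context
  fixes C :: "('o, 'm) tensor_cat" (structure)
begin

primrec tensor_pow :: "'o \<Rightarrow> nat \<Rightarrow> 'o" where
  "tensor_pow X 0 = \<I>"
| "tensor_pow X (Suc n) = X \<otimes>\<^sub>o tensor_pow X n"

text \<open>The associativity isomorphism \<open>\<otimes>\<^sup>mX \<otimes> \<otimes>\<^sup>nX \<rightarrow> \<otimes>\<^sup>m\<^sup>+\<^sup>nX\<close>.\<close>

primrec tensor_pow_join :: "'o \<Rightarrow> nat \<Rightarrow> nat \<Rightarrow> 'm" where
  "tensor_pow_join X 0 n = Lunit C (tensor_pow X n)"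
| "tensor_pow_join X (Suc m) n =
     (\<^bold>1 X \<otimes>\<^sub>m tensor_pow_join X m n) \<cdot> Assoc C X (tensor_pow X m) (tensor_pow X n)"

definition swap_first :: "'o \<Rightarrow> nat \<Rightarrow> 'm" where
  "swap_first X n = Assoc C X X (tensor_pow X n) \<cdot> (\<tau> X X \<otimes>\<^sub>m \<^bold>1 (tensor_pow X n)) \<cdot>
     inv_Assoc C X X (tensor_pow X n)"

text \<open>For \<open>k \<le> n\<close>, the automorphism \<open>move_first X k n\<close> of \<open>\<otimes>\<^sup>n\<^sup>+\<^sup>1X\<close> takes the factor in
  position 0 to position \<open>k\<close> and keeps the order of the remaining \<open>n\<close> factors.\<close>

primrec move_first :: "'o \<Rightarrow> nat \<Rightarrow> nat \<Rightarrow> 'm" where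
  "move_first X 0 n = \<^bold>1 (tensor_pow X (Suc n))"
| "move_first X (Suc k) n = (\<^bold>1 X \<otimes>\<^sub>m move_first X k (n - 1)) \<cdot> swap_first X (n - 1)"

text \<open>The action of a permutation \<open>\<sigma>\<close> of \<open>{..<n}\<close> on \<open>\<otimes>\<^sup>nX\<close>, taking the factor in position
  \<open>k\<close> to position \<open>\<sigma> k\<close>: first permute the factors in positions \<open>1, \<dots>, n - 1\<close> into the order
  prescribed by \<open>\<sigma>\<close>, then move the factor in position 0 to position \<open>\<sigma> 0\<close>.\<close>

primrec perm_action :: "'o \<Rightarrow> nat \<Rightarrow> (nat \<Rightarrow> nat) \<Rightarrow> 'm" where
  "perm_action X 0 \<sigma> = \<^bold>1 \<I>"
| "perm_action X (Suc n) \<sigma> = move_first X (\<sigma> 0) n \<cdot>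
     (\<^bold>1 X \<otimes>\<^sub>m perm_action X n (\<lambda>k. if \<sigma> (Suc k) > \<sigma> 0 then \<sigma> (Suc k) - 1 else \<sigma> (Suc k)))"

definition symmetrizer :: "'o \<Rightarrow> nat \<Rightarrow> 'm" where
  "symmetrizer X n = Scale C (1 / fact n)
     (\<Oplus>\<^bsub>hom_module C (tensor_pow X n) (tensor_pow X n)\<^esub>\<sigma>\<in>{\<sigma>. \<sigma> permutes {..<n}}. perm_action X n \<sigma>)"

definition sym_splitting :: "'o \<Rightarrow> nat \<Rightarrow> 'o \<times> 'm \<times> 'm" where
  "sym_splitting X n = (SOME s. is_splitting C (tensor_pow X n) (symmetrizer X n) s)"

definition sym_pow :: "'o \<Rightarrow> nat \<Rightarrow> 'o" where
  "sym_pow X n = fst (sym_splitting X n)"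

definition sym_inj :: "'o \<Rightarrow> nat \<Rightarrow> 'm" where
  "sym_inj X n = fst (snd (sym_splitting X n))"

definition sym_proj :: "'o \<Rightarrow> nat \<Rightarrow> 'm" where
  "sym_proj X n = snd (snd (sym_splitting X n))"

definition sym_mult :: "'o \<Rightarrow> nat \<Rightarrow> nat \<Rightarrow> 'm" where
  "sym_mult X m n = sym_proj X (m + n) \<cdot> tensor_pow_join X m n \<cdot> (sym_inj X m \<otimes>\<^sub>m sym_inj X n)"

primrec tensor_pow_ev :: "'o \<Rightarrow> nat \<Rightarrow> 'm" where
  "tensor_pow_ev X 0 = Lunit C \<I>"
| "tensor_pow_ev X (Suc n) = Lunit C \<I> \<cdot> (dual_ev C X \<otimes>\<^sub>m tensor_pow_ev X n) \<cdot>
     interchange C (dual C X) (tensor_pow (dual C X) n) X (tensor_pow X n)"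

definition tensor_pow_ev_symm :: "'o \<Rightarrow> nat \<Rightarrow> 'm" where
  "tensor_pow_ev_symm X n =
     tensor_pow_ev X n \<cdot> \<tau> (tensor_pow X n) (tensor_pow (dual C X) n)"

text \<open>The pairing \<open>\<or>\<^sup>n(X\<^sup>\<or>) \<otimes> \<or>\<^sup>nX \<rightarrow> \<I>\<close> exhibiting \<open>\<or>\<^sup>n(X\<^sup>\<or>)\<close> as the dual of \<open>\<or>\<^sup>nX\<close>.\<close>

definition sym_ev :: "'o \<Rightarrow> nat \<Rightarrow> 'm" where
  "sym_ev X n = tensor_pow_ev X n \<cdot> (sym_inj (dual C X) n \<otimes>\<^sub>m sym_inj X n)"

text \<open>For \<open>m \<le> n\<close> and \<open>e : A \<otimes> \<otimes>\<^sup>mX \<rightarrow> \<I>\<close>, the morphism \<open>e \<otimes> 1\<close> from \<open>A \<otimes> \<otimes>\<^sup>nX\<close> to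
  \<open>\<otimes>\<^sup>n\<^sup>-\<^sup>mX\<close>.\<close>

definition contract :: "'o \<Rightarrow> 'o \<Rightarrow> nat \<Rightarrow> nat \<Rightarrow> 'm \<Rightarrow> 'm" where
  "contract A X m n e =
     Lunit C (tensor_pow X (n - m)) \<cdot> (e \<otimes>\<^sub>m \<^bold>1 (tensor_pow X (n - m))) \<cdot>
     inv_Assoc C A (tensor_pow X m) (tensor_pow X (n - m)) \<cdot>
     (\<^bold>1 A \<otimes>\<^sub>m iso_inv C (tensor_pow X m \<otimes>\<^sub>o tensor_pow X (n - m)) (tensor_pow X n)
        (tensor_pow_join X m (n - m)))"

definition iota_upper :: "'o \<Rightarrow> nat \<Rightarrow> nat \<Rightarrow> 'm" where
  "iota_upper V i g =
     curry_mor C (sym_pow V i) (sym_pow (dual C V) g) (sym_pow (dual C V) (g - i))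
       (sym_proj (dual C V) (g - i) \<cdot>
        contract (tensor_pow V i) (dual C V) i g (tensor_pow_ev_symm V i) \<cdot>
        (sym_inj V i \<otimes>\<^sub>m sym_inj (dual C V) g))"

definition iota_lower :: "'o \<Rightarrow> nat \<Rightarrow> nat \<Rightarrow> 'm" where
  "iota_lower V i g =
     curry_mor C (sym_pow (dual C V) i) (sym_pow V g) (sym_pow V (g - i))
       (sym_proj V (g - i) \<cdot>
        contract (tensor_pow (dual C V) i) V i g (tensor_pow_ev V i) \<cdot>
        (sym_inj (dual C V) i \<otimes>\<^sub>m sym_inj V g))"

definition D_upper :: "'o \<Rightarrow> nat \<Rightarrow> nat \<Rightarrow> 'm" where
  "D_upper V i g =
     iso_inv C (sym_pow (dual C V) (g - i) \<otimes>\<^sub>o sym_pow (dual C (dual C V)) g)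
       (IHom C (sym_pow (dual C V) g) (sym_pow (dual C V) (g - i)))
       (alpha_via C (sym_pow (dual C V) g) (sym_pow (dual C V) (g - i))
          (sym_pow (dual C (dual C V)) g) (sym_ev (dual C V) g)) \<cdot>
     iota_upper V i g"

definition D_lower :: "'o \<Rightarrow> nat \<Rightarrow> nat \<Rightarrow> 'm" where
  "D_lower V i g =
     iso_inv C (sym_pow V (g - i) \<otimes>\<^sub>o sym_pow (dual C V) g)
       (IHom C (sym_pow V g) (sym_pow V (g - i)))
       (alpha_via C (sym_pow V g) (sym_pow V (g - i)) (sym_pow (dual C V) g) (sym_ev V g)) \<cdot>
     iota_lower V i g"

definition perfect_pairing :: "'o \<Rightarrow> 'o \<Rightarrow> 'o \<Rightarrow> 'm \<Rightarrow> bool" where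
  "perfect_pairing X Y Z f \<longleftrightarrow>
     f \<in> Hom C (X \<otimes>\<^sub>o Y) Z \<and>
     is_isomorphism C X (IHom C Y Z) (curry_mor C X Y Z f) \<and>
     is_isomorphism C Y (IHom C X Z) (curry_mor C Y X Z (f \<cdot> \<tau> Y X))"

definition unit_scalar :: "rat \<Rightarrow> 'm" where
  "unit_scalar q = Scale C q (\<^bold>1 \<I>)"

primrec falling_factorial :: "'m \<Rightarrow> nat \<Rightarrow> 'm" where
  "falling_factorial t 0 = \<^bold>1 \<I>"
| "falling_factorial t (Suc k) = falling_factorial t k \<cdot> (t \<^bold>+ unit_scalar (- of_nat k))"

definition unit_binomial :: "'m \<Rightarrow> nat \<Rightarrow> 'm" where
  "unit_binomial t k = Scale C (1 / fact k) (falling_factorial t k)"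

definition shifted_rank :: "'o \<Rightarrow> nat \<Rightarrow> 'm" where
  "shifted_rank V g = tensor_rank C V \<^bold>+ unit_scalar (of_nat g - 1)"

definition has_symmetric_rank :: "'o \<Rightarrow> nat \<Rightarrow> bool" where
  "has_symmetric_rank V g \<longleftrightarrow> g \<ge> 1 \<and> invertible_object C (sym_pow V g) \<and>
     (\<forall>i\<le>g. is_isomorphism C \<I> \<I> (unit_binomial (shifted_rank V g) (g - i)) \<and>
            is_isomorphism C \<I> \<I> (unit_binomial (shifted_rank V g) i))"

definition has_strong_symmetric_rank :: "'o \<Rightarrow> nat \<Rightarrow> bool" where
  "has_strong_symmetric_rank V g \<longleftrightarrow> g \<ge> 1 \<and> invertible_object C (sym_pow V g) \<and>
     tensor_rank C V = unit_scalar (- of_nat g)"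

end

end

theory Submission
  imports Defs
begin

text \<open>
  Write \<open>e\<^sub>n\<close> for the symmetrizer, \<open>A = V\<close>, \<open>B = V\<^sup>\<or>\<close> and \<open>L = \<or>\<^sup>gV\<close>, and let \<open>i + j = g\<close>.
  Transposing the multiplications of the two symmetric algebras gives
  \<open>\<psi> : \<or>\<^sup>jB \<rightarrow> \<or>\<^sup>iA \<otimes> \<or>\<^sup>gB\<close> and \<open>\<psi>' : \<or>\<^sup>iA \<rightarrow> \<or>\<^sup>jB \<otimes> \<or>\<^sup>gA\<close>; up to canonical isomorphisms every
  map in the theorem is one of these. Contracting \<open>\<or>\<^sup>gB \<otimes> \<or>\<^sup>gA\<close> in \<open>(\<psi> \<otimes> 1) \<psi>'\<close> leaves the partial
  trace of \<open>e\<^sub>g\<close> over \<open>j\<close> factors. Since \<open>e\<^sub>n\<^sub>+\<^sub>1\<close> is the average over \<open>k\<close> of (move factor 0 to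
  position \<open>k\<close>) after \<open>1 \<otimes> e\<^sub>n\<close>, one partial trace turns \<open>e\<^sub>n\<^sub>+\<^sub>1\<close> into \<open>(r + n) / (n + 1)\<close> times \<open>e\<^sub>n\<close>,
  so the composite is \<open>(r + g - 1 choose j)\<close> times a nonzero rational number. By symmetry the
  opposite composite is governed by \<open>(r + g - 1 choose i)\<close>. As \<open>L\<close> is invertible, the contraction
  \<open>\<or>\<^sup>gB \<otimes> \<or>\<^sup>gA \<rightarrow> \<I>\<close> is an isomorphism, hence so are \<open>\<psi>\<close> and \<open>\<psi>'\<close>.

  The computations take place in the strict monoidal category whose objects are lists of objects and
  whose arrows are the arrows between right-nested tensor products.
\<close>

section \<open>Strict symmetric monoidal categories\<close>

text \<open>The nonzero rational number is 1 / (g choose j), so only the binomials in r can obstruct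
  invertibility. Both are required because each composite yields a one-sided inverse only.

  The recursion for \<open>e\<^sub>n\<^sub>+\<^sub>1\<close> treats its two sides differently.
  Invariance under transpositions on the left comes from the braid relation, but invariance on the
  right is not visible in it. It is obtained from left invariance for the dual object, carried over
  by the nondegenerate pairing of the tensor powers.

  The target of \<open>D^{i,g}\<close> contains the g-th symmetric power of the bidual, whereas
  \<open>\<psi>'\<close> ends in \<open>\<or>\<^sup>gA\<close>. The two targets are not compared.
  Invertibility of a morphism into hom(Y, Z) can be tested by composing with the coevaluation of any
  dual of Y, so \<open>\<or>\<^sup>gA\<close> serves as the dual of \<open>\<or>\<^sup>gB\<close> in
  this test, and the bidual enters only through the invertibility of \<alpha>.\<close>

primrec pw :: "'o list \<Rightarrow> nat \<Rightarrow> 'o list" where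
  "pw A 0 = []"
| "pw A (Suc n) = A @ pw A n"

lemma pw_comm [simp]: "pw A n @ A = A @ pw A n"
  by (induction n) auto

lemma pw_comm_append [simp]: "pw A n @ A @ xs = A @ pw A n @ xs"
  by (metis append_assoc pw_comm)

lemma pw_add: "pw A (m + n) = pw A m @ pw A n"
  by (induction m) auto

text \<open>
  \<open>wh U f U'\<close> stands for \<open>1\<^sub>U \<otimes> f \<otimes> 1\<^sub>U\<^sub>'\<close>. Composites of arrows that do not match are not
  arrows; this makes associativity and the functoriality of whiskering hold without side conditions.
\<close>

locale strict_smc =
  fixes arr :: "'a \<Rightarrow> bool"
    and src tgt :: "'a \<Rightarrow> 'o list"
    and idm :: "'o list \<Rightarrow> 'a"
    and cmp :: "'a \<Rightarrow> 'a \<Rightarrow> 'a"  (infixr "\<bullet>" 60)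
    and wh :: "'o list \<Rightarrow> 'a \<Rightarrow> 'o list \<Rightarrow> 'a"
    and sym :: "'o list \<Rightarrow> 'o list \<Rightarrow> 'a"
    and pls :: "'a \<Rightarrow> 'a \<Rightarrow> 'a"  (infixl "\<boxplus>" 55)
    and scl :: "rat \<Rightarrow> 'a \<Rightarrow> 'a"
  assumes arr_idm [simp]: "arr (idm X)"
    and src_idm [simp]: "src (idm X) = X"
    and tgt_idm [simp]: "tgt (idm X) = X"
    and arr_cmp [simp]: "arr (g \<bullet> f) \<longleftrightarrow> arr g \<and> arr f \<and> src g = tgt f"
    and src_cmp [simp]: "arr g \<Longrightarrow> arr f \<Longrightarrow> src g = tgt f \<Longrightarrow> src (g \<bullet> f) = src f"
    and tgt_cmp [simp]: "arr g \<Longrightarrow> arr f \<Longrightarrow> src g = tgt f \<Longrightarrow> tgt (g \<bullet> f) = tgt g"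
    and cmp_assoc: "(h \<bullet> g) \<bullet> f = h \<bullet> (g \<bullet> f)"
    and cmp_idm [simp]: "arr f \<Longrightarrow> src f = X \<Longrightarrow> f \<bullet> idm X = f"
    and idm_cmp [simp]: "arr f \<Longrightarrow> tgt f = X \<Longrightarrow> idm X \<bullet> f = f"
    and arr_wh [simp]: "arr (wh U f U') \<longleftrightarrow> arr f"
    and src_wh [simp]: "arr f \<Longrightarrow> src (wh U f U') = U @ src f @ U'"
    and tgt_wh [simp]: "arr f \<Longrightarrow> tgt (wh U f U') = U @ tgt f @ U'"
    and wh_cmp: "wh U (g \<bullet> f) U' = wh U g U' \<bullet> wh U f U'"
    and wh_idm [simp]: "wh U (idm X) U' = idm (U @ X @ U')"
    and wh_wh [simp]: "wh U (wh X f Y) U' = wh (U @ X) f (Y @ U')"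
    and wh_Nil [simp]: "arr f \<Longrightarrow> wh [] f [] = f"
    and interchange0: "arr f \<Longrightarrow> arr g \<Longrightarrow>
      wh [] f (tgt g) \<bullet> wh (src f) g [] = wh (tgt f) g [] \<bullet> wh [] f (src g)"
    and arr_sym [simp]: "arr (sym X Y)"
    and src_sym [simp]: "src (sym X Y) = X @ Y"
    and tgt_sym [simp]: "tgt (sym X Y) = Y @ X"
    and sym_natural: "arr f \<Longrightarrow> sym (tgt f) Z \<bullet> wh [] f Z = wh Z f [] \<bullet> sym (src f) Z"
    and sym_sym [simp]: "sym Y X \<bullet> sym X Y = idm (X @ Y)"
    and hexagon: "sym X (Y @ Z) = wh Y (sym X Z) [] \<bullet> wh [] (sym X Y) Z"
    and arr_pls [simp]: "arr f \<Longrightarrow> arr g \<Longrightarrow> src f = src g \<Longrightarrow> tgt f = tgt g \<Longrightarrow> arr (f \<boxplus> g)"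
    and src_pls [simp]: "arr f \<Longrightarrow> arr g \<Longrightarrow> src f = src g \<Longrightarrow> tgt f = tgt g \<Longrightarrow> src (f \<boxplus> g) = src f"
    and tgt_pls [simp]: "arr f \<Longrightarrow> arr g \<Longrightarrow> src f = src g \<Longrightarrow> tgt f = tgt g \<Longrightarrow> tgt (f \<boxplus> g) = tgt f"
    and arr_scl [simp]: "arr f \<Longrightarrow> arr (scl q f)"
    and src_scl [simp]: "arr f \<Longrightarrow> src (scl q f) = src f"
    and tgt_scl [simp]: "arr f \<Longrightarrow> tgt (scl q f) = tgt f"
    and pls_commute: "arr f \<Longrightarrow> arr g \<Longrightarrow> src f = src g \<Longrightarrow> tgt f = tgt g \<Longrightarrow> f \<boxplus> g = g \<boxplus> f"
    and pls_assoc: "arr f \<Longrightarrow> arr g \<Longrightarrow> arr h \<Longrightarrow> src f = src g \<Longrightarrow> tgt f = tgt g \<Longrightarrow>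
      src g = src h \<Longrightarrow> tgt g = tgt h \<Longrightarrow> (f \<boxplus> g) \<boxplus> h = f \<boxplus> (g \<boxplus> h)"
    and scl_add: "arr f \<Longrightarrow> scl (a + b) f = scl a f \<boxplus> scl b f"
    and scl_scl: "arr f \<Longrightarrow> scl a (scl b f) = scl (a * b) f"
    and pls_scl_0 [simp]: "arr f \<Longrightarrow> arr g \<Longrightarrow> src f = src g \<Longrightarrow> tgt f = tgt g \<Longrightarrow> f \<boxplus> scl 0 g = f"
    and scl_1 [simp]: "arr f \<Longrightarrow> scl 1 f = f"
    and scl_pls: "arr f \<Longrightarrow> arr g \<Longrightarrow> src f = src g \<Longrightarrow> tgt f = tgt g \<Longrightarrow>
      scl a (f \<boxplus> g) = scl a f \<boxplus> scl a g"
    and cmp_pls: "arr f \<Longrightarrow> arr g \<Longrightarrow> src f = src g \<Longrightarrow> tgt f = tgt g \<Longrightarrow> arr h \<Longrightarrow> src h = tgt f \<Longrightarrow>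
      h \<bullet> (f \<boxplus> g) = h \<bullet> f \<boxplus> h \<bullet> g"
    and pls_cmp: "arr f \<Longrightarrow> arr g \<Longrightarrow> src f = src g \<Longrightarrow> tgt f = tgt g \<Longrightarrow> arr h \<Longrightarrow> tgt h = src f \<Longrightarrow>
      (f \<boxplus> g) \<bullet> h = f \<bullet> h \<boxplus> g \<bullet> h"
    and cmp_scl: "arr f \<Longrightarrow> arr h \<Longrightarrow> src h = tgt f \<Longrightarrow> h \<bullet> scl a f = scl a (h \<bullet> f)"
    and scl_cmp: "arr f \<Longrightarrow> arr h \<Longrightarrow> src h = tgt f \<Longrightarrow> scl a h \<bullet> f = scl a (h \<bullet> f)"
    and wh_pls: "arr f \<Longrightarrow> arr g \<Longrightarrow> src f = src g \<Longrightarrow> tgt f = tgt g \<Longrightarrow>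
      wh U (f \<boxplus> g) U' = wh U f U' \<boxplus> wh U g U'"
    and wh_scl: "arr f \<Longrightarrow> wh U (scl a f) U' = scl a (wh U f U')"
begin

text \<open>Composites are kept nested to the right. This form and the next rewrite the beginning of
  such a composite; they have no typing premises because associativity has none.\<close>

lemma reassoc: "a \<bullet> b = c \<Longrightarrow> a \<bullet> (b \<bullet> x) = c \<bullet> x"
  by (metis cmp_assoc)

lemma reassoc2: "a \<bullet> b = c \<bullet> d \<Longrightarrow> a \<bullet> (b \<bullet> x) = c \<bullet> (d \<bullet> x)"
  by (metis cmp_assoc)

text \<open>Absorbing the gap \<open>M\<close> into the second arrow reduces this form to
  \<open>interchange0\<close>, whiskered by \<open>U\<close> and \<open>U'\<close>.\<close>

lemma interchange:
  assumes "arr f" "arr g" "src f = X" "tgt f = X'" "src g = Y" "tgt g = Y'"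
  shows "wh U f (M @ Y' @ U') \<bullet> wh (U @ X @ M) g U' = wh (U @ X' @ M) g U' \<bullet> wh U f (M @ Y @ U')"
proof -
  have "wh [] f (tgt (wh M g [])) \<bullet> wh (src f) (wh M g []) [] =
      wh (tgt f) (wh M g []) [] \<bullet> wh [] f (src (wh M g []))"
    by (rule interchange0) (use assms in auto)
  then have "wh U (wh [] f (tgt (wh M g [])) \<bullet> wh (src f) (wh M g []) []) U' =
      wh U (wh (tgt f) (wh M g []) [] \<bullet> wh [] f (src (wh M g []))) U'"
    by simp
  then show ?thesis using assms by (simp add: wh_cmp)
qed

text \<open>The hexagon with two empty words makes \<open>sym X []\<close> idempotent, and an
  invertible idempotent is an identity.\<close>

lemma sym_Nil_right [simp]: "sym X [] = idm X"
proof -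
  have *: "sym X [] = sym X [] \<bullet> sym X []"
    using hexagon[of X "[]" "[]"] by simp
  have "sym [] X \<bullet> sym X [] = sym [] X \<bullet> (sym X [] \<bullet> sym X [])"
    using * by simp
  then show ?thesis
    by (simp add: reassoc[OF sym_sym])
qed

lemma sym_Nil_left [simp]: "sym [] X = idm X"
  using sym_sym[of X "[]"] by simp

lemma sym_sym_wh [simp]: "wh U (sym Y X) U' \<bullet> wh U (sym X Y) U' = idm (U @ X @ Y @ U')"
  by (metis append_assoc sym_sym wh_cmp wh_idm)

lemma sym_sym_wh_cmp [simp]:
  "arr x \<Longrightarrow> tgt x = U @ X @ Y @ U' \<Longrightarrow> wh U (sym Y X) U' \<bullet> (wh U (sym X Y) U' \<bullet> x) = x"
  by (simp add: reassoc[OF sym_sym_wh])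

text \<open>By \<open>hexagon\<close> the right-hand side is a right inverse of
  \<open>sym Z (X @ Y)\<close>, whose inverse is the left-hand side.\<close>

lemma hexagon_left: "sym (X @ Y) Z = wh [] (sym X Z) Y \<bullet> wh X (sym Y Z) []"
proof -
  have 1: "sym Z (X @ Y) \<bullet> (wh [] (sym X Z) Y \<bullet> wh X (sym Y Z) []) = idm (X @ Y @ Z)"
    by (simp add: hexagon cmp_assoc)
  have "sym (X @ Y) Z \<bullet> (sym Z (X @ Y) \<bullet> (wh [] (sym X Z) Y \<bullet> wh X (sym Y Z) [])) = sym (X @ Y) Z"
    unfolding 1 by simp
  then show ?thesis by (subst (asm) reassoc[OF sym_sym]) simp
qed

lemma sym_natural_wh:
  "arr f \<Longrightarrow> src f = X \<Longrightarrow> tgt f = Y \<Longrightarrow>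
    wh U (sym Y Z) U' \<bullet> wh U f (Z @ U') = wh (U @ Z) f U' \<bullet> wh U (sym X Z) U'"
proof -
  assume a: "arr f" "src f = X" "tgt f = Y"
  then have "sym Y Z \<bullet> wh [] f Z = wh Z f [] \<bullet> sym X Z"
    using sym_natural by blast
  then have "wh U (sym Y Z \<bullet> wh [] f Z) U' = wh U (wh Z f [] \<bullet> sym X Z) U'" by simp
  then show ?thesis by (simp add: wh_cmp)
qed

lemma sym_natural_wh':
  assumes a: "arr f" "src f = X" "tgt f = Y"
  shows "wh U (sym Z Y) U' \<bullet> wh (U @ Z) f U' = wh U f (Z @ U') \<bullet> wh U (sym Z X) U'"
proof -
  have "wh U (sym Z Y) U' \<bullet> (wh (U @ Z) f U' \<bullet> wh U (sym X Z) U') \<bullet> wh U (sym Z X) U'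
     = wh U (sym Z Y) U' \<bullet> (wh U (sym Y Z) U' \<bullet> wh U f (Z @ U')) \<bullet> wh U (sym Z X) U'"
    using sym_natural_wh[OF a, of U Z U'] by simp
  then show ?thesis using a by (simp add: cmp_assoc)
qed

text \<open>The symmetry of the empty word with \<open>U\<close> is an identity, so its naturality
  carries a scalar across \<open>U\<close>.\<close>

lemma scalar_central: "arr r \<Longrightarrow> src r = [] \<Longrightarrow> tgt r = [] \<Longrightarrow> wh U r U' = wh [] r (U @ U')"
proof -
  assume r: "arr r" "src r = []" "tgt r = []"
  have "wh U r [] = wh [] r U" using sym_natural[of r U] r by simp
  then have "wh [] (wh U r []) U' = wh [] (wh [] r U) U'" by simp
  then show ?thesis by simp
qed

definition is_iso :: "'a \<Rightarrow> bool" where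
  "is_iso f \<longleftrightarrow> arr f \<and> (\<exists>h. arr h \<and> src h = tgt f \<and> tgt h = src f \<and> h \<bullet> f = idm (src f) \<and> f \<bullet> h = idm (tgt f))"

text \<open>The zigzag identities. This is a relation and not a choice of dual, because one object
  is used with several duals: a symmetric power of the dual is paired with that of the object and
  also with that of the bidual.\<close>

definition dual_pair :: "'o list \<Rightarrow> 'o list \<Rightarrow> 'a \<Rightarrow> 'a \<Rightarrow> bool" where
  "dual_pair A B ev co \<longleftrightarrow> arr ev \<and> src ev = B @ A \<and> tgt ev = [] \<and>
     arr co \<and> src co = [] \<and> tgt co = A @ B \<and>
     wh A ev [] \<bullet> wh [] co A = idm A \<and> wh [] ev B \<bullet> wh B co [] = idm B"

text \<open>Naturality of the symmetry with respect to \<open>ev\<close> and \<open>co\<close> turns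
  each zigzag for the exchanged roles into one of the given zigzags.\<close>

lemma dual_pair_swap:
  assumes "dual_pair A B ev co"
  shows "dual_pair B A (ev \<bullet> sym A B) (sym A B \<bullet> co)"
proof -
  have t [simp]: "arr ev" "src ev = B @ A" "tgt ev = []" "arr co" "src co = []" "tgt co = A @ B"
    and z1: "wh A ev [] \<bullet> wh [] co A = idm A" and z2: "wh [] ev B \<bullet> wh B co [] = idm B"
    using assms by (auto simp: dual_pair_def)
  \<comment> \<open>Rotating \<open>Y X Z\<close> twice by its first block moves \<open>Z\<close> to
    the front. This merges the crossings of the exchanged evaluation and coevaluation into a single
    one that \<open>ev\<close> or \<open>co\<close> can pass.\<close>
  have braid: "sym X (Z @ Y) \<bullet> sym Y (X @ Z) = sym (Y @ X) Z" for X Y Z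
  proof -
    have "sym X (Z @ Y) \<bullet> sym Y (X @ Z) =
        wh Z (sym X Y) [] \<bullet> (wh [] (sym X Z) Y \<bullet> wh X (sym Y Z) []) \<bullet> wh [] (sym Y X) Z"
      by (simp add: hexagon cmp_assoc)
    also have "\<dots> = wh Z (sym X Y) [] \<bullet> sym (X @ Y) Z \<bullet> wh [] (sym Y X) Z"
      by (simp add: hexagon_left cmp_assoc)
    also have "\<dots> = wh Z (sym X Y) [] \<bullet> wh Z (sym Y X) [] \<bullet> sym (Y @ X) Z"
      using sym_natural[of "sym Y X" Z] by (simp add: cmp_assoc)
    finally show ?thesis by simp
  qed
  have braid': "sym (Z @ X) Y \<bullet> sym (X @ Y) Z = sym X (Y @ Z)" for X Y Z
  proof -
    have "(sym (Z @ X) Y \<bullet> sym (X @ Y) Z) \<bullet> (sym Z (X @ Y) \<bullet> sym Y (Z @ X)) = idm (Y @ Z @ X)"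
      using reassoc[OF sym_sym, of "X @ Y" Z "sym Y (Z @ X)"] by (simp add: cmp_assoc)
    then have "((sym (Z @ X) Y \<bullet> sym (X @ Y) Z) \<bullet> sym (Y @ Z) X) \<bullet> sym X (Y @ Z) = sym X (Y @ Z)"
      by (simp add: braid cmp_assoc)
    then show ?thesis by (simp only: cmp_assoc) simp
  qed
  have s1: "wh B (ev \<bullet> sym A B) [] \<bullet> wh [] (sym A B \<bullet> co) B = idm B"
  proof -
    have "wh B (ev \<bullet> sym A B) [] \<bullet> wh [] (sym A B \<bullet> co) B =
        wh B ev [] \<bullet> sym A (B @ B) \<bullet> wh [] co B"
      by (simp add: hexagon wh_cmp cmp_assoc)
    also have "wh [] co B = sym B (A @ B) \<bullet> wh B co []"
      using sym_natural_wh'[of co "[]" "A @ B" "[]" B "[]"] by simp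
    also have "wh B ev [] \<bullet> sym A (B @ B) \<bullet> sym B (A @ B) \<bullet> wh B co []
       = wh B ev [] \<bullet> sym (B @ A) B \<bullet> wh B co []"
      by (simp add: reassoc[OF braid])
    also have "\<dots> = idm B"
      using sym_natural[of ev B, symmetric] by (simp add: z2 flip: cmp_assoc)
    finally show ?thesis .
  qed
  have s2: "wh [] (ev \<bullet> sym A B) A \<bullet> wh A (sym A B \<bullet> co) [] = idm A"
  proof -
    have "wh [] (ev \<bullet> sym A B) A \<bullet> wh A (sym A B \<bullet> co) [] =
        wh [] ev A \<bullet> sym (A @ A) B \<bullet> wh A co []"
      by (simp add: hexagon_left wh_cmp cmp_assoc)
    also have "wh [] ev A = wh A ev [] \<bullet> sym (B @ A) A"
      using sym_natural_wh[of ev "B @ A" "[]" "[]" A "[]"] by simp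
    also have "(wh A ev [] \<bullet> sym (B @ A) A) \<bullet> sym (A @ A) B \<bullet> wh A co []
       = wh A ev [] \<bullet> sym A (A @ B) \<bullet> wh A co []"
    proof -
      show ?thesis by (simp add: cmp_assoc reassoc[OF braid'])
    qed
    also have "\<dots> = idm A"
      using sym_natural_wh'[of co "[]" "A @ B" "[]" A "[]"] by (simp add: z1)
    finally show ?thesis .
  qed
  show ?thesis using s1 s2 by (simp add: dual_pair_def)
qed

end

context strict_smc
begin

lemma sym_sym_cmp [simp]: "arr x \<Longrightarrow> tgt x = X @ Y \<Longrightarrow> sym Y X \<bullet> (sym X Y \<bullet> x) = x"
  by (simp add: reassoc[OF sym_sym])

section \<open>The symmetrizer\<close>

text \<open>The sum over \<open>k \<le> n\<close> of the automorphisms of \<open>A\<^sup>n\<^sup>+\<^sup>1\<close> that move factor 0 to position \<open>k\<close>.\<close>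

primrec coset_sum :: "'o list \<Rightarrow> nat \<Rightarrow> 'a" where
  "coset_sum A 0 = idm A"
| "coset_sum A (Suc n) =
     idm (pw A (n + 2)) \<boxplus> wh A (coset_sum A n) [] \<bullet> wh [] (sym A A) (pw A n)"

text \<open>No permutations occur in the strict setting; \<open>L_symmetrizer\<close> identifies
  this recursion with the average over the symmetric group.\<close>

primrec symmer :: "'o list \<Rightarrow> nat \<Rightarrow> 'a" where
  "symmer A 0 = idm []"
| "symmer A (Suc n) = scl (1 / of_nat (Suc n)) (coset_sum A n \<bullet> wh A (symmer A n) [])"

lemma coset_sum_typ [simp]:
  "arr (coset_sum A n)" "src (coset_sum A n) = pw A (Suc n)" "tgt (coset_sum A n) = pw A (Suc n)"
  by (induction n) auto

lemma symmer_typ [simp]: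
  "arr (symmer A n)" "src (symmer A n) = pw A n" "tgt (symmer A n) = pw A n"
  by (induction n) auto

text \<open>Invariance under the symmetric group, tested on its generators, the adjacent
  transpositions. The words \<open>U\<close> and \<open>U'\<close> allow the block of copies of
  \<open>A\<close> to sit inside a longer word.\<close>

definition left_absorbs :: "'o list \<Rightarrow> 'o list \<Rightarrow> nat \<Rightarrow> 'o list \<Rightarrow> 'a \<Rightarrow> bool" where
  "left_absorbs A U n U' y \<longleftrightarrow> arr y \<and> tgt y = U @ pw A n @ U' \<and>
     (\<forall>k m. n = k + m + 2 \<longrightarrow> wh (U @ pw A k) (sym A A) (pw A m @ U') \<bullet> y = y)"

definition right_absorbs :: "'o list \<Rightarrow> 'o list \<Rightarrow> nat \<Rightarrow> 'o list \<Rightarrow> 'a \<Rightarrow> bool" where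
  "right_absorbs A U n U' x \<longleftrightarrow> arr x \<and> src x = U @ pw A n @ U' \<and>
     (\<forall>k m. n = k + m + 2 \<longrightarrow> x \<bullet> wh (U @ pw A k) (sym A A) (pw A m @ U') = x)"

lemma left_absorbs_shift: "left_absorbs A U (Suc n) U' y \<Longrightarrow> left_absorbs A (U @ A) n U' y"
  unfolding left_absorbs_def
  by (auto, metis add_Suc append_assoc pw.simps(2))

lemma right_absorbs_shift: "right_absorbs A U (Suc n) U' x \<Longrightarrow> right_absorbs A (U @ A) n U' x"
  unfolding right_absorbs_def
  by (auto, metis add_Suc append_assoc pw.simps(2))

lemma scl_Suc: "arr y \<Longrightarrow> y \<boxplus> scl (of_nat n) y = scl (of_nat (Suc n)) y"
  by (simp add: scl_add)

text \<open>Each of the n + 1 summands is a word in adjacent transpositions, and all of these fix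
  \<open>y\<close>.\<close>

lemma coset_sum_left:
  "left_absorbs A U (Suc n) U' y \<Longrightarrow> wh U (coset_sum A n) U' \<bullet> y = scl (of_nat (Suc n)) y"
proof (induction n arbitrary: U)
  case 0
  then show ?case by (simp add: left_absorbs_def)
next
  case (Suc n)
  have t [simp]: "arr y" "tgt y = U @ A @ A @ pw A n @ U'"
    and s: "wh U (sym A A) (pw A n @ U') \<bullet> y = y"
    using Suc.prems unfolding left_absorbs_def by (auto dest: spec[of _ "0::nat"])
  have "wh (U @ A) (coset_sum A n) U' \<bullet> y = scl (of_nat (Suc n)) y"
    using Suc.IH left_absorbs_shift[OF Suc.prems] by blast
  then show ?case
    by (simp add: wh_pls wh_cmp pls_cmp cmp_assoc s scl_Suc del: of_nat_Suc)
qed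

lemma coset_sum_right:
  "right_absorbs A U (Suc n) U' x \<Longrightarrow> x \<bullet> wh U (coset_sum A n) U' = scl (of_nat (Suc n)) x"
proof (induction n arbitrary: U)
  case 0
  then show ?case by (simp add: right_absorbs_def)
next
  case (Suc n)
  have t [simp]: "arr x" "src x = U @ A @ A @ pw A n @ U'"
    and s: "x \<bullet> wh U (sym A A) (pw A n @ U') = x"
    using Suc.prems unfolding right_absorbs_def by (auto dest: spec[of _ "0::nat"])
  have *: "x \<bullet> wh (U @ A) (coset_sum A n) U' = scl (of_nat (Suc n)) x"
    using Suc.IH right_absorbs_shift[OF Suc.prems] by blast
  show ?case
    by (simp add: wh_pls wh_cmp cmp_pls reassoc[OF *] scl_cmp s scl_Suc del: of_nat_Suc)
qed

text \<open>At each level of the recursion the coset sum multiplies by its number of terms and the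
  normalisation divides by it again.\<close>

lemma symmer_left: "left_absorbs A U n U' y \<Longrightarrow> wh U (symmer A n) U' \<bullet> y = y"
proof (induction n arbitrary: U)
  case 0
  then show ?case by (simp add: left_absorbs_def)
next
  case (Suc n)
  have t [simp]: "arr y" "tgt y = U @ A @ pw A n @ U'"
    using Suc.prems by (auto simp: left_absorbs_def)
  have "wh (U @ A) (symmer A n) U' \<bullet> y = y"
    using Suc.IH left_absorbs_shift[OF Suc.prems] by blast
  then show ?case using coset_sum_left[OF Suc.prems]
    by (simp add: wh_scl wh_cmp scl_cmp cmp_assoc scl_scl)
qed

lemma symmer_right: "right_absorbs A U n U' x \<Longrightarrow> x \<bullet> wh U (symmer A n) U' = x"
proof (induction n arbitrary: U)
  case 0
  then show ?case by (simp add: right_absorbs_def)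
next
  case (Suc n)
  have t [simp]: "arr x" "src x = U @ A @ pw A n @ U'"
    using Suc.prems by (auto simp: right_absorbs_def)
  have "x \<bullet> wh (U @ A) (symmer A n) U' = x"
    using Suc.IH right_absorbs_shift[OF Suc.prems] by blast
  then show ?case using coset_sum_right[OF Suc.prems]
    by (simp add: wh_scl wh_cmp scl_cmp cmp_scl reassoc scl_scl)
qed

text \<open>Naturality of the crossing of \<open>A @ A\<close> with \<open>A\<close>, applied to
  \<open>sym A A\<close> itself; \<open>hexagon_left\<close> expands both block crossings.\<close>

lemma braid: "wh [] (sym A A) A \<bullet> wh A (sym A A) [] \<bullet> wh [] (sym A A) A =
    wh A (sym A A) [] \<bullet> wh [] (sym A A) A \<bullet> wh A (sym A A) []"
  using sym_natural_wh[of "sym A A" "A @ A" "A @ A" "[]" A "[]"]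
  by (simp add: hexagon_left cmp_assoc)

lemma braid_wh: "wh U (sym A A) (A @ U') \<bullet> wh (U @ A) (sym A A) U' \<bullet> wh U (sym A A) (A @ U') \<bullet> y =
    wh (U @ A) (sym A A) U' \<bullet> wh U (sym A A) (A @ U') \<bullet> wh (U @ A) (sym A A) U' \<bullet> y"
proof -
  have "wh U (wh [] (sym A A) A \<bullet> wh A (sym A A) [] \<bullet> wh [] (sym A A) A) U' =
    wh U (wh A (sym A A) [] \<bullet> wh [] (sym A A) A \<bullet> wh A (sym A A) []) U'"
    by (simp only: braid)
  then have "(wh U (sym A A) (A @ U') \<bullet> wh (U @ A) (sym A A) U' \<bullet> wh U (sym A A) (A @ U')) \<bullet> y =
    (wh (U @ A) (sym A A) U' \<bullet> wh U (sym A A) (A @ U') \<bullet> wh (U @ A) (sym A A) U') \<bullet> y"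
    by (simp add: wh_cmp)
  then show ?thesis by (simp only: cmp_assoc)
qed

text \<open>
  With \<open>E = 1 \<otimes> e\<^sub>n\<^sub>+\<^sub>1\<close> and \<open>Q\<close> the coset sum, \<open>e\<^sub>n\<^sub>+\<^sub>2\<close> is proportional to
  \<open>E + (1 \<otimes> Q) s\<^sub>0 E\<close>. For \<open>s\<^sub>0\<close> one uses the braid relation; for \<open>s\<^sub>k\<close> with \<open>k > 0\<close> one inserts
  \<open>E = (1 \<otimes> 1 \<otimes> e\<^sub>n) E\<close> and moves \<open>1 \<otimes> 1 \<otimes> e\<^sub>n\<close> past \<open>s\<^sub>0\<close> to recover a multiple of
  \<open>1 \<otimes> e\<^sub>n\<^sub>+\<^sub>1\<close> to the right of \<open>s\<^sub>k\<close>.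
\<close>

lemma symmer_left_absorbs: "left_absorbs A [] n [] (symmer A n)"
proof (induction n rule: less_induct)
  case (less n)
  show ?case
  proof (cases "n < 2")
    case True
    then show ?thesis by (auto simp: left_absorbs_def)
  next
    case False
    then obtain n' where n: "n = Suc (Suc n')"
      by (metis One_nat_def Suc_1 less_2_cases_iff not0_implies_Suc)
    define E where "E = wh A (symmer A (Suc n')) []"
    define q where "q = coset_sum A n'"
    have [simp]: "arr E" "src E = A @ A @ pw A n'" "tgt E = A @ A @ pw A n'"
      "arr q" "src q = A @ pw A n'" "tgt q = A @ pw A n'"
      by (auto simp: E_def q_def)
    have ih: "left_absorbs A [] (Suc n') [] (symmer A (Suc n'))" "left_absorbs A [] n' [] (symmer A n')"
      using less n by (auto simp del: symmer.simps)
    have adjE: "wh (A @ pw A k) (sym A A) (pw A m) \<bullet> E = E" if "Suc n' = k + m + 2" for k m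
    proof -
      have "wh (pw A k) (sym A A) (pw A m) \<bullet> symmer A (Suc n') = symmer A (Suc n')"
        using ih(1) that unfolding left_absorbs_def by simp
      then have "wh A (wh (pw A k) (sym A A) (pw A m) \<bullet> symmer A (Suc n')) [] = E"
        by (simp only: E_def)
      then show ?thesis by (simp only: wh_cmp E_def[symmetric]) simp
    qed
    have sE: "symmer A n = scl (1 / of_nat n) (E \<boxplus> wh A q [] \<bullet> wh [] (sym A A) (pw A n') \<bullet> E)"
      by (simp add: n E_def q_def pls_cmp cmp_assoc)
    have main: "wh (pw A k) (sym A A) (pw A m) \<bullet> (E \<boxplus> wh A q [] \<bullet> wh [] (sym A A) (pw A n') \<bullet> E)
        = E \<boxplus> wh A q [] \<bullet> wh [] (sym A A) (pw A n') \<bullet> E"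
      if km: "n = k + m + 2" for k m
    proof (cases k)
      case 0
      then have m: "m = n'" using km n by simp
      let ?s = "wh [] (sym A A) (pw A n')"
      show ?thesis
      proof (cases n')
        case 0
        \<comment> \<open>For n = 2 the summands are the identity and the transposition, which
          change places.\<close>
        then show ?thesis using m \<open>k = 0\<close>
          by (simp add: q_def cmp_pls, subst pls_commute) (auto simp: cmp_assoc)
      next
        case (Suc l)
        define q' where "q' = coset_sum A l"
        let ?t = "wh A (sym A A) (pw A l)"
        have [simp]: "arr q'" "src q' = A @ pw A l" "tgt q' = A @ pw A l"
          by (auto simp: q'_def)
        have tE: "?t \<bullet> E = E"
          using adjE[of 0 l] Suc by simp
        have Q: "wh A q [] = idm (pw A n) \<boxplus> wh (A @ A) q' [] \<bullet> ?t"
          by (simp add: q_def Suc q'_def wh_pls wh_cmp n)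
        have qs: "?s \<bullet> wh (A @ A) q' [] = wh (A @ A) q' [] \<bullet> ?s"
          using interchange[of "sym A A" q' "A @ A" "A @ A" "A @ pw A l" "A @ pw A l" "[]" "[]" "[]"]
          by (simp add: Suc)
        have br: "?s \<bullet> ?t \<bullet> ?s \<bullet> E = ?t \<bullet> ?s \<bullet> ?t \<bullet> E"
          using braid_wh[of "[]" A "pw A l" E] by (simp add: Suc)
        have Qs: "wh A q [] \<bullet> ?s \<bullet> E = ?s \<bullet> E \<boxplus> wh (A @ A) q' [] \<bullet> ?t \<bullet> ?s \<bullet> E"
          by (simp add: Q pls_cmp cmp_assoc Suc n)
        have "?s \<bullet> (E \<boxplus> wh A q [] \<bullet> ?s \<bullet> E) =
            ?s \<bullet> E \<boxplus> (?s \<bullet> ?s \<bullet> E \<boxplus> ?s \<bullet> wh (A @ A) q' [] \<bullet> ?t \<bullet> ?s \<bullet> E)"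
          unfolding Qs by (simp add: cmp_pls Suc)
        \<comment> \<open>The terms with at least two transpositions are fixed one by one:
          \<open>?s\<close> commutes with \<open>q'\<close>, and the braid relation with
          \<open>?t \<bullet> E = E\<close> reduces
          \<open>?s \<bullet> ?t \<bullet> ?s \<bullet> E\<close> to
          \<open>?t \<bullet> ?s \<bullet> E\<close>. The two remaining terms, \<open>E\<close> and
          \<open>?s \<bullet> E\<close>, are exchanged.\<close>
        also have "?s \<bullet> wh (A @ A) q' [] \<bullet> ?t \<bullet> ?s \<bullet> E = wh (A @ A) q' [] \<bullet> ?t \<bullet> ?s \<bullet> E"
          by (simp add: reassoc2[OF qs] br tE)
        also have "?s \<bullet> ?s \<bullet> E = E" by (simp add: Suc)
        also have "?s \<bullet> E \<boxplus> (E \<boxplus> wh (A @ A) q' [] \<bullet> ?t \<bullet> ?s \<bullet> E)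
            = E \<boxplus> (?s \<bullet> E \<boxplus> wh (A @ A) q' [] \<bullet> ?t \<bullet> ?s \<bullet> E)"
          by (subst (1 2) pls_assoc[symmetric]; (subst pls_commute[of "?s \<bullet> E" E])?)
            (auto simp: Suc)
        finally show ?thesis using \<open>k = 0\<close> m by (simp add: Qs)
      qed
    next
      case (Suc k')
      then have km': "Suc n' = k' + m + 2" using km n by simp
      let ?s = "wh [] (sym A A) (pw A n')"
      let ?a = "wh (pw A k') (sym A A) (pw A m)"
      have "n' = Suc (k' + m)" using km' by simp
      then have pw1: "pw A n' = A @ pw A k' @ pw A m"
        by (simp add: pw_add)
      have aE: "wh (A @ pw A k') (sym A A) (pw A m) \<bullet> E = E"
        using adjE[OF km'] .
      have eE: "wh (A @ A) (symmer A n') [] \<bullet> E = E"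
      proof -
        have "wh A (symmer A n') [] \<bullet> symmer A (Suc n') = symmer A (Suc n')"
          using symmer_left[OF left_absorbs_shift[OF ih(1)]] by simp
        then have "wh A (wh A (symmer A n') [] \<bullet> symmer A (Suc n')) [] = E"
          by (simp only: E_def)
        then show ?thesis by (simp only: wh_cmp E_def[symmetric]) simp
      qed
      have es: "?s \<bullet> wh (A @ A) (symmer A n') [] = wh (A @ A) (symmer A n') [] \<bullet> ?s"
        using interchange[of "sym A A" "symmer A n'" "A @ A" "A @ A" "pw A n'" "pw A n'" "[]" "[]" "[]"]
        by simp
      have qe: "q \<bullet> wh A (symmer A n') [] = scl (of_nat (Suc n')) (symmer A (Suc n'))"
        by (simp add: q_def scl_scl)
      have as: "?a \<bullet> symmer A (Suc n') = symmer A (Suc n')"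
        using ih(1) km' unfolding left_absorbs_def by (simp del: symmer.simps)
      have "?a \<bullet> (q \<bullet> wh A (symmer A n') []) = q \<bullet> wh A (symmer A n') []"
        unfolding qe using as by (simp add: cmp_scl pw1 del: symmer.simps)
      then have "wh A (?a \<bullet> (q \<bullet> wh A (symmer A n') [])) [] = wh A (q \<bullet> wh A (symmer A n') []) []"
        by simp
      then have aq: "wh (A @ pw A k') (sym A A) (pw A m) \<bullet> wh A q [] \<bullet> wh (A @ A) (symmer A n') []
          = wh A q [] \<bullet> wh (A @ A) (symmer A n') []"
        by (simp add: wh_cmp)
      have sE': "?s \<bullet> E = wh (A @ A) (symmer A n') [] \<bullet> ?s \<bullet> E"
        by (metis reassoc2[OF es] eE)
      have "wh (A @ pw A k') (sym A A) (pw A m) \<bullet> wh A q [] \<bullet> ?s \<bullet> E = wh A q [] \<bullet> ?s \<bullet> E"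
        by (subst (1 2) sE') (metis aq cmp_assoc)
      then show ?thesis using aE by (simp add: Suc cmp_pls pw1)
    qed
    have pwn: "n = k + m + 2 \<Longrightarrow> A @ A @ pw A n' = A @ A @ pw A k @ pw A m" for k m
      using n by (simp add: pw_add)
    show ?thesis unfolding left_absorbs_def sE
      using main pwn by (auto simp: cmp_scl n)
  qed
qed

end

lemma pw_swap: "pw A m @ pw A n = pw A n @ pw A m"
  by (metis add.commute pw_add)

context strict_smc
begin

lemma absorbs_sub_eq:
  "wh (U @ pw A k @ pw A k') f (pw A m' @ pw A m @ U') = wh (U @ pw A (k + k')) f (pw A (m' + m) @ U')"
  by (simp add: pw_add)

lemma left_absorbs_sub:
  assumes "left_absorbs A U (k + n + m) U' y"
  shows "left_absorbs A (U @ pw A k) n (pw A m @ U') y"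
  unfolding left_absorbs_def
proof (intro conjI allI impI)
  show "arr y" "tgt y = (U @ pw A k) @ pw A n @ (pw A m @ U')"
    using assms by (auto simp: left_absorbs_def pw_add)
  fix k' m' assume "n = k' + m' + 2"
  then have "k + n + m = (k + k') + (m' + m) + 2" by simp
  then show "wh ((U @ pw A k) @ pw A k') (sym A A) (pw A m' @ pw A m @ U') \<bullet> y = y"
    using assms unfolding left_absorbs_def by (metis absorbs_sub_eq append_assoc)
qed

lemma right_absorbs_sub:
  assumes "right_absorbs A U (k + n + m) U' y"
  shows "right_absorbs A (U @ pw A k) n (pw A m @ U') y"
  unfolding right_absorbs_def
proof (intro conjI allI impI)
  show "arr y" "src y = (U @ pw A k) @ pw A n @ (pw A m @ U')"
    using assms by (auto simp: right_absorbs_def pw_add)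
  fix k' m' assume "n = k' + m' + 2"
  then have "k + n + m = (k + k') + (m' + m) + 2" by simp
  then show "y \<bullet> wh ((U @ pw A k) @ pw A k') (sym A A) (pw A m' @ pw A m @ U') = y"
    using assms unfolding right_absorbs_def by (metis absorbs_sub_eq append_assoc)
qed

lemma symmer_idem: "symmer A n \<bullet> symmer A n = symmer A n"
  using symmer_left[OF symmer_left_absorbs] by simp

text \<open>Nondegeneracy of the evaluation: attaching the coevaluation to the pairing with
  \<open>x\<close> rebuilds \<open>x\<close> by a zigzag.\<close>

lemma dual_pair_cancel_right:
  assumes "dual_pair X Y e c" "arr x" "arr y" "tgt x = X" "tgt y = X" "src x = S" "src y = S"
    and "e \<bullet> wh Y x [] = e \<bullet> wh Y y []"
  shows "x = y"
proof -
  have e [simp]: "arr e" "src e = Y @ X" "tgt e = []" "arr c" "src c = []" "tgt c = X @ Y"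
    and z: "wh X e [] \<bullet> wh [] c X = idm X"
    using assms(1) by (auto simp: dual_pair_def)
  have "x = wh X (e \<bullet> wh Y x []) [] \<bullet> wh [] c S" if "arr x" "tgt x = X" "src x = S" for x
  proof -
    have "x = (wh X e [] \<bullet> wh [] c X) \<bullet> x" using z that by simp
    also have "\<dots> = wh X e [] \<bullet> wh (X @ Y) x [] \<bullet> wh [] c S"
      using interchange[of c x "[]" "X @ Y" S X "[]" "[]" "[]"] that by (simp add: cmp_assoc)
    finally show ?thesis by (simp add: wh_cmp cmp_assoc)
  qed
  then show ?thesis using assms by metis
qed

lemma dual_pair_cancel_left:
  assumes "dual_pair X Y e c" "arr x" "arr y" "tgt x = Y" "tgt y = Y" "src x = S" "src y = S"
    and "e \<bullet> wh [] x X = e \<bullet> wh [] y X"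
  shows "x = y"
proof -
  have e [simp]: "arr e" "src e = Y @ X" "tgt e = []" "arr c" "src c = []" "tgt c = X @ Y"
    and z: "wh [] e Y \<bullet> wh Y c [] = idm Y"
    using assms(1) by (auto simp: dual_pair_def)
  have "x = wh [] (e \<bullet> wh [] x X) Y \<bullet> wh S c []" if "arr x" "tgt x = Y" "src x = S" for x
  proof -
    have "x = (wh [] e Y \<bullet> wh Y c []) \<bullet> x" using z that by simp
    also have "\<dots> = wh [] e Y \<bullet> wh [] x (X @ Y) \<bullet> wh S c []"
      using interchange[of x c S Y "[]" "X @ Y" "[]" "[]" "[]"] that by (simp add: cmp_assoc)
    finally show ?thesis by (simp add: wh_cmp cmp_assoc)
  qed
  then show ?thesis using assms by metis
qed

section \<open>Duality and traces\<close>

text \<open>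
  The nested pairing matches the last factor of \<open>B\<^sup>n\<close> with the first factor of \<open>A\<^sup>n\<close>, so that its
  diagrams are planar. It differs from the pairing of the k-th factors by a reversal, which the
  symmetrizer absorbs.
\<close>

primrec nested_ev :: "'o list \<Rightarrow> 'o list \<Rightarrow> 'a \<Rightarrow> nat \<Rightarrow> 'a" where
  "nested_ev A B e 0 = idm []"
| "nested_ev A B e (Suc n) = nested_ev A B e n \<bullet> wh (pw B n) e (pw A n)"

primrec nested_co :: "'o list \<Rightarrow> 'o list \<Rightarrow> 'a \<Rightarrow> nat \<Rightarrow> 'a" where
  "nested_co A B c 0 = idm []"
| "nested_co A B c (Suc n) = wh (pw A n) c (pw B n) \<bullet> nested_co A B c n"

text \<open>A strand \<open>Z\<close> may leave a pairing on either side. This is naturality of the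
  symmetry with respect to \<open>e\<close>, whose target is the empty word.\<close>

lemma pairing_slide:
  assumes [simp]: "arr e" "src e = Y @ X" "tgt e = []"
  shows "wh [] e Z \<bullet> wh Y (sym Z X) [] = wh Z e [] \<bullet> wh [] (sym Y Z) X"
proof -
  have "wh [] e Z = wh Z e [] \<bullet> wh [] (sym Y Z) X \<bullet> wh Y (sym X Z) []"
    using sym_natural[of e Z] by (simp add: hexagon_left)
  then show ?thesis by (simp add: cmp_assoc)
qed

primrec fall :: "'a \<Rightarrow> nat \<Rightarrow> 'a" where
  "fall t 0 = idm []"
| "fall t (Suc k) = fall t k \<bullet> (t \<boxplus> scl (- of_nat k) (idm []))"

lemma fall_typ [simp]:
  assumes "arr t" "src t = []" "tgt t = []"
  shows "arr (fall t k)" "src (fall t k) = []" "tgt (fall t k) = []"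
  using assms by (induction k) auto

text \<open>Peels off the top factor instead of the last one, which is the order in which successive
  partial traces produce the factors.\<close>

lemma fall_Suc_left:
  assumes [simp]: "arr t" "src t = []" "tgt t = []"
  shows "fall t (Suc k) = t \<bullet> fall (t \<boxplus> scl (-1) (idm [])) k"
proof (induction k)
  case 0
  show ?case by simp
next
  case (Suc k)
  have e: "t \<boxplus> scl (- of_nat (Suc k)) (idm []) = (t \<boxplus> scl (-1) (idm [])) \<boxplus> scl (- of_nat k) (idm [])"
    using scl_add[of "idm []" "-1" "- of_nat k"] by (simp add: pls_assoc)
  have "fall t (Suc (Suc k)) = fall t (Suc k) \<bullet> (t \<boxplus> scl (- of_nat (Suc k)) (idm []))"
    by (simp only: fall.simps)
  also have "\<dots> = t \<bullet> fall (t \<boxplus> scl (-1) (idm [])) k \<bullet>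
      ((t \<boxplus> scl (-1) (idm [])) \<boxplus> scl (- of_nat k) (idm []))"
    unfolding Suc.IH e by (simp only: cmp_assoc)
  also have "\<dots> = t \<bullet> fall (t \<boxplus> scl (-1) (idm [])) (Suc k)"
    by (simp only: fall.simps)
  finally show ?case .
qed

end

locale dual_objects = strict_smc +
  fixes A B ev co
  assumes dual: "dual_pair A B ev co"
begin

lemma ev_typ [simp]: "arr ev" "src ev = B @ A" "tgt ev = []"
  and co_typ [simp]: "arr co" "src co = []" "tgt co = A @ B"
  and zig: "wh A ev [] \<bullet> wh [] co A = idm A" and zag: "wh [] ev B \<bullet> wh B co [] = idm B"
  using dual by (auto simp: dual_pair_def)

abbreviation nev where "nev \<equiv> nested_ev A B ev"
abbreviation nco where "nco \<equiv> nested_co A B co"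
abbreviation coi where "coi \<equiv> sym A B \<bullet> co"
abbreviation ncoi where "ncoi \<equiv> nested_co B A coi"

lemma nev_typ [simp]: "arr (nev n)" "src (nev n) = pw B n @ pw A n" "tgt (nev n) = []"
  by (induction n) auto

lemma nco_typ [simp]: "arr (nco n)" "src (nco n) = []" "tgt (nco n) = pw A n @ pw B n"
  by (induction n) auto

lemma ncoi_typ [simp]: "arr (ncoi n)" "src (ncoi n) = []" "tgt (ncoi n) = pw B n @ pw A n"
  by (induction n) auto

lemma nev_add: "nev (m + n) = nev m \<bullet> wh (pw B m) (nev n) (pw A m)"
proof (induction n)
  case (Suc n)
  have "nev (m + Suc n) = nev (m + n) \<bullet> wh (pw B (m + n)) ev (pw A (n + m))"
    by (simp add: add.commute)
  then show ?case unfolding Suc.IH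
    by (simp add: pw_add wh_cmp cmp_assoc)
qed simp

lemma nco_add: "nco (m + n) = wh (pw A m) (nco n) (pw B m) \<bullet> nco m"
proof (induction n)
  case (Suc n)
  have "nco (m + Suc n) = wh (pw A (m + n)) co (pw B (n + m)) \<bullet> nco (m + n)"
    by (simp add: add.commute)
  then show ?case unfolding Suc.IH
    by (simp add: pw_add wh_cmp cmp_assoc)
qed simp

lemma nested_dual_pair: "dual_pair (pw A n) (pw B n) (nev n) (nco n)"
proof (induction n)
  case 0
  then show ?case by (simp add: dual_pair_def)
next
  case (Suc n)
  then have z: "wh (pw A n) (nev n) [] \<bullet> wh [] (nco n) (pw A n) = idm (pw A n)"
    and z': "wh [] (nev n) (pw B n) \<bullet> wh (pw B n) (nco n) [] = idm (pw B n)"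
    by (auto simp: dual_pair_def)
  \<comment> \<open>The recursion adds the new coevaluation innermost. Here the outermost one is
    split off, since in the zigzag it meets the innermost evaluation.\<close>
  have c: "nco (Suc n) = wh A (nco n) B \<bullet> co"
    using nco_add[of 1 n] by simp
  have 1: "wh (pw A (Suc n)) (nev (Suc n)) [] \<bullet> wh [] (nco (Suc n)) (pw A (Suc n)) = idm (pw A (Suc n))"
  proof -
    have i: "wh (A @ pw A n @ pw B n) ev (pw A n) \<bullet> wh A (nco n) (B @ A @ pw A n)
        = wh A (nco n) (pw A n) \<bullet> wh A ev (pw A n)"
      using interchange[of "nco n" ev "[]" "pw A n @ pw B n" "B @ A" "[]" A "[]" "pw A n"] by simp
    have "wh (pw A (Suc n)) (nev (Suc n)) [] \<bullet> wh [] (nco (Suc n)) (pw A (Suc n))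
       = wh (A @ pw A n) (nev n) [] \<bullet> (wh (A @ pw A n @ pw B n) ev (pw A n) \<bullet>
         wh A (nco n) (B @ A @ pw A n)) \<bullet> wh [] co (A @ pw A n)"
      unfolding c by (simp add: wh_cmp cmp_assoc)
    also have "\<dots> = wh A (wh (pw A n) (nev n) [] \<bullet> wh [] (nco n) (pw A n)) [] \<bullet>
        wh [] (wh A ev [] \<bullet> wh [] co A) (pw A n)"
      unfolding i by (simp add: wh_cmp cmp_assoc)
    finally show ?thesis unfolding z zig by simp
  qed
  have 2: "wh [] (nev (Suc n)) (pw B (Suc n)) \<bullet> wh (pw B (Suc n)) (nco (Suc n)) [] = idm (pw B (Suc n))"
  proof -
    have i: "wh (pw B n) ev (pw A n @ pw B n @ B) \<bullet> wh (pw B n @ B @ A) (nco n) B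
        = wh (pw B n) (nco n) B \<bullet> wh (pw B n) ev B"
      using interchange[of ev "nco n" "B @ A" "[]" "[]" "pw A n @ pw B n" "pw B n" "[]" B] by simp
    have "wh [] (nev (Suc n)) (pw B (Suc n)) \<bullet> wh (pw B (Suc n)) (nco (Suc n)) []
       = wh [] (nev n) (pw B n @ B) \<bullet> (wh (pw B n) ev (pw A n @ pw B n @ B) \<bullet>
         wh (pw B n @ B @ A) (nco n) B) \<bullet> wh (pw B n @ B) co []"
      unfolding c by (simp add: wh_cmp cmp_assoc)
    also have "\<dots> = wh [] (wh [] (nev n) (pw B n) \<bullet> wh (pw B n) (nco n) []) B \<bullet>
        wh (pw B n) (wh [] ev B \<bullet> wh B co []) []"
      unfolding i by (simp add: wh_cmp cmp_assoc)
    finally show ?thesis unfolding z' zag by simp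
  qed
  show ?case unfolding dual_pair_def using 1 2 by simp
qed

text \<open>Sliding either crossing over a pairing leaves the same crossing of the middle
  \<open>B\<close> and \<open>A\<close>, followed by two disjoint evaluations whose order does not
  matter.\<close>

lemma ev2_transpose: "nev 2 \<bullet> wh [] (sym B B) (A @ A) = nev 2 \<bullet> wh (B @ B) (sym A A) []"
proof -
  have n2: "nev 2 = ev \<bullet> wh B ev A" by (simp add: numeral_2_eq_2)
  have "wh B ev A \<bullet> wh [] (sym B B) (A @ A) = wh [] (wh B ev [] \<bullet> wh [] (sym B B) A) A"
    by (simp add: wh_cmp)
  also have "\<dots> = wh [] (wh [] ev B \<bullet> wh B (sym B A) []) A"
    by (simp add: pairing_slide)
  finally have l: "wh B ev A \<bullet> wh [] (sym B B) (A @ A) = wh [] ev (B @ A) \<bullet> wh B (sym B A) A"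
    by (simp add: wh_cmp)
  have "wh B ev A \<bullet> wh (B @ B) (sym A A) [] = wh B (wh [] ev A \<bullet> wh B (sym A A) []) []"
    by (simp add: wh_cmp)
  also have "\<dots> = wh B (wh A ev [] \<bullet> wh [] (sym B A) A) []"
    by (simp add: pairing_slide)
  finally have r: "wh B ev A \<bullet> wh (B @ B) (sym A A) [] = wh (B @ A) ev [] \<bullet> wh B (sym B A) A"
    by (simp add: wh_cmp)
  have i: "ev \<bullet> wh [] ev (B @ A) = ev \<bullet> wh (B @ A) ev []"
    using interchange[of ev ev "B @ A" "[]" "B @ A" "[]" "[]" "[]" "[]"] by simp
  show ?thesis unfolding n2 by (simp add: cmp_assoc l r reassoc2[OF i])
qed

text \<open>The numbers \<open>k\<close> and \<open>m\<close> change places because the nested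
  pairing matches factors in reverse order. The pairing is cut into \<open>k\<close> outer pairs,
  the two pairs concerned and \<open>m\<close> inner pairs.\<close>

lemma adjacent_transpose:
  assumes n: "n = k + m + 2"
  shows "nev n \<bullet> wh (pw B k) (sym B B) (pw B m @ pw A n) = nev n \<bullet> wh (pw B n @ pw A m) (sym A A) (pw A k)"
proof -
  have "nev n = nev k \<bullet> wh (pw B k) (nev (2 + m)) (pw A k)"
    using nev_add[of k "2 + m"] n by (simp add: ac_simps)
  then have nv: "nev n = nev k \<bullet> wh (pw B k) (nev 2) (pw A k) \<bullet> wh (pw B k @ B @ B) (nev m) (A @ A @ pw A k)"
    unfolding nev_add[of 2 m] by (simp add: numeral_2_eq_2 wh_cmp del: nested_ev.simps)
  have pn: "pw A n = pw A m @ A @ A @ pw A k" "pw B n = pw B k @ B @ B @ pw B m"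
    using n by (simp_all add: pw_add pw_swap)
  have i1: "wh (pw B k @ B @ B) (nev m) (A @ A @ pw A k) \<bullet> wh (pw B k) (sym B B) (pw B m @ pw A m @ A @ A @ pw A k)
     = wh (pw B k) (sym B B) (A @ A @ pw A k) \<bullet> wh (pw B k @ B @ B) (nev m) (A @ A @ pw A k)"
    using interchange[of "sym B B" "nev m" "B @ B" "B @ B" "pw B m @ pw A m" "[]" "pw B k" "[]" "A @ A @ pw A k"]
    by simp
  have i2: "wh (pw B k @ B @ B) (nev m) (A @ A @ pw A k) \<bullet> wh (pw B k @ B @ B @ pw B m @ pw A m) (sym A A) (pw A k)
     = wh (pw B k @ B @ B) (sym A A) (pw A k) \<bullet> wh (pw B k @ B @ B) (nev m) (A @ A @ pw A k)"
    using interchange[of "nev m" "sym A A" "pw B m @ pw A m" "[]" "A @ A" "A @ A" "pw B k @ B @ B" "[]" "pw A k"]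
    by simp
  have "wh (pw B k) (nev 2 \<bullet> wh [] (sym B B) (A @ A)) (pw A k)
      = wh (pw B k) (nev 2 \<bullet> wh (B @ B) (sym A A) []) (pw A k)"
    by (simp only: ev2_transpose)
  then have t: "wh (pw B k) (nev 2) (pw A k) \<bullet> wh (pw B k) (sym B B) (A @ A @ pw A k)
      = wh (pw B k) (nev 2) (pw A k) \<bullet> wh (pw B k @ B @ B) (sym A A) (pw A k)"
    by (simp add: wh_cmp del: pw_comm_append)
  show ?thesis unfolding nv pn
    by (simp only: cmp_assoc append_assoc i1 i2 reassoc2[OF t])
qed

text \<open>
  Both sides equal the pairing precomposed with the symmetrizers of \<open>A\<close> and \<open>B\<close>, because each
  symmetrizer is an average of words in transpositions and left absorption is already known. Right
  absorption follows by nondegeneracy.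
\<close>

lemma symmer_transpose:
  "nev n \<bullet> wh [] (symmer B n) (pw A n) = nev n \<bullet> wh (pw B n) (symmer A n) []"
proof -
  let ?x = "nev n \<bullet> wh (pw B n) (symmer A n) []"
  let ?y = "nev n \<bullet> wh [] (symmer B n) (pw A n)"
  have "right_absorbs B [] n (pw A n) ?x"
    unfolding right_absorbs_def
  proof (intro conjI allI impI)
    fix k m assume n: "n = k + m + 2"
    have pB: "pw B n = pw B k @ B @ B @ pw B m" and pA: "pw A n = pw A m @ A @ A @ pw A k"
      using n by (simp_all add: pw_add pw_swap)
    have "?x \<bullet> wh (pw B k) (sym B B) (pw B m @ pw A n)
        = nev n \<bullet> wh (pw B k) (sym B B) (pw B m @ pw A n) \<bullet> wh (pw B n) (symmer A n) []"
      using interchange[of "sym B B" "symmer A n" "B @ B" "B @ B" "pw A n" "pw A n" "pw B k" "pw B m" "[]"]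
      by (simp add: cmp_assoc pB)
    also have "\<dots> = nev n \<bullet> wh (pw B n) (wh (pw A m) (sym A A) (pw A k) \<bullet> symmer A n) []"
      by (simp add: reassoc2[OF adjacent_transpose[OF n]] wh_cmp)
    also have "wh (pw A m) (sym A A) (pw A k) \<bullet> symmer A n = symmer A n"
      using symmer_left_absorbs[of A n] n unfolding left_absorbs_def by (metis add.commute append_Nil append_Nil2)
    finally show "?x \<bullet> wh ([] @ pw B k) (sym B B) (pw B m @ pw A n) = ?x" by simp
  qed auto
  from symmer_right[OF this] have x: "?x \<bullet> wh [] (symmer B n) (pw A n) = ?x" by simp
  have "right_absorbs A (pw B n) n [] ?y"
    unfolding right_absorbs_def
  proof (intro conjI allI impI)
    fix m k assume "n = m + k + 2"
    then have n: "n = k + m + 2" by simp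
    have pB: "pw B n = pw B k @ B @ B @ pw B m" and pA: "pw A n = pw A m @ A @ A @ pw A k"
      using n by (simp_all add: pw_add pw_swap)
    have "?y \<bullet> wh (pw B n @ pw A m) (sym A A) (pw A k)
        = nev n \<bullet> wh (pw B n @ pw A m) (sym A A) (pw A k) \<bullet> wh [] (symmer B n) (pw A n)"
      using interchange[of "symmer B n" "sym A A" "pw B n" "pw B n" "A @ A" "A @ A" "[]" "pw A m" "pw A k"]
      by (simp add: cmp_assoc pA)
    also have "\<dots> = nev n \<bullet> wh [] (wh (pw B k) (sym B B) (pw B m) \<bullet> symmer B n) (pw A n)"
      by (simp add: reassoc2[OF adjacent_transpose[OF n, symmetric]] wh_cmp)
    also have "wh (pw B k) (sym B B) (pw B m) \<bullet> symmer B n = symmer B n"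
      using symmer_left_absorbs[of B n] n unfolding left_absorbs_def by (metis append_Nil append_Nil2)
    finally show "?y \<bullet> wh (pw B n @ pw A m) (sym A A) (pw A k @ []) = ?y" by simp
  qed auto
  from symmer_right[OF this] have y: "?y \<bullet> wh (pw B n) (symmer A n) [] = ?y" .
  have "?x \<bullet> wh [] (symmer B n) (pw A n) = ?y \<bullet> wh (pw B n) (symmer A n) []"
    using interchange[of "symmer B n" "symmer A n" "pw B n" "pw B n" "pw A n" "pw A n" "[]" "[]" "[]"]
    by (simp add: cmp_assoc)
  then show ?thesis using x y by simp
qed

lemma symmer_right_absorbs: "right_absorbs A [] n [] (symmer A n)"
  unfolding right_absorbs_def
proof (intro conjI allI impI)
  fix m k assume "n = m + k + 2"
  then have n: "n = k + m + 2" by simp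
  have pB: "pw B n = pw B k @ B @ B @ pw B m" and pA: "pw A n = pw A m @ A @ A @ pw A k"
    using n by (simp_all add: pw_add pw_swap)
  have "nev n \<bullet> wh (pw B n) (symmer A n \<bullet> wh (pw A m) (sym A A) (pw A k)) []
     = nev n \<bullet> wh [] (symmer B n) (pw A n) \<bullet> wh (pw B n @ pw A m) (sym A A) (pw A k)"
    by (simp add: wh_cmp reassoc2[OF symmer_transpose])
  also have "\<dots> = nev n \<bullet> wh (pw B n @ pw A m) (sym A A) (pw A k) \<bullet> wh [] (symmer B n) (pw A n)"
    using interchange[of "symmer B n" "sym A A" "pw B n" "pw B n" "A @ A" "A @ A" "[]" "pw A m" "pw A k"]
    by (simp add: pA)
  also have "\<dots> = nev n \<bullet> wh [] (wh (pw B k) (sym B B) (pw B m) \<bullet> symmer B n) (pw A n)"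
    by (simp add: reassoc2[OF adjacent_transpose[OF n, symmetric]] wh_cmp)
  also have "wh (pw B k) (sym B B) (pw B m) \<bullet> symmer B n = symmer B n"
    using symmer_left_absorbs[of B n] n unfolding left_absorbs_def by (metis append_Nil append_Nil2)
  also have "nev n \<bullet> wh [] (symmer B n) (pw A n) = nev n \<bullet> wh (pw B n) (symmer A n) []"
    by (rule symmer_transpose)
  finally have eq: "nev n \<bullet> wh (pw B n) (symmer A n \<bullet> wh (pw A m) (sym A A) (pw A k)) [] =
    nev n \<bullet> wh (pw B n) (symmer A n) []" .
  have "symmer A n \<bullet> wh (pw A m) (sym A A) (pw A k) = symmer A n"
    by (rule dual_pair_cancel_right[OF nested_dual_pair[of n], where S = "pw A n", OF _ _ _ _ _ _ eq])
      (simp_all add: pA)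
  then show "symmer A n \<bullet> wh ([] @ pw A m) (sym A A) (pw A k @ []) = symmer A n" by simp
qed auto

lemma symmer_absorb_right:
  "n = k + l + m \<Longrightarrow> symmer A n \<bullet> wh (pw A k) (symmer A l) (pw A m) = symmer A n"
  using symmer_right[OF right_absorbs_sub[of A "[]" k l m "[]"]] symmer_right_absorbs[of n] by simp

end

context dual_objects
begin

text \<open>The partial trace over the leading factor. The loop is closed on the left of the
  remaining strands, hence the exchanged coevaluation \<open>coi\<close>.\<close>

definition ltrace :: "'b list \<Rightarrow> 'a \<Rightarrow> 'a" where
  "ltrace X f = wh [] ev X \<bullet> wh B f [] \<bullet> wh [] coi X"

definition ltrace_pow :: "nat \<Rightarrow> 'b list \<Rightarrow> 'a \<Rightarrow> 'a" where
  "ltrace_pow n X f = wh [] (nev n) X \<bullet> wh (pw B n) f [] \<bullet> wh [] (ncoi n) X"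

definition rk where "rk = ev \<bullet> coi"

lemma rk_typ [simp]: "arr rk" "src rk = []" "tgt rk = []"
  by (auto simp: rk_def)

lemma ltrace_cmp_right:
  assumes "arr f" "arr g" "src f = A @ X" "tgt f = A @ Z" "src g = Z" "tgt g = X"
  shows "ltrace Z (f \<bullet> wh A g []) = wh [] ev Z \<bullet> wh B f [] \<bullet> wh [] coi X \<bullet> g"
  using interchange[of coi g "[]" "B @ A" Z X "[]" "[]" "[]"] assms
  by (simp add: ltrace_def wh_cmp cmp_assoc)

text \<open>In the coset sum the identity closes up to a free loop and gives \<open>rk\<close>. In
  every other summand the traced strand crosses the next one, and straightening it leaves the coset
  sum with one strand less, which has n terms and is absorbed by \<open>symmer A n\<close>.\<close>

lemma ltrace_symmer:
  "ltrace (pw A n) (symmer A (Suc n)) =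
     scl (1 / of_nat (Suc n)) (wh [] (rk \<boxplus> scl (of_nat n) (idm [])) (pw A n) \<bullet> symmer A n)"
proof -
  have *: "wh [] ev (pw A n) \<bullet> wh B (coset_sum A n) [] \<bullet> wh [] coi (pw A n) \<bullet> symmer A n
    = wh [] rk (pw A n) \<bullet> symmer A n \<boxplus> scl (of_nat n) (symmer A n)"
  proof (cases n)
    case [simp]: 0
    show ?thesis by (simp add: rk_def)
  next
    case (Suc m)
    let ?e = "symmer A n" and ?q = "coset_sum A m"
    \<comment> \<open>The partial trace of a crossing is a plain strand, by one slide and one
      zigzag.\<close>
    have slide: "wh [] ev A \<bullet> wh B (sym A A) [] \<bullet> wh [] coi A = idm A"
      by (simp add: reassoc2[OF pairing_slide] wh_cmp zig)
    have i: "wh [] ev (A @ pw A m) \<bullet> wh (B @ A) ?q [] = ?q \<bullet> wh [] ev (A @ pw A m)"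
      using interchange[of ev ?q "B @ A" "[]" "A @ pw A m" "A @ pw A m" "[]" "[]" "[]"] by simp
    have "wh [] (wh [] ev A \<bullet> wh B (sym A A) [] \<bullet> wh [] coi A) (pw A m) = idm (A @ pw A m)"
      by (simp add: slide)
    then have s: "wh [] ev (A @ pw A m) \<bullet> wh B (sym A A) (pw A m) \<bullet> wh [] coi (A @ pw A m) = idm (A @ pw A m)"
      by (simp add: wh_cmp)
    have "wh [] ev (pw A n) \<bullet> wh B (coset_sum A n) [] \<bullet> wh [] coi (pw A n) =
       wh [] rk (pw A n) \<boxplus> wh [] ev (A @ pw A m) \<bullet> wh (B @ A) ?q [] \<bullet> wh B (sym A A) (pw A m) \<bullet> wh [] coi (A @ pw A m)"
      by (simp add: Suc wh_pls wh_cmp pls_cmp cmp_pls rk_def cmp_assoc)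
    also have "\<dots> = wh [] rk (pw A n) \<boxplus> ?q"
      by (simp add: reassoc2[OF i] s del: wh_cmp)
    finally have "(wh [] ev (pw A n) \<bullet> wh B (coset_sum A n) [] \<bullet> wh [] coi (pw A n)) \<bullet> ?e =
       wh [] rk (pw A n) \<bullet> ?e \<boxplus> ?q \<bullet> ?e"
      by (simp add: pls_cmp Suc del: symmer.simps)
    moreover have "?q \<bullet> ?e = scl (of_nat n) ?e"
      using coset_sum_left[of A "[]" m "[]" ?e] symmer_left_absorbs[of A n] Suc by simp
    ultimately show ?thesis by (simp only: cmp_assoc)
  qed
  have "ltrace (pw A n) (coset_sum A n \<bullet> wh A (symmer A n) []) =
      wh [] (rk \<boxplus> scl (of_nat n) (idm [])) (pw A n) \<bullet> symmer A n"
    using ltrace_cmp_right[of "coset_sum A n" "symmer A n" "pw A n" "pw A n"] *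
    by (simp add: wh_pls wh_scl pls_cmp scl_cmp)
  then show ?thesis
    by (simp add: ltrace_def wh_scl scl_cmp cmp_scl del: of_nat_Suc)
qed

lemma ltrace_pow_Suc:
  assumes "arr f" "src f = A @ pw A n @ X" "tgt f = A @ pw A n @ X"
  shows "ltrace_pow (Suc n) X f = ltrace_pow n X (ltrace (pw A n @ X) f)"
  using assms by (simp add: ltrace_pow_def ltrace_def wh_cmp cmp_assoc)

lemma ltrace_pow_scalar:
  assumes [simp]: "arr f" "src f = pw A n @ X" "tgt f = pw A n @ X" "arr r" "src r = []" "tgt r = []"
  shows "ltrace_pow n X (scl a (wh [] r (pw A n @ X) \<bullet> f)) = scl a (wh [] r X \<bullet> ltrace_pow n X f)"
proof -
  have s: "wh [] (nev n) X \<bullet> wh (pw B n) r (pw A n @ X) = wh [] r X \<bullet> wh [] (nev n) X"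
    using interchange[of r "nev n" "[]" "[]" "pw B n @ pw A n" "[]" "[]" "[]" X]
    by (simp add: scalar_central[of r "pw B n"])
  then show ?thesis
    by (simp add: ltrace_pow_def wh_scl scl_cmp cmp_scl wh_cmp reassoc2[OF s] cmp_assoc)
qed

text \<open>The traces contribute (r + n) / (n + 1) for n from j + i - 1 down to i. The denominators
  multiply to (j + i)! / i!, the numerators to a falling factorial with j factors starting at r + (j
  + i) - 1.\<close>

lemma ltrace_pow_symmer:
  "ltrace_pow j (pw A i) (symmer A (j + i)) =
     scl (fact i / fact (j + i))
       (wh [] (fall (rk \<boxplus> scl (of_nat (j + i) - 1) (idm [])) j) (pw A i) \<bullet> symmer A i)"
proof (induction j)
  case 0
  then show ?case by (simp add: ltrace_pow_def)
next
  case (Suc j)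
  let ?t = "rk \<boxplus> scl (of_nat (j + i)) (idm [])"
  have t1: "rk \<boxplus> scl (of_nat (j + i) - 1) (idm []) = ?t \<boxplus> scl (-1) (idm [])"
    using scl_add[of "idm []" "of_nat (j + i)" "-1"] by (simp add: pls_assoc)
  have "ltrace_pow (Suc j) (pw A i) (symmer A (Suc j + i)) =
      ltrace_pow j (pw A i) (ltrace (pw A (j + i)) (symmer A (Suc (j + i))))"
    by (simp add: ltrace_pow_Suc pw_add)
  also have "\<dots> = scl (1 / of_nat (Suc (j + i))) (wh [] ?t (pw A i) \<bullet> ltrace_pow j (pw A i) (symmer A (j + i)))"
    unfolding ltrace_symmer using ltrace_pow_scalar[of "symmer A (j + i)" j "pw A i" ?t]
    by (simp add: pw_add)
  also have "\<dots> = scl (fact i / fact (Suc j + i)) (wh [] (?t \<bullet> fall (?t \<boxplus> scl (-1) (idm [])) j) (pw A i) \<bullet> symmer A i)"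
    unfolding Suc.IH t1 by (simp add: cmp_scl scl_scl wh_cmp cmp_assoc field_simps)
  also have "?t \<bullet> fall (?t \<boxplus> scl (-1) (idm [])) j = fall ?t (Suc j)"
    by (rule fall_Suc_left[symmetric]) auto
  finally show ?case by simp
qed

end

context strict_smc
begin

section \<open>Isomorphisms and mates\<close>

lemma exchange:
  "arr f \<Longrightarrow> arr g \<Longrightarrow>
    wh U f (M @ tgt g @ U') \<bullet> wh (U @ src f @ M) g U' = wh (U @ tgt f @ M) g U' \<bullet> wh U f (M @ src g @ U')"
  by (rule interchange) auto

lemma is_isoI:
  "arr f \<Longrightarrow> arr h \<Longrightarrow> src h = tgt f \<Longrightarrow> tgt h = src f \<Longrightarrow> h \<bullet> f = idm (src f) \<Longrightarrow>
    f \<bullet> h = idm (tgt f) \<Longrightarrow> is_iso f"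
  by (auto simp: is_iso_def)

lemma is_isoE:
  assumes "is_iso f"
  obtains h where "arr h" "src h = tgt f" "tgt h = src f" "h \<bullet> f = idm (src f)" "f \<bullet> h = idm (tgt f)" "arr f"
    "is_iso h"
  using assms by (auto simp: is_iso_def)

lemma is_iso_arr: "is_iso f \<Longrightarrow> arr f"
  by (simp add: is_iso_def)

lemma is_iso_idm [simp]: "is_iso (idm X)"
  by (auto simp: is_iso_def intro!: exI[of _ "idm X"])

lemma is_iso_sym [simp]: "is_iso (sym X Y)"
  by (auto simp: is_iso_def intro!: exI[of _ "sym Y X"])

lemma is_iso_cmp:
  assumes "is_iso g" "is_iso f" "src g = tgt f"
  shows "is_iso (g \<bullet> f)"
proof -
  obtain g' where g: "arr g'" "src g' = tgt g" "tgt g' = src g" "g' \<bullet> g = idm (src g)" "g \<bullet> g' = idm (tgt g)" "arr g"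
    using assms(1) by (rule is_isoE)
  obtain f' where f: "arr f'" "src f' = tgt f" "tgt f' = src f" "f' \<bullet> f = idm (src f)" "f \<bullet> f' = idm (tgt f)" "arr f"
    using assms(2) by (rule is_isoE)
  show ?thesis
  proof (rule is_isoI)
    have "(f' \<bullet> g') \<bullet> (g \<bullet> f) = f' \<bullet> (g' \<bullet> g) \<bullet> f" by (simp add: cmp_assoc)
    then show "(f' \<bullet> g') \<bullet> (g \<bullet> f) = idm (src (g \<bullet> f))" using f g assms(3) by simp
    have "(g \<bullet> f) \<bullet> (f' \<bullet> g') = g \<bullet> (f \<bullet> f') \<bullet> g'" by (simp add: cmp_assoc)
    then show "(g \<bullet> f) \<bullet> (f' \<bullet> g') = idm (tgt (g \<bullet> f))" using f g assms(3)[symmetric] by simp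
  qed (use f g assms(3) in auto)
qed

lemma is_iso_wh: "is_iso f \<Longrightarrow> is_iso (wh U f U')"
proof (erule is_isoE)
  fix h assume h: "arr h" "src h = tgt f" "tgt h = src f" "h \<bullet> f = idm (src f)" "f \<bullet> h = idm (tgt f)" "arr f"
  show "is_iso (wh U f U')"
    by (rule is_isoI[of _ "wh U h U'"]) (use h in \<open>auto simp flip: wh_cmp\<close>)
qed

lemma is_iso_two_sided:
  assumes "arr f" "arr g" "arr h" "g \<bullet> f = idm (src f)" "f \<bullet> h = idm (tgt f)"
    "src g = tgt f" "tgt h = src f"
  shows "is_iso f"
proof -
  have t: "tgt g = src f" "src h = tgt f"
    by (metis assms tgt_cmp tgt_idm) (metis assms src_cmp src_idm)
  have "g = g \<bullet> (f \<bullet> h)" using assms t by simp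
  also have "\<dots> = (g \<bullet> f) \<bullet> h" by (simp only: cmp_assoc)
  also have "\<dots> = h" using assms t by simp
  finally show ?thesis using assms t by (intro is_isoI[of f g]) auto
qed

lemma is_iso_scl:
  assumes "is_iso f" "c \<noteq> 0"
  shows "is_iso (scl c f)"
  using assms(1)
proof (rule is_isoE)
  fix h assume h: "arr h" "src h = tgt f" "tgt h = src f" "h \<bullet> f = idm (src f)" "f \<bullet> h = idm (tgt f)" "arr f"
  show ?thesis
    by (rule is_isoI[of _ "scl (1 / c) h"]) (use h assms(2) in \<open>auto simp: scl_cmp cmp_scl scl_scl\<close>)
qed

lemma is_iso_cancel_left:
  assumes "is_iso (g \<bullet> f)" "is_iso g"
  shows "is_iso f"
proof -
  have t: "arr f" "src g = tgt f" using is_iso_arr[OF assms(1)] by auto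
  obtain g' where g: "arr g'" "src g' = tgt g" "tgt g' = src g" "g' \<bullet> g = idm (src g)" "is_iso g'" "arr g"
    using assms(2) by (rule is_isoE)
  have "g' \<bullet> (g \<bullet> f) = f" using g t by (simp add: reassoc[OF g(4)])
  moreover have "is_iso (g' \<bullet> (g \<bullet> f))"
    using assms g t by (intro is_iso_cmp[of g' "g \<bullet> f"]) auto
  ultimately show ?thesis by metis
qed

text \<open>A tensor inverse is a dual, so \<open>L'\<close> must be isomorphic to \<open>D\<close>.
  The comparison \<open>th\<close> satisfies \<open>e \<bullet> wh [] th L = f'\<close>; once it is
  known to be invertible, \<open>e\<close> is a composite of isomorphisms.\<close>

lemma invertible_dual_ev:
  assumes dp: "dual_pair L D e c" and f: "is_iso f" "src f = L @ L'" "tgt f = []"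
  shows "is_iso e"
proof -
  have e [simp]: "arr e" "src e = D @ L" "tgt e = []" "arr c" "src c = []" "tgt c = L @ D"
    and z1: "wh L e [] \<bullet> wh [] c L = idm L" and z2: "wh [] e D \<bullet> wh D c [] = idm D"
    using dp by (auto simp: dual_pair_def)
  obtain h where h [simp]: "arr h" "src h = []" "tgt h = L @ L'" "is_iso h"
    using f by (metis is_isoE)
  define f' where "f' = f \<bullet> sym L' L"
  have f' [simp]: "arr f'" "src f' = L' @ L" "tgt f' = []" "is_iso f'"
    using f by (auto simp: f'_def is_iso_arr intro!: is_iso_cmp)
  define th where "th = wh [] f' D \<bullet> wh L' c []"
  define th' where "th' = wh [] e L' \<bullet> wh D h []"
  have [simp]: "arr th" "src th = L'" "tgt th = D" "arr th'" "src th' = D" "tgt th' = L'"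
    by (auto simp: th_def th'_def)
  have eth: "e \<bullet> wh [] th L = f'"
  proof -
    have "e \<bullet> wh [] th L = (e \<bullet> wh [] f' (D @ L)) \<bullet> wh L' c L"
      by (simp add: th_def wh_cmp cmp_assoc)
    also have "\<dots> = f' \<bullet> wh L' (wh L e [] \<bullet> wh [] c L) []"
      by (simp add: reassoc2[OF exchange[of f' e "[]" "[]" "[]", simplified, symmetric]] wh_cmp cmp_assoc)
    finally show ?thesis by (simp add: z1)
  qed
  \<comment> \<open>The isomorphisms \<open>f'\<close> and \<open>h\<close> need not satisfy the
    zigzag identities. Their defect is this automorphism of \<open>L\<close>.\<close>
  define z where "z = wh L f' [] \<bullet> wh [] h L"
  have [simp]: "arr z" "src z = L" "tgt z = L" "is_iso z"
    by (auto simp: z_def intro!: is_iso_cmp is_iso_wh)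
  obtain zi where zi [simp]: "arr zi" "src zi = L" "tgt zi = L" "zi \<bullet> z = idm L"
    by (rule is_isoE[of z]) auto
  \<comment> \<open>The transpose of \<open>zi\<close> on the dual side. It corrects the defect:
    \<open>th' \<bullet> w\<close> is a right inverse of \<open>th\<close>.\<close>
  define w where "w = wh [] e D \<bullet> wh D zi D \<bullet> wh D c []"
  have [simp]: "arr w" "src w = D" "tgt w = D" by (auto simp: w_def)
  have ew: "e \<bullet> wh [] w L = e \<bullet> wh D zi []"
  proof -
    have "e \<bullet> wh [] w L = (e \<bullet> wh [] e (D @ L)) \<bullet> wh D zi (D @ L) \<bullet> wh D c L"
      by (simp add: w_def wh_cmp cmp_assoc)
    also have "\<dots> = e \<bullet> (wh (D @ L) e [] \<bullet> wh D zi (D @ L)) \<bullet> wh D c L"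
      by (simp add: reassoc2[OF exchange[of e e "[]" "[]" "[]", simplified, symmetric]] cmp_assoc)
    also have "\<dots> = e \<bullet> wh D zi [] \<bullet> wh D (wh L e [] \<bullet> wh [] c L) []"
      by (simp add: reassoc2[OF exchange[of zi e D "[]" "[]", simplified, symmetric]] wh_cmp cmp_assoc)
    finally show ?thesis by (simp add: z1)
  qed
  have eth2: "e \<bullet> wh [] (th \<bullet> th') L = e \<bullet> wh D z []"
  proof -
    have "e \<bullet> wh [] (th \<bullet> th') L = (f' \<bullet> wh [] e (L' @ L)) \<bullet> wh D h L"
      by (simp add: wh_cmp th'_def reassoc[OF eth] cmp_assoc)
    also have "\<dots> = e \<bullet> wh D z []"
      by (simp add: reassoc2[OF exchange[of e f' "[]" "[]" "[]", simplified, symmetric]] z_def wh_cmp cmp_assoc)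
    finally show ?thesis .
  qed
  have r: "th \<bullet> (th' \<bullet> w) = idm D"
  proof (rule dual_pair_cancel_left[OF dp])
    have "e \<bullet> wh [] (th \<bullet> (th' \<bullet> w)) L = (e \<bullet> wh [] (th \<bullet> th') L) \<bullet> wh [] w L"
      by (simp add: wh_cmp cmp_assoc)
    also have "\<dots> = e \<bullet> wh D z [] \<bullet> wh [] w L" by (simp add: eth2 cmp_assoc)
    also have "\<dots> = (e \<bullet> wh [] w L) \<bullet> wh D z []"
      using exchange[of w z "[]" "[]" "[]"] by (simp add: cmp_assoc)
    also have "\<dots> = e \<bullet> wh D (zi \<bullet> z) []" by (simp add: ew wh_cmp cmp_assoc del: zi)
    finally show "e \<bullet> wh [] (th \<bullet> th' \<bullet> w) L = e \<bullet> wh [] (idm D) L" by simp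
  qed auto
  \<comment> \<open>The opposite composite is built from \<open>f'\<close> and \<open>h\<close>
    alone, so it is invertible without any zigzag identity.\<close>
  have l: "is_iso (th' \<bullet> th)"
  proof -
    have "th' \<bullet> th = wh [] e L' \<bullet> (wh D h [] \<bullet> th)" by (simp add: th'_def cmp_assoc)
    also have "\<dots> = wh [] (e \<bullet> wh [] th L) L' \<bullet> wh L' h []"
      using exchange[of th h "[]" "[]" "[]"] by (simp add: wh_cmp cmp_assoc)
    finally show ?thesis by (simp add: eth, intro is_iso_cmp is_iso_wh) auto
  qed
  obtain k where k: "arr k" "src k = L'" "tgt k = L'" "k \<bullet> (th' \<bullet> th) = idm L'"
    by (rule is_isoE[OF l]) auto
  have "is_iso th"
    by (rule is_iso_two_sided[of th "k \<bullet> th'" "th' \<bullet> w"]) (use k r in \<open>auto simp: cmp_assoc\<close>)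
  then obtain ti where ti: "arr ti" "src ti = D" "tgt ti = L'" "th \<bullet> ti = idm D" "is_iso ti"
    by (rule is_isoE) auto
  have "e = (e \<bullet> wh [] th L) \<bullet> wh [] ti L"
    using ti by (simp add: cmp_assoc flip: wh_cmp)
  then have "e = f' \<bullet> wh [] ti L" by (simp add: eth)
  then show ?thesis using ti is_iso_cmp[of f' "wh [] ti L"] is_iso_wh[of ti "[]" L] by simp
qed

text \<open>
  \<open>u\<close> makes \<open>b \<otimes> 1\<^sub>L\<close> split epi and \<open>v\<close> makes \<open>b\<close> split mono, so \<open>b \<otimes> 1\<^sub>L\<close> is invertible, and
  tensoring with \<open>L \<otimes> D \<cong> \<I>\<close> recovers \<open>b\<close>.
\<close>

lemma cross_iso:
  assumes [simp]: "arr a" "src a = X" "tgt a = Y @ L" "arr b" "src b = Y" "tgt b = X @ D"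
    and e1: "is_iso e1" "src e1 = D @ L" "tgt e1 = []" and e2: "is_iso e2" "src e2 = L @ D" "tgt e2 = []"
    and u: "is_iso (wh X e1 [] \<bullet> wh [] b L \<bullet> a)" and v: "is_iso (wh Y e2 [] \<bullet> wh [] a D \<bullet> b)"
  shows "is_iso b"
proof -
  have [simp]: "arr e1" "arr e2" using e1 e2 is_iso_arr by auto
  note [simp] = e1(2,3) e2(2,3)
  let ?E = "wh X e1 []"
  obtain v' where v': "arr v'" "src v' = Y" "tgt v' = Y" "v' \<bullet> (wh Y e2 [] \<bullet> wh [] a D \<bullet> b) = idm Y"
    using v by (rule is_isoE) auto
  define q where "q = v' \<bullet> wh Y e2 [] \<bullet> wh [] a D"
  have q: "arr q" "src q = X @ D" "tgt q = Y" "q \<bullet> b = idm Y"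
    using v' by (auto simp: q_def cmp_assoc)
  obtain u' where u': "arr u'" "src u' = X" "tgt u' = X" "(?E \<bullet> wh [] b L \<bullet> a) \<bullet> u' = idm X"
    using u by (rule is_isoE) auto
  obtain E' where E': "arr E'" "src E' = X" "tgt E' = X @ D @ L" "E' \<bullet> ?E = idm (X @ D @ L)"
    using is_iso_wh[OF e1(1), of X "[]"] by (rule is_isoE) auto
  have "wh [] b L \<bullet> a \<bullet> u' = (E' \<bullet> ?E) \<bullet> (wh [] b L \<bullet> a \<bullet> u')"
    using E' u' by simp
  also have "\<dots> = E' \<bullet> ((?E \<bullet> wh [] b L \<bullet> a) \<bullet> u')" by (simp only: cmp_assoc)
  also have "\<dots> = E'" using u' E' by simp
  finally have r: "wh [] b L \<bullet> (a \<bullet> u' \<bullet> ?E) = idm (X @ D @ L)"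
    using E'(4) by (metis cmp_assoc)
  have "is_iso (wh [] b L)"
  proof (rule is_iso_two_sided[of _ "wh [] q L" "a \<bullet> u' \<bullet> ?E"])
    show "wh [] q L \<bullet> wh [] b L = idm (src (wh [] b L))"
      using q by (simp flip: wh_cmp)
    show "wh [] b L \<bullet> (a \<bullet> u' \<bullet> ?E) = idm (tgt (wh [] b L))"
      using r by simp
  qed (use q u' in auto)
  then have bLD: "is_iso (wh [] b (L @ D))"
    using is_iso_wh[of "wh [] b L" "[]" D] by simp
  obtain F where F: "arr F" "src F = Y" "tgt F = Y @ L @ D" "wh Y e2 [] \<bullet> F = idm Y" "is_iso F"
    using is_iso_wh[OF e2(1), of Y "[]"] by (rule is_isoE) auto
  have "b = b \<bullet> wh Y e2 [] \<bullet> F" using F by simp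
  also have "\<dots> = wh (X @ D) e2 [] \<bullet> wh [] b (L @ D) \<bullet> F"
    by (simp add: reassoc2[OF exchange[of b e2 "[]" "[]" "[]", simplified]])
  finally have "b = wh (X @ D) e2 [] \<bullet> wh [] b (L @ D) \<bullet> F" .
  moreover have "is_iso (wh (X @ D) e2 [] \<bullet> wh [] b (L @ D) \<bullet> F)"
    by (intro is_iso_cmp is_iso_wh e2 bLD F) (use F in auto)
  ultimately show ?thesis by simp
qed

text \<open>The universal property of an internal hom \<open>K\<close> from \<open>Y\<close> to
  \<open>Z\<close> with evaluation \<open>E\<close>; \<open>K\<close>, \<open>Y\<close> and
  \<open>Z\<close> may be words.\<close>

definition universal :: "'o list \<Rightarrow> 'o list \<Rightarrow> 'o list \<Rightarrow> 'a \<Rightarrow> bool" where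
  "universal K Y Z E \<longleftrightarrow> arr E \<and> src E = K @ Y \<and> tgt E = Z \<and>
     (\<forall>X f. arr f \<and> src f = X @ Y \<and> tgt f = Z \<longrightarrow>
       (\<exists>!h. arr h \<and> src h = X \<and> tgt h = K \<and> E \<bullet> wh [] h Y = f))"

lemma universal_unique:
  assumes "universal K Y Z E" "arr h" "arr h'" "src h = src h'" "tgt h = K" "tgt h' = K"
    "E \<bullet> wh [] h Y = E \<bullet> wh [] h' Y"
  shows "h = h'"
proof -
  have E: "arr E" "src E = K @ Y" "tgt E = Z" using assms(1) by (auto simp: universal_def)
  define f where "f = E \<bullet> wh [] h' Y"
  have "arr f" "src f = src h' @ Y" "tgt f = Z" using E assms by (auto simp: f_def)
  then have "\<exists>!h. arr h \<and> src h = src h' \<and> tgt h = K \<and> E \<bullet> wh [] h Y = f"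
    using assms(1) by (simp add: universal_def)
  then show ?thesis using assms f_def by metis
qed

text \<open>The inverse of the canonical map \<alpha> in closed form: insert a coevaluation of
  \<open>Y\<close>, then evaluate. This holds for every dual \<open>Y'\<close> of
  \<open>Y\<close>.\<close>

lemma alpha_iso:
  assumes un: "universal K Y Z E" and dp: "dual_pair Y Y' e c"
    and al [simp]: "arr al" "src al = Z @ Y'" "tgt al = K" and ale: "E \<bullet> wh [] al Y = wh Z e []"
  shows "al \<bullet> (wh [] E Y' \<bullet> wh K c []) = idm K" "(wh [] E Y' \<bullet> wh K c []) \<bullet> al = idm (Z @ Y')"
proof -
  have e [simp]: "arr e" "src e = Y' @ Y" "tgt e = []" "arr c" "src c = []" "tgt c = Y @ Y'"
    and z1: "wh Y e [] \<bullet> wh [] c Y = idm Y" and z2: "wh [] e Y' \<bullet> wh Y' c [] = idm Y'"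
    using dp by (auto simp: dual_pair_def)
  have E [simp]: "arr E" "src E = K @ Y" "tgt E = Z" using un by (auto simp: universal_def)
  show "(wh [] E Y' \<bullet> wh K c []) \<bullet> al = idm (Z @ Y')"
  proof -
    have "(wh [] E Y' \<bullet> wh K c []) \<bullet> al = wh [] (E \<bullet> wh [] al Y) Y' \<bullet> wh (Z @ Y') c []"
      using exchange[of al c "[]" "[]" "[]"] by (simp add: wh_cmp cmp_assoc)
    also have "\<dots> = wh Z (wh [] e Y' \<bullet> wh Y' c []) []" unfolding ale by (simp add: wh_cmp)
    finally show ?thesis by (simp add: z2)
  qed
  show "al \<bullet> (wh [] E Y' \<bullet> wh K c []) = idm K"
  proof (rule universal_unique[OF un])
    have "E \<bullet> wh [] (al \<bullet> (wh [] E Y' \<bullet> wh K c [])) Y = (wh Z e [] \<bullet> wh [] E (Y' @ Y)) \<bullet> wh K c Y"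
      by (simp add: wh_cmp reassoc[OF ale] cmp_assoc)
    also have "\<dots> = E \<bullet> wh K (wh Y e [] \<bullet> wh [] c Y) []"
      by (simp add: reassoc2[OF exchange[of E e "[]" "[]" "[]", simplified, symmetric]] wh_cmp cmp_assoc)
    finally show "E \<bullet> wh [] (al \<bullet> wh [] E Y' \<bullet> wh K c []) Y = E \<bullet> wh [] (idm K) Y"
      by (simp add: z1)
  qed auto
qed

text \<open>The inverse of \<alpha> after a curried morphism is the mate of the uncurried one. The
  maps \<open>D_upper\<close> and \<open>D_lower\<close> and the coevaluation are composites of this
  shape.\<close>

lemma mate_eq:
  assumes un: "universal K Y Z E" and dp: "dual_pair Y Y' e c"
    and h [simp]: "arr h" "src h = X" "tgt h = K" and hf: "E \<bullet> wh [] h Y = f"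
  shows "(wh [] E Y' \<bullet> wh K c []) \<bullet> h = wh [] f Y' \<bullet> wh X c []"
proof -
  have e [simp]: "arr c" "src c = []" "tgt c = Y @ Y'"
    using dp by (auto simp: dual_pair_def)
  have E [simp]: "arr E" "src E = K @ Y" "tgt E = Z" using un by (auto simp: universal_def)
  show ?thesis
    using exchange[of h c "[]" "[]" "[]"] by (simp add: wh_cmp cmp_assoc hf[symmetric])
qed

lemma universal_exists:
  "universal K Y Z E \<Longrightarrow> arr f \<Longrightarrow> src f = X @ Y \<Longrightarrow> tgt f = Z \<Longrightarrow>
    \<exists>h. arr h \<and> src h = X \<and> tgt h = K \<and> E \<bullet> wh [] h Y = f"
  unfolding universal_def by blast

text \<open>The mate differs from \<open>h\<close> by the inverse of \<alpha>, an isomorphism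
  whichever dual \<open>Y'\<close> is chosen.\<close>

lemma curry_iso:
  assumes un: "universal K Y Z E" and dp: "dual_pair Y Y' e c"
    and h: "arr h" "src h = X" "tgt h = K" and hf: "E \<bullet> wh [] h Y = f"
    and m: "is_iso (wh [] f Y' \<bullet> wh X c [])"
  shows "is_iso h"
proof -
  have e [simp]: "arr e" "src e = Y' @ Y" "tgt e = []" "arr c" "src c = []" "tgt c = Y @ Y'"
    using dp by (auto simp: dual_pair_def)
  have E [simp]: "arr E" "src E = K @ Y" "tgt E = Z" using un by (auto simp: universal_def)
  obtain al where al: "arr al" "src al = Z @ Y'" "tgt al = K" and ale: "E \<bullet> wh [] al Y = wh Z e []"
    using universal_exists[OF un, of "wh Z e []" "Z @ Y'"] by auto
  have "is_iso (wh [] E Y' \<bullet> wh K c [])"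
    using al alpha_iso[OF un dp al ale] by (intro is_isoI[of _ al]) auto
  moreover have "is_iso ((wh [] E Y' \<bullet> wh K c []) \<bullet> h)"
    using m mate_eq[OF un dp h hf] by simp
  ultimately show ?thesis using is_iso_cancel_left by blast
qed

text \<open>The hypothesis writes \<open>b\<close> as \<open>a\<close> bent around by
  \<open>e\<close> and \<open>c\<close>. Sliding the two coevaluations past each other leaves one
  zigzag to cancel.\<close>

lemma transpose_co:
  assumes dp: "dual_pair X Y e c" and [simp]: "arr a" "src a = X" "tgt a = X" "arr b" "src b = Y" "tgt b = Y"
    and t: "e \<bullet> wh [] b X = e \<bullet> wh Y a []"
  shows "wh X b [] \<bullet> c = wh [] a Y \<bullet> c"
proof -
  have e [simp]: "arr e" "src e = Y @ X" "tgt e = []" "arr c" "src c = []" "tgt c = X @ Y"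
    and z1: "wh X e [] \<bullet> wh [] c X = idm X" and z2: "wh [] e Y \<bullet> wh Y c [] = idm Y"
    using dp by (auto simp: dual_pair_def)
  have "b = (wh [] e Y \<bullet> wh Y c []) \<bullet> b" by (simp add: z2)
  also have "\<dots> = wh [] (e \<bullet> wh [] b X) Y \<bullet> wh Y c []"
    using exchange[of b c "[]" "[]" "[]"] by (simp add: wh_cmp cmp_assoc)
  finally have b: "b = wh [] e Y \<bullet> wh Y a Y \<bullet> wh Y c []"
    unfolding t by (simp add: wh_cmp cmp_assoc)
  have i1: "wh (X @ Y) c [] \<bullet> c = wh [] c (X @ Y) \<bullet> c"
    using exchange[of c c "[]" "[]" "[]"] by simp
  have i2: "wh (X @ Y) a Y \<bullet> wh [] c (X @ Y) = wh [] c (X @ Y) \<bullet> wh [] a Y"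
    using exchange[of c a "[]" "[]" Y] by simp
  have "wh X b [] \<bullet> c = wh X (wh [] e Y \<bullet> wh Y a Y \<bullet> wh Y c []) [] \<bullet> c"
    by (simp flip: b)
  also have "\<dots> = wh X e Y \<bullet> wh (X @ Y) a Y \<bullet> wh (X @ Y) c [] \<bullet> c"
    by (simp add: wh_cmp cmp_assoc)
  also have "\<dots> = wh [] (wh X e [] \<bullet> wh [] c X) Y \<bullet> wh [] a Y \<bullet> c"
    by (simp add: wh_cmp cmp_assoc i1 reassoc2[OF i2])
  finally show ?thesis by (simp add: z1)
qed

text \<open>By the hexagon, the crossing of one strand with a block is a word in adjacent
  transpositions.\<close>

lemma left_absorbs_block1:
  "left_absorbs A U (Suc m) U' y \<Longrightarrow> wh U (sym A (pw A m)) U' \<bullet> y = y"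
proof (induction m arbitrary: U)
  case 0
  then show ?case by (simp add: left_absorbs_def)
next
  case (Suc m)
  have s: "wh U (sym A A) (pw A m @ U') \<bullet> y = y" and [simp]: "arr y"
    using Suc.prems unfolding left_absorbs_def by (auto dest: spec[of _ "0::nat"])
  show ?case using Suc.IH[OF left_absorbs_shift[OF Suc.prems]]
    by (simp add: hexagon wh_cmp cmp_assoc s)
qed

lemma right_absorbs_block1:
  "right_absorbs A U (Suc m) U' x \<Longrightarrow> x \<bullet> wh U (sym A (pw A m)) U' = x"
proof (induction m arbitrary: U)
  case 0
  then show ?case by (simp add: right_absorbs_def)
next
  case (Suc m)
  have s: "x \<bullet> wh U (sym A A) (pw A m @ U') = x" and [simp]: "arr x"
    using Suc.prems unfolding right_absorbs_def by (auto dest: spec[of _ "0::nat"])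
  show ?case using Suc.IH[OF right_absorbs_shift[OF Suc.prems]]
    by (simp add: hexagon wh_cmp reassoc s)
qed

lemma right_absorbs_block:
  "right_absorbs A U (k + m) U' x \<Longrightarrow> x \<bullet> wh U (sym (pw A k) (pw A m)) U' = x"
proof (induction k arbitrary: U)
  case 0
  then show ?case by (simp add: right_absorbs_def)
next
  case (Suc k)
  have "right_absorbs A (U @ pw A 0) (Suc m) (pw A k @ U') x"
    using right_absorbs_sub[of A U 0 "Suc m" k U' x] Suc.prems by (simp add: ac_simps)
  then have "x \<bullet> wh U (sym A (pw A m)) (pw A k @ U') = x"
    using right_absorbs_block1 by simp
  moreover have "x \<bullet> wh (U @ A) (sym (pw A k) (pw A m)) U' = x"
    using Suc.IH[of "U @ A"] left_absorbs_shift Suc.prems right_absorbs_shift by simp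
  ultimately show ?case
    by (simp add: hexagon_left wh_cmp reassoc)
qed

end

section \<open>Symmetric powers\<close>

locale sym_split = strict_smc +
  fixes A S i p
  assumes i_typ [simp]: "arr (i n)" "src (i n) = S n" "tgt (i n) = pw A n"
    and p_typ [simp]: "arr (p n)" "src (p n) = pw A n" "tgt (p n) = S n"
    and p_i: "p n \<bullet> i n = idm (S n)"
    and i_p: "i n \<bullet> p n = symmer A n"
begin

definition mult :: "nat \<Rightarrow> nat \<Rightarrow> 'a" where
  "mult m n = p (m + n) \<bullet> wh [] (i m) (pw A n) \<bullet> wh (S m) (i n) []"

lemma mult_typ [simp]: "arr (mult m n)" "src (mult m n) = S m @ S n" "tgt (mult m n) = S (m + n)"
  by (auto simp: mult_def pw_add)

lemma symmer_i: "symmer A n \<bullet> i n = i n"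
  by (simp add: cmp_assoc p_i flip: i_p)

lemma p_symmer: "p n \<bullet> symmer A n = p n"
  by (simp add: reassoc[OF p_i] flip: i_p)

end

locale sym_dual_objects = dual_objects + a: sym_split where A = A and S = SA and i = iA and p = pA
  + b: sym_split where A = B and S = SB and i = iB and p = pB
  for SA iA pA SB iB pB
begin

interpretation swap: dual_objects arr src tgt idm cmp wh sym pls scl B A "ev \<bullet> sym A B" coi
  by unfold_locales (rule dual_pair_swap[OF dual])

lemma pB_absorb: "n = k + l + m \<Longrightarrow> pB n \<bullet> wh (pw B k) (symmer B l) (pw B m) = pB n"
  by (metis b.p_symmer cmp_assoc swap.symmer_absorb_right)

lemma pA_block: "pA (k + m) \<bullet> sym (pw A k) (pw A m) = pA (k + m)"
proof -
  have "pA (k + m) \<bullet> (symmer A (k + m) \<bullet> sym (pw A k) (pw A m)) = pA (k + m)"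
    using right_absorbs_block[OF symmer_right_absorbs, of k m] a.p_symmer by simp
  then show ?thesis by (simp add: reassoc[OF a.p_symmer])
qed

text \<open>Naturality moves the crossing from the symmetric powers to the tensor powers, where
  \<open>pA\<close> absorbs it.\<close>

lemma mult_commute: "a.mult m n \<bullet> sym (SA n) (SA m) = a.mult n m"
proof -
  have 1: "wh (SA m) (iA n) [] \<bullet> sym (SA n) (SA m) = sym (pw A n) (SA m) \<bullet> wh [] (iA n) (SA m)"
    using sym_natural[of "iA n" "SA m"] by simp
  have 2: "wh [] (iA m) (pw A n) \<bullet> sym (pw A n) (SA m) = sym (pw A n) (pw A m) \<bullet> wh (pw A n) (iA m) []"
    using sym_natural_wh'[of "iA m" "SA m" "pw A m" "[]" "pw A n" "[]"] by simp
  have 3: "wh (pw A n) (iA m) [] \<bullet> wh [] (iA n) (SA m) = wh [] (iA n) (pw A m) \<bullet> wh (SA n) (iA m) []"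
    using exchange[of "iA n" "iA m" "[]" "[]" "[]"] by simp
  have 4: "pA (m + n) \<bullet> sym (pw A n) (pw A m) = pA (n + m)"
    using pA_block[of n m] by (simp add: add.commute)
  show ?thesis
    unfolding a.mult_def by (simp add: cmp_assoc 1 reassoc2[OF 2] 3 reassoc[OF 4])
qed

text \<open>The nested pairing is used for its planar diagrams. On symmetric powers it agrees with
  the factorwise pairing by \<open>pow_ev_iB\<close>.\<close>

definition sev where "sev n = nev n \<bullet> wh [] (iB n) (pw A n) \<bullet> wh (SB n) (iA n) []"
definition sco where "sco n = wh (SA n) (pB n) [] \<bullet> wh [] (pA n) (pw B n) \<bullet> nco n"

lemma sev_typ [simp]: "arr (sev n)" "src (sev n) = SB n @ SA n" "tgt (sev n) = []"
  and sco_typ [simp]: "arr (sco n)" "src (sco n) = []" "tgt (sco n) = SA n @ SB n"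
  by (auto simp: sev_def sco_def)

lemma nco_symmer: "wh (pw A n) (symmer B n) [] \<bullet> nco n = wh [] (symmer A n) (pw B n) \<bullet> nco n"
  by (rule transpose_co[OF nested_dual_pair]) (use symmer_transpose in auto)

text \<open>In each zigzag an injection meets a projection and forms a symmetrizer. It is carried
  along the evaluation or the coevaluation of the tensor powers to the end of the strand, where
  \<open>iA n\<close> or \<open>pB n\<close> absorbs it.\<close>

lemma sym_dual_pair: "dual_pair (SA n) (SB n) (sev n) (sco n)"
proof -
  have z: "wh (pw A n) (nev n) [] \<bullet> wh [] (nco n) (pw A n) = idm (pw A n)"
    and z': "wh [] (nev n) (pw B n) \<bullet> wh (pw B n) (nco n) [] = idm (pw B n)"
    using nested_dual_pair[of n] by (auto simp: dual_pair_def)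
  have e1: "nev n \<bullet> wh [] (iB n) (pw A n) \<bullet> wh [] (pB n) (pw A n) = nev n \<bullet> wh (pw B n) (symmer A n) []"
    by (metis symmer_transpose b.i_p wh_cmp)
  have 1: "wh (SA n) (sev n) [] \<bullet> wh [] (sco n) (SA n) = idm (SA n)"
  proof -
    note m1 = exchange[of "pB n" "iA n" "SA n" "[]" "[]", simplified]
    note m2 = exchange[of "pA n" "iA n" "[]" "pw B n" "[]", simplified]
    note m3 = exchange[of "nco n" "iA n" "[]" "[]" "[]", simplified]
    have "wh (SA n) (sev n) [] \<bullet> wh [] (sco n) (SA n) =
       wh (SA n) (nev n) [] \<bullet> wh (SA n) (iB n) (pw A n) \<bullet> wh (SA n @ SB n) (iA n) [] \<bullet>
       wh (SA n) (pB n) (SA n) \<bullet> wh [] (pA n) (pw B n @ SA n) \<bullet> wh [] (nco n) (SA n)"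
      by (simp add: sev_def sco_def wh_cmp cmp_assoc)
    also have "\<dots> = wh (SA n) (nev n) [] \<bullet> wh (SA n) (iB n) (pw A n) \<bullet> wh (SA n) (pB n) (pw A n) \<bullet>
       wh [] (pA n) (pw B n @ pw A n) \<bullet> wh [] (nco n) (pw A n) \<bullet> iA n"
      by (simp add: reassoc2[OF m1[symmetric]] reassoc2[OF m2[symmetric]] m3[symmetric])
    also have "\<dots> = wh (SA n) (nev n \<bullet> wh [] (iB n) (pw A n) \<bullet> wh [] (pB n) (pw A n)) [] \<bullet>
       wh [] (pA n) (pw B n @ pw A n) \<bullet> wh [] (nco n) (pw A n) \<bullet> iA n"
      by (simp add: wh_cmp cmp_assoc)
    also have "\<dots> = wh (SA n) (nev n) [] \<bullet> wh (SA n @ pw B n) (symmer A n) [] \<bullet>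
       wh [] (pA n) (pw B n @ pw A n) \<bullet> wh [] (nco n) (pw A n) \<bullet> iA n"
      unfolding e1 by (simp add: wh_cmp cmp_assoc)
    also have "\<dots> = wh (SA n) (nev n) [] \<bullet>
       wh [] (pA n) (pw B n @ pw A n) \<bullet> wh [] (nco n) (pw A n) \<bullet> symmer A n \<bullet> iA n"
      by (simp add: reassoc2[OF exchange[of "pA n" "symmer A n" "[]" "pw B n" "[]", simplified, symmetric]]
         reassoc2[OF exchange[of "nco n" "symmer A n" "[]" "[]" "[]", simplified, symmetric]])
    also have "\<dots> = pA n \<bullet> wh (pw A n) (nev n) [] \<bullet> wh [] (nco n) (pw A n) \<bullet> iA n"
      by (simp add: a.symmer_i reassoc2[OF exchange[of "pA n" "nev n" "[]" "[]" "[]", simplified, symmetric]])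
    also have "\<dots> = idm (SA n)"
      by (simp add: reassoc[OF z] a.p_i)
    finally show ?thesis .
  qed
  have 2: "wh [] (sev n) (SB n) \<bullet> wh (SB n) (sco n) [] = idm (SB n)"
  proof -
    have "wh [] (sev n) (SB n) \<bullet> wh (SB n) (sco n) [] =
       wh [] (nev n) (SB n) \<bullet> wh [] (iB n) (pw A n @ SB n) \<bullet> wh (SB n) (iA n) (SB n) \<bullet>
       wh (SB n @ SA n) (pB n) [] \<bullet> wh (SB n) (pA n) (pw B n) \<bullet> wh (SB n) (nco n) []"
      by (simp add: sev_def sco_def wh_cmp cmp_assoc)
    also have "\<dots> = wh [] (nev n) (SB n) \<bullet> wh [] (iB n) (pw A n @ SB n) \<bullet> wh (SB n @ pw A n) (pB n) [] \<bullet>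
       wh (SB n) (wh [] (iA n) (pw B n) \<bullet> wh [] (pA n) (pw B n) \<bullet> nco n) []"
      by (simp add: wh_cmp reassoc2[OF exchange[of "iA n" "pB n" "SB n" "[]" "[]", simplified]])
    also have "wh [] (iA n) (pw B n) \<bullet> wh [] (pA n) (pw B n) \<bullet> nco n = wh (pw A n) (symmer B n) [] \<bullet> nco n"
      by (metis nco_symmer a.i_p wh_cmp cmp_assoc)
    also have "wh [] (nev n) (SB n) \<bullet> wh [] (iB n) (pw A n @ SB n) \<bullet> wh (SB n @ pw A n) (pB n) [] \<bullet>
         wh (SB n) (wh (pw A n) (symmer B n) [] \<bullet> nco n) []
       = wh [] (nev n) (SB n) \<bullet> wh [] (iB n) (pw A n @ SB n) \<bullet> wh (SB n @ pw A n) (pB n \<bullet> symmer B n) [] \<bullet>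
         wh (SB n) (nco n) []"
      by (simp add: wh_cmp cmp_assoc)
    also have "\<dots> = pB n \<bullet> wh [] (nev n) (pw B n) \<bullet> wh (pw B n) (nco n) [] \<bullet> iB n"
    proof -
      note m1 = exchange[of "iB n" "pB n" "[]" "pw A n" "[]", simplified]
      note m2 = exchange[of "nev n" "pB n" "[]" "[]" "[]", simplified]
      note m3 = exchange[of "iB n" "nco n" "[]" "[]" "[]", simplified]
      show ?thesis by (simp add: b.p_symmer reassoc2[OF m1] reassoc2[OF m2] m3)
    qed
    also have "\<dots> = idm (SB n)"
      by (simp add: reassoc[OF z'] b.p_i)
    finally show ?thesis .
  qed
  show ?thesis unfolding dual_pair_def using 1 2 by simp
qed

definition psi where "psi i j = wh (SA i) (b.mult i j) [] \<bullet> wh [] (sco i) (SB j)"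

lemma psi_typ [simp]: "arr (psi i j)" "src (psi i j) = SB j" "tgt (psi i j) = SA i @ SB (i + j)"
  by (auto simp: psi_def)

text \<open>Written on tensor powers: the symmetrizer between the coevaluation and the
  multiplication disappears into \<open>pB (i + j)\<close>.\<close>

lemma psi_eq: "psi i j = wh (SA i) (pB (i + j)) [] \<bullet> wh [] (pA i) (pw B (i + j)) \<bullet> wh [] (nco i) (pw B j) \<bullet> iB j"
proof -
  note m1 = exchange[of "pB i" "iB j" "SA i" "[]" "[]", simplified]
  note m2 = exchange[of "pA i" "iB j" "[]" "pw B i" "[]", simplified]
  note m3 = exchange[of "nco i" "iB j" "[]" "[]" "[]", simplified]
  have ab: "pB (i + j) \<bullet> wh [] (iB i) (pw B j) \<bullet> wh [] (pB i) (pw B j) = pB (i + j)"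
    using pB_absorb[of "i + j" 0 i j] by (simp add: wh_cmp flip: b.i_p)
  have "psi i j = wh (SA i) (pB (i + j)) [] \<bullet> wh (SA i) (iB i) (pw B j) \<bullet> wh (SA i @ SB i) (iB j) [] \<bullet>
      wh (SA i) (pB i) (SB j) \<bullet> wh [] (pA i) (pw B i @ SB j) \<bullet> wh [] (nco i) (SB j)"
    by (simp add: psi_def b.mult_def sco_def wh_cmp cmp_assoc)
  also have "\<dots> = wh (SA i) (pB (i + j)) [] \<bullet> wh (SA i) (iB i) (pw B j) \<bullet> wh (SA i) (pB i) (pw B j) \<bullet>
      wh [] (pA i) (pw B i @ pw B j) \<bullet> wh [] (nco i) (pw B j) \<bullet> iB j"
    by (simp add: reassoc2[OF m1[symmetric]] reassoc2[OF m2[symmetric]] m3[symmetric])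
  also have "\<dots> = wh (SA i) (pB (i + j) \<bullet> wh [] (iB i) (pw B j) \<bullet> wh [] (pB i) (pw B j)) [] \<bullet>
      wh [] (pA i) (pw B i @ pw B j) \<bullet> wh [] (nco i) (pw B j) \<bullet> iB j"
    by (simp add: wh_cmp cmp_assoc)
  finally show ?thesis by (simp add: ab pw_add)
qed

end

context sym_dual_objects
begin

lemma swap_sym_dual_objects:
  "sym_dual_objects arr src tgt idm cmp wh sym pls scl B A (ev \<bullet> sym A B) coi SB iB pB SA iA pA"
  by unfold_locales (rule dual_pair_swap[OF dual])

interpretation swap: sym_dual_objects arr src tgt idm cmp wh sym pls scl B A "ev \<bullet> sym A B" coi SB iB pB SA iA pA
  by (rule swap_sym_dual_objects)

text \<open>The map \<open>psi\<close> with \<open>A\<close> and \<open>B\<close> exchanged, under a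
  name that remains available outside the local interpretation \<open>swap\<close>.\<close>

definition psi' where "psi' j i = wh (SB j) (a.mult j i) [] \<bullet> wh [] (swap.sco j) (SA i)"

lemma swap_psi: "swap.psi = psi'"
  by (intro ext) (simp add: psi'_def swap.psi_def)

lemma psi'_typ [simp]: "arr (psi' j i)" "src (psi' j i) = SA i" "tgt (psi' j i) = SB j @ SA (j + i)"
  unfolding swap_psi[symmetric] by simp_all

lemma psi'_eq: "psi' j i = wh (SB j) (pA (j + i)) [] \<bullet> wh [] (pB j) (pw A (j + i)) \<bullet> wh [] (ncoi j) (pw A i) \<bullet> iA i"
  unfolding swap_psi[symmetric] by (rule swap.psi_eq)

text \<open>After all symmetrizers are collected into one, the strands fall into two groups:
  \<open>i\<close> of them form zigzags and become straight, the other \<open>j\<close> close up to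
  loops around the symmetrizer.\<close>

lemma psi_psi':
  assumes g: "g = i + j"
  shows "wh (SA i) (sev g) [] \<bullet> wh [] (psi i j) (SA g) \<bullet> psi' j i =
    pA i \<bullet> ltrace_pow j (pw A i) (symmer A g) \<bullet> iA i"
proof -
  have pwg: "pw A g = pw A j @ pw A i" "pw B g = pw B i @ pw B j"
    using g by (simp_all add: pw_add pw_swap)
  have g': "j + i = g" "i + j = g" using g by simp_all
  have nevg: "nev g = nev i \<bullet> wh (pw B i) (nev j) (pw A i)"
    using nev_add[of i j] g by simp
  have psi: "psi i j = wh (SA i) (pB g) [] \<bullet> wh [] (pA i) (pw B g) \<bullet> wh [] (nco i) (pw B j) \<bullet> iB j"
    using psi_eq[of i j] g' by simp
  have psi': "psi' j i = wh (SB j) (pA g) [] \<bullet> wh [] (pB j) (pw A g) \<bullet> wh [] (ncoi j) (pw A i) \<bullet> iA i"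
    using psi'_eq[of j i] g' by simp
  define tl where "tl = wh [] (ncoi j) (pw A i) \<bullet> iA i"
  have [simp]: "arr tl" "src tl = SA i" "tgt tl = pw B j @ pw A g"
    by (auto simp: tl_def pwg)
  have "wh (SA i) (sev g) [] \<bullet> wh [] (psi i j) (SA g) \<bullet> psi' j i =
     wh (SA i) (nev g) [] \<bullet> wh (SA i) (iB g) (pw A g) \<bullet> wh (SA i @ SB g) (iA g) [] \<bullet>
     wh (SA i) (pB g) (SA g) \<bullet> wh [] (pA i) (pw B g @ SA g) \<bullet> wh [] (nco i) (pw B j @ SA g) \<bullet>
     wh [] (iB j) (SA g) \<bullet> wh (SB j) (pA g) [] \<bullet> wh [] (pB j) (pw A g) \<bullet> tl"
    unfolding psi psi' sev_def tl_def by (simp add: wh_cmp cmp_assoc pwg)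
  \<comment> \<open>\<open>iA g\<close> is moved to the far end next to \<open>pA g\<close>, which
    also brings \<open>iB g\<close> next to \<open>pB g\<close>. Both pairs then combine to
    symmetrizers.\<close>
  also have "\<dots> = wh (SA i) (nev g) [] \<bullet> wh (SA i) (iB g) (pw A g) \<bullet> wh (SA i) (pB g) (pw A g) \<bullet>
     wh [] (pA i) (pw B g @ pw A g) \<bullet> wh [] (nco i) (pw B j @ pw A g) \<bullet>
     wh [] (iB j) (pw A g) \<bullet> wh (SB j) (iA g) [] \<bullet> wh (SB j) (pA g) [] \<bullet> wh [] (pB j) (pw A g) \<bullet> tl"
  proof -
    note m1 = exchange[of "pB g" "iA g" "SA i" "[]" "[]", simplified]
    note m2 = exchange[of "pA i" "iA g" "[]" "pw B g" "[]", simplified]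
    have m3: "wh (pw A i @ pw B g) (iA g) [] \<bullet> wh [] (nco i) (pw B j @ SA g) = wh [] (nco i) (pw B j @ pw A g) \<bullet> wh (pw B j) (iA g) []"
      using exchange[of "nco i" "iA g" "[]" "pw B j" "[]", simplified] by (simp add: pwg)
    note m4 = exchange[of "iB j" "iA g" "[]" "[]" "[]", simplified]
    show ?thesis
      by (simp only: reassoc2[OF m1[symmetric]] reassoc2[OF m2[symmetric]] reassoc2[OF m3] reassoc2[OF m4[symmetric]])
  qed
  also have "\<dots> = wh (SA i) (nev g \<bullet> wh [] (iB g) (pw A g) \<bullet> wh [] (pB g) (pw A g)) [] \<bullet>
     wh [] (pA i) (pw B g @ pw A g) \<bullet> wh [] (nco i) (pw B j @ pw A g) \<bullet>
     wh [] (iB j) (pw A g) \<bullet> wh (SB j) (iA g \<bullet> pA g) [] \<bullet> wh [] (pB j) (pw A g) \<bullet> tl"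
    by (simp add: wh_cmp cmp_assoc)
  also have "nev g \<bullet> wh [] (iB g) (pw A g) \<bullet> wh [] (pB g) (pw A g) = nev g \<bullet> wh [] (symmer B g) (pw A g)"
    by (metis b.i_p wh_cmp)
  also have "iA g \<bullet> pA g = symmer A g" by (rule a.i_p)
  also have "wh (SA i) (nev g \<bullet> wh [] (symmer B g) (pw A g)) [] \<bullet>
     wh [] (pA i) (pw B g @ pw A g) \<bullet> wh [] (nco i) (pw B j @ pw A g) \<bullet>
     wh [] (iB j) (pw A g) \<bullet> wh (SB j) (symmer A g) [] \<bullet> wh [] (pB j) (pw A g) \<bullet> tl
   = pA i \<bullet> wh (pw A i) (nev g \<bullet> wh [] (symmer B g) (pw A g)) [] \<bullet> wh [] (nco i) (pw B j @ pw A g) \<bullet>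
     wh [] (iB j \<bullet> pB j) (pw A g) \<bullet> wh (pw B j) (symmer A g) [] \<bullet> tl"
  proof -
    note m1 = exchange[of "pA i" "nev g \<bullet> wh [] (symmer B g) (pw A g)" "[]" "[]" "[]", simplified]
    note m2 = exchange[of "pB j" "symmer A g" "[]" "[]" "[]", simplified]
    show ?thesis
      by (simp add: reassoc2[OF m1[symmetric]] reassoc2[OF m2[symmetric]] cmp_assoc wh_cmp[of "[]" "iB j" "pB j"])
  qed
  also have "iB j \<bullet> pB j = symmer B j" by (rule b.i_p)
  \<comment> \<open>The symmetrizer of \<open>j\<close> factors slides past \<open>nco i\<close>
    onto the last \<open>j\<close> of the \<open>g\<close> factors \<open>B\<close>, where
    \<open>symmer B g\<close> absorbs it.\<close>
  also have "wh [] (nco i) (pw B j @ pw A g) \<bullet> wh [] (symmer B j) (pw A g) \<bullet> wh (pw B j) (symmer A g) [] \<bullet> tl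
    = wh (pw A i) (wh (pw B i) (symmer B j) (pw A g)) [] \<bullet> wh [] (nco i) (pw B j @ pw A g) \<bullet> wh (pw B j) (symmer A g) [] \<bullet> tl"
    using reassoc2[OF exchange[of "nco i" "symmer B j" "[]" "[]" "pw A g", simplified]] by simp
  also have "pA i \<bullet> wh (pw A i) (nev g \<bullet> wh [] (symmer B g) (pw A g)) [] \<bullet>
      wh (pw A i) (wh (pw B i) (symmer B j) (pw A g)) [] \<bullet> wh [] (nco i) (pw B j @ pw A g) \<bullet> wh (pw B j) (symmer A g) [] \<bullet> tl
    = pA i \<bullet> wh (pw A i) (nev g \<bullet> wh [] (symmer B g \<bullet> wh (pw B i) (symmer B j) []) (pw A g)) [] \<bullet>
      wh [] (nco i) (pw B j @ pw A g) \<bullet> wh (pw B j) (symmer A g) [] \<bullet> tl"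
    by (simp add: wh_cmp cmp_assoc)
  also have "symmer B g \<bullet> wh (pw B i) (symmer B j) [] = symmer B g"
    using swap.symmer_absorb_right[of g i j 0] g by simp
  \<comment> \<open>The symmetrizer changes to the \<open>A\<close> side of the pairing, where it
    merges with the one already there.\<close>
  also have "nev g \<bullet> wh [] (symmer B g) (pw A g) = nev g \<bullet> wh (pw B g) (symmer A g) []"
    by (rule symmer_transpose)
  also have "pA i \<bullet> wh (pw A i) (nev g \<bullet> wh (pw B g) (symmer A g) []) [] \<bullet>
      wh [] (nco i) (pw B j @ pw A g) \<bullet> wh (pw B j) (symmer A g) [] \<bullet> tl
    = pA i \<bullet> wh (pw A i) (nev g) [] \<bullet> wh [] (nco i) (pw B j @ pw A g) \<bullet>
      wh (pw B j) (symmer A g \<bullet> symmer A g) [] \<bullet> tl"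
  proof -
    have m: "wh (pw A i @ pw B g) (symmer A g) [] \<bullet> wh [] (nco i) (pw B j @ pw A g) =
        wh [] (nco i) (pw B j @ pw A g) \<bullet> wh (pw B j) (symmer A g) []"
      using exchange[of "nco i" "symmer A g" "[]" "pw B j" "[]", simplified] by (simp add: pwg)
    show ?thesis by (simp add: wh_cmp cmp_assoc reassoc2[OF m])
  qed
  also have "symmer A g \<bullet> symmer A g = symmer A g" by (rule symmer_idem)
  \<comment> \<open>The pairing splits into \<open>i\<close> outer and \<open>j\<close> inner pairs.
    The outer ones form zigzags with \<open>nco i\<close>, the inner ones form loops with
    \<open>ncoi j\<close>.\<close>
  also have "wh (pw A i) (nev g) [] \<bullet> wh [] (nco i) (pw B j @ pw A g) \<bullet> wh (pw B j) (symmer A g) [] \<bullet> tl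
    = (wh (pw A i) (nev i) [] \<bullet> wh [] (nco i) (pw A i)) \<bullet> wh [] (nev j) (pw A i) \<bullet> wh (pw B j) (symmer A g) [] \<bullet> tl"
  proof -
    note m = exchange[of "nco i" "nev j" "[]" "[]" "pw A i", simplified]
    show ?thesis
      by (simp add: nevg wh_cmp cmp_assoc pwg(1) reassoc2[OF m[symmetric]])
  qed
  also have "wh (pw A i) (nev i) [] \<bullet> wh [] (nco i) (pw A i) = idm (pw A i)"
    using nested_dual_pair[of i] by (simp add: dual_pair_def)
  also have "idm (pw A i) \<bullet> wh [] (nev j) (pw A i) \<bullet> wh (pw B j) (symmer A g) [] \<bullet> tl
      = ltrace_pow j (pw A i) (symmer A g) \<bullet> iA i"
    by (simp add: ltrace_pow_def tl_def cmp_assoc pwg)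
  finally show ?thesis .
qed

lemma is_iso_psi_psi':
  assumes g: "g = i + j" and f: "is_iso (fall (rk \<boxplus> scl (of_nat g - 1) (idm [])) j)"
  shows "is_iso (wh (SA i) (sev g) [] \<bullet> wh [] (psi i j) (SA g) \<bullet> psi' j i)"
proof -
  let ?f = "fall (rk \<boxplus> scl (of_nat g - 1) (idm [])) j"
  have g': "g = j + i" using g by simp
  have [simp]: "arr ?f" "src ?f = []" "tgt ?f = []" by auto
  have "pA i \<bullet> wh [] ?f (pw A i) \<bullet> symmer A i \<bullet> iA i = wh [] ?f (SA i)"
    by (simp add: a.symmer_i reassoc2[OF exchange[of ?f "pA i" "[]" "[]" "[]", simplified, symmetric]] a.p_i)
  then have "pA i \<bullet> ltrace_pow j (pw A i) (symmer A g) \<bullet> iA i = scl (fact i / fact g) (wh [] ?f (SA i))"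
    unfolding g' ltrace_pow_symmer by (simp add: scl_cmp cmp_scl cmp_assoc)
  then show ?thesis
    unfolding psi_psi'[OF g] using is_iso_scl[OF is_iso_wh[OF f]] by simp
qed

end

section \<open>The factorwise pairing and its comparison with the nested one\<close>

context strict_smc
begin

text \<open>The strict image of \<open>tensor_pow_ev\<close>: k-th factors are paired with each
  other, which costs one block crossing at every step.\<close>

primrec pow_ev :: "'o list \<Rightarrow> 'o list \<Rightarrow> 'a \<Rightarrow> nat \<Rightarrow> 'a" where
  "pow_ev A B e 0 = idm []"
| "pow_ev A B e (Suc n) = pow_ev A B e n \<bullet> wh [] e (pw B n @ pw A n) \<bullet> wh B (sym (pw B n) A) (pw A n)"

lemma pow_ev_typ [simp]:
  assumes "arr e" "src e = B @ A" "tgt e = []"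
  shows "arr (pow_ev A B e n)" "src (pow_ev A B e n) = pw B n @ pw A n" "tgt (pow_ev A B e n) = []"
  using assms by (induction n) auto

text \<open>At each step the two pairings differ by moving one factor \<open>B\<close> past the
  others; sliding this crossing onto the \<open>B\<close> side lets the symmetrizer absorb
  it.\<close>

lemma pow_ev_symmer:
  assumes [simp]: "arr e" "src e = B @ A" "tgt e = []"
  shows "pow_ev A B e n \<bullet> wh [] (symmer B n) (pw A n) = nested_ev A B e n \<bullet> wh [] (symmer B n) (pw A n)"
proof (induction n)
  case 0
  then show ?case by simp
next
  case (Suc n)
  let ?s = "symmer B (Suc n)"
  have [simp]: "arr (nested_ev A B e n)" "src (nested_ev A B e n) = pw B n @ pw A n" "tgt (nested_ev A B e n) = []" for n
    by (induction n) auto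
  have bl: "sym B (pw B n) \<bullet> ?s = ?s"
    using left_absorbs_block1[OF symmer_left_absorbs[of B "Suc n"]] by simp
  have sl: "wh [] (symmer B n) B \<bullet> ?s = ?s"
    using symmer_left[OF left_absorbs_sub[of B "[]" 0 n 1 "[]" ?s]] symmer_left_absorbs[of B "Suc n"] by simp
  have "wh [] e (pw B n) \<bullet> wh B (sym (pw B n) A) [] = wh (pw B n) e [] \<bullet> wh [] (sym B (pw B n)) A"
    by (rule pairing_slide) auto
  then have "wh [] (wh [] e (pw B n) \<bullet> wh B (sym (pw B n) A) []) (pw A n) =
      wh [] (wh (pw B n) e [] \<bullet> wh [] (sym B (pw B n)) A) (pw A n)" by simp
  then have st: "wh [] e (pw B n @ pw A n) \<bullet> wh B (sym (pw B n) A) (pw A n) =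
      wh (pw B n) e (pw A n) \<bullet> wh [] (sym B (pw B n)) (A @ pw A n)"
    by (simp add: wh_cmp)
  \<comment> \<open>The symmetrizer of n + 1 factors can give off one of n factors; this copy feeds
    the induction hypothesis.\<close>
  have c: "wh (pw B n) e (pw A n) \<bullet> wh [] ?s (A @ pw A n) =
      wh [] (symmer B n) (pw A n) \<bullet> wh (pw B n) e (pw A n) \<bullet> wh [] ?s (A @ pw A n)"
  proof -
    have "wh [] ?s (A @ pw A n) = wh [] (wh [] (symmer B n) B \<bullet> ?s) (A @ pw A n)"
      by (simp only: sl)
    also have "\<dots> = wh [] (symmer B n) (B @ A @ pw A n) \<bullet> wh [] ?s (A @ pw A n)"
      by (simp add: wh_cmp del: symmer.simps)
    finally have 1: "wh [] ?s (A @ pw A n) = wh [] (symmer B n) (B @ A @ pw A n) \<bullet> wh [] ?s (A @ pw A n)" .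
    have 2: "wh (pw B n) e (pw A n) \<bullet> wh [] (symmer B n) (B @ A @ pw A n) =
        wh [] (symmer B n) (pw A n) \<bullet> wh (pw B n) e (pw A n)"
      using exchange[of "symmer B n" e "[]" "[]" "pw A n"] by simp
    show ?thesis by (subst 1) (simp only: reassoc2[OF 2])
  qed
  have "pow_ev A B e (Suc n) \<bullet> wh [] ?s (pw A (Suc n)) =
      pow_ev A B e n \<bullet> wh (pw B n) e (pw A n) \<bullet> wh [] (sym B (pw B n) \<bullet> ?s) (A @ pw A n)"
    by (simp add: cmp_assoc reassoc2[OF st] wh_cmp del: symmer.simps)
  also have "\<dots> = (pow_ev A B e n \<bullet> wh [] (symmer B n) (pw A n)) \<bullet> wh (pw B n) e (pw A n) \<bullet> wh [] ?s (A @ pw A n)"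
    unfolding bl by (subst c) (simp only: cmp_assoc)
  also have "\<dots> = nested_ev A B e n \<bullet> wh (pw B n) e (pw A n) \<bullet> wh [] ?s (A @ pw A n)"
    unfolding Suc.IH by (simp only: cmp_assoc c[symmetric])
  finally show ?case by (simp add: cmp_assoc del: symmer.simps)
qed

text \<open>The block symmetry decomposes into the crossing of the two leading factors, the block
  symmetry of the rest and the two block crossings that occur in the recursions on both sides. This
  matches the definition of \<open>tensor_pow_ev_symm\<close>.\<close>

lemma pow_ev_swap:
  assumes [simp]: "arr e" "src e = B @ A" "tgt e = []"
  shows "pow_ev B A (e \<bullet> sym A B) n = pow_ev A B e n \<bullet> sym (pw A n) (pw B n)"
proof (induction n)
  case 0
  then show ?case by simp
next
  case (Suc n)
  have 1: "sym (A @ pw A n) (B @ pw B n) =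
    wh B (sym A (pw B n)) (pw A n) \<bullet> wh [] (sym A B) (pw B n @ pw A n) \<bullet>
    wh (A @ B) (sym (pw A n) (pw B n)) [] \<bullet> wh A (sym (pw A n) B) (pw B n)"
    by (subst hexagon_left)
      (simp add: hexagon[of A B "pw B n"] hexagon[of "pw A n" B "pw B n"] wh_cmp cmp_assoc)
  have 2: "wh [] (e \<bullet> sym A B) (pw B n @ pw A n) \<bullet> wh (A @ B) (sym (pw A n) (pw B n)) [] =
      sym (pw A n) (pw B n) \<bullet> wh [] (e \<bullet> sym A B) (pw A n @ pw B n)"
    using exchange[of "e \<bullet> sym A B" "sym (pw A n) (pw B n)" "[]" "[]" "[]"] by simp
  have "pow_ev A B e (Suc n) \<bullet> sym (pw A (Suc n)) (pw B (Suc n)) =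
     pow_ev A B e n \<bullet> (wh [] (e \<bullet> sym A B) (pw B n @ pw A n) \<bullet> wh (A @ B) (sym (pw A n) (pw B n)) []) \<bullet>
     wh A (sym (pw A n) B) (pw B n)"
    by (simp add: 1 cmp_assoc wh_cmp)
  also have "\<dots> = pow_ev B A (e \<bullet> sym A B) (Suc n)"
    unfolding 2 by (simp add: Suc.IH cmp_assoc)
  finally show ?case by simp
qed

end

context sym_dual_objects
begin

interpretation swap: sym_dual_objects arr src tgt idm cmp wh sym pls scl B A "ev \<bullet> sym A B" coi SB iB pB SA iA pA
  by (rule swap_sym_dual_objects)

lemma swap_rk: "swap.rk = rk"
  by (simp add: swap.rk_def rk_def cmp_assoc)

lemma swap_psi': "swap.psi' = psi"
  by (intro ext) (simp add: swap.psi'_eq psi_eq)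

text \<open>The composites \<open>u\<close> and \<open>v\<close> needed by \<open>cross_iso\<close>
  are the same statement for the two orders of \<open>A\<close> and \<open>B\<close>. They involve
  falling factorials with \<open>j\<close> and \<open>i\<close> factors of one and the same scalar,
  since the rank does not change under the exchange.\<close>

lemma psi_iso:
  assumes f: "is_iso f" "src f = SA g @ L'" "tgt f = []"
    and b: "\<And>k. k \<le> g \<Longrightarrow> is_iso (fall (rk \<boxplus> scl (of_nat g - 1) (idm [])) k)"
    and g: "g = i + j"
  shows "is_iso (psi i j)" "is_iso (psi' j i)"
proof -
  have e1: "is_iso (sev g)"
    using invertible_dual_ev[OF sym_dual_pair f] .
  \<comment> \<open>Being invertible, \<open>sev g\<close> exhibits the power of \<open>A\<close> as
    a tensor inverse of that of \<open>B\<close>.\<close>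
  have e2: "is_iso (swap.sev g)"
    by (rule invertible_dual_ev[OF swap.sym_dual_pair e1]) auto
  have u: "is_iso (wh (SA i) (sev g) [] \<bullet> wh [] (psi i j) (SA g) \<bullet> psi' j i)"
    using is_iso_psi_psi'[OF g] b g by simp
  have "is_iso (wh (SB j) (swap.sev g) [] \<bullet> wh [] (swap.psi j i) (SB g) \<bullet> swap.psi' i j)"
    using swap.is_iso_psi_psi'[of g j i] b g by (simp add: swap_rk)
  then have v: "is_iso (wh (SB j) (swap.sev g) [] \<bullet> wh [] (psi' j i) (SB g) \<bullet> psi i j)"
    by (simp add: swap_psi swap_psi')
  have g': "i + j = g" "j + i = g" using g by auto
  show "is_iso (psi i j)"
    by (rule cross_iso[OF _ _ _ _ _ _ e1 _ _ e2 _ _ u v]) (auto simp: g')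
  show "is_iso (psi' j i)"
    by (rule cross_iso[OF _ _ _ _ _ _ e2 _ _ e1 _ _ v u]) (auto simp: g')
qed

text \<open>The strict image of the morphism whose adjunct is \<open>iota_lower\<close>; with the
  roles exchanged, of the one for \<open>iota_upper\<close>.\<close>

definition contraction where
  "contraction j i = pA i \<bullet> wh [] (pow_ev A B ev j) (pw A i) \<bullet> wh [] (iB j) (pw A (j + i)) \<bullet> wh (SB j) (iA (j + i)) []"

lemma pow_ev_iB: "pow_ev A B ev j \<bullet> wh [] (iB j) (pw A j) = nev j \<bullet> wh [] (iB j) (pw A j)"
proof -
  have "pow_ev A B ev j \<bullet> wh [] (symmer B j \<bullet> iB j) (pw A j) = nev j \<bullet> wh [] (symmer B j \<bullet> iB j) (pw A j)"
    unfolding wh_cmp using reassoc2[OF pow_ev_symmer[of ev B A j]] by simp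
  then show ?thesis by (simp only: b.symmer_i)
qed

text \<open>The coevaluation of \<open>j + i\<close> factors has \<open>j\<close> outer and
  \<open>i\<close> inner pairs. The outer ones cancel against the evaluation in the contraction, and
  the inner ones are the coevaluation in \<open>psi i j\<close>.\<close>

lemma contraction_mate:
  "wh [] (contraction j i) (SB (j + i)) \<bullet> wh (SB j) (sco (j + i)) [] = psi i j"
proof -
  define g where "g = j + i"
  have pwg: "pw A g = pw A j @ pw A i" "pw B g = pw B i @ pw B j"
    unfolding g_def by (simp_all add: pw_add pw_swap)
  have pe': "wh [] (pow_ev A B ev j) X \<bullet> wh [] (iB j) (pw A j @ X) = wh [] (nev j) X \<bullet> wh [] (iB j) (pw A j @ X)" for X
  proof -
    have "wh [] (pow_ev A B ev j \<bullet> wh [] (iB j) (pw A j)) X = wh [] (nev j \<bullet> wh [] (iB j) (pw A j)) X"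
      by (simp only: pow_ev_iB)
    then show ?thesis by (simp add: wh_cmp)
  qed
  have ng: "nco g = wh (pw A j) (nco i) (pw B j) \<bullet> nco j"
    unfolding g_def by (rule nco_add)
  have "wh [] (contraction j i) (SB g) \<bullet> wh (SB j) (sco g) [] =
     wh [] (pA i) (SB g) \<bullet> wh [] (nev j) (pw A i @ SB g) \<bullet> wh [] (iB j) (pw A g @ SB g) \<bullet>
     wh (SB j) (iA g) (SB g) \<bullet> wh (SB j @ SA g) (pB g) [] \<bullet> wh (SB j) (pA g) (pw B g) \<bullet> wh (SB j) (nco g) []"
    unfolding contraction_def g_def[symmetric] sco_def
    by (simp add: wh_cmp cmp_assoc pwg(1) reassoc2[OF pe'])
  also have "\<dots> = wh [] (pA i) (SB g) \<bullet> wh [] (nev j) (pw A i @ SB g) \<bullet> wh [] (iB j) (pw A g @ SB g) \<bullet>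
     wh (SB j @ pw A g) (pB g) [] \<bullet> wh (SB j) (wh [] (iA g) (pw B g) \<bullet> wh [] (pA g) (pw B g) \<bullet> nco g) []"
    by (simp add: wh_cmp reassoc2[OF exchange[of "iA g" "pB g" "SB j" "[]" "[]", simplified]])
  also have "wh [] (iA g) (pw B g) \<bullet> wh [] (pA g) (pw B g) \<bullet> nco g = wh (pw A g) (symmer B g) [] \<bullet> nco g"
    by (metis nco_symmer a.i_p wh_cmp cmp_assoc)
  also have "wh [] (pA i) (SB g) \<bullet> wh [] (nev j) (pw A i @ SB g) \<bullet> wh [] (iB j) (pw A g @ SB g) \<bullet>
     wh (SB j @ pw A g) (pB g) [] \<bullet> wh (SB j) (wh (pw A g) (symmer B g) [] \<bullet> nco g) [] =
     wh [] (pA i) (SB g) \<bullet> wh [] (nev j) (pw A i @ SB g) \<bullet> wh [] (iB j) (pw A g @ SB g) \<bullet>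
     wh (SB j @ pw A g) (pB g \<bullet> symmer B g) [] \<bullet> wh (SB j) (nco g) []"
    by (simp add: wh_cmp cmp_assoc)
  also have "\<dots> = wh (SA i) (pB g) [] \<bullet> wh [] (pA i) (pw B g) \<bullet> wh [] (nev j) (pw A i @ pw B g) \<bullet>
     wh (pw B j) (nco g) [] \<bullet> iB j"
  proof -
    note m1 = exchange[of "iB j" "pB g" "[]" "pw A g" "[]", simplified]
    note m2 = exchange[of "nev j" "pB g" "[]" "pw A i" "[]", simplified]
    note m3 = exchange[of "pA i" "pB g" "[]" "[]" "[]", simplified]
    note m4 = exchange[of "iB j" "nco g" "[]" "[]" "[]", simplified]
    show ?thesis
      by (simp add: b.p_symmer reassoc2[OF m1] m4) (simp add: pwg(1) reassoc2[OF m2] reassoc2[OF m3])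
  qed
  also have "wh [] (nev j) (pw A i @ pw B g) \<bullet> wh (pw B j) (nco g) [] \<bullet> iB j = wh [] (nco i) (pw B j) \<bullet> iB j"
  proof -
    have z: "wh [] (nev j) (pw B j) \<bullet> wh (pw B j) (nco j) [] = idm (pw B j)"
      using nested_dual_pair[of j] by (simp add: dual_pair_def)
    note m = exchange[of "nev j" "nco i" "[]" "[]" "pw B j", simplified]
    show ?thesis
      unfolding ng pwg(2) wh_cmp by (simp add: cmp_assoc reassoc2[OF m] reassoc[OF z])
  qed
  finally show ?thesis unfolding psi_eq g_def by (simp add: add.commute)
qed

definition swap_sco where "swap_sco = swap.sco"

text \<open>Commutativity replaces the product in one order by the product in the other; the
  crossings that remain combine to a single one in front.\<close>

lemma mult_mate:
  "wh [] (a.mult i j) (SB j) \<bullet> wh (SA i) (sym (SB j) (SA j) \<bullet> swap_sco j) [] = sym (SB j) (SA (i + j)) \<bullet> psi' j i"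
proof -
  have [simp]: "arr (swap_sco j)" "src (swap_sco j) = []" "tgt (swap_sco j) = SB j @ SA j"
    by (simp_all add: swap_sco_def)
  let ?c = "sym (SB j) (SA j) \<bullet> swap_sco j"
  have 1: "sym (SB j) (SA (i + j)) \<bullet> wh (SB j) (a.mult j i) [] = wh [] (a.mult j i) (SB j) \<bullet> sym (SB j) (SA j @ SA i)"
    using sym_natural_wh'[of "a.mult j i" "SA j @ SA i" "SA (j + i)" "[]" "SB j" "[]"] by (simp add: add.commute)
  have "sym (SB j) (SA (i + j)) \<bullet> psi' j i = wh [] (a.mult j i) (SB j) \<bullet> sym (SB j) (SA j @ SA i) \<bullet> wh [] (swap_sco j) (SA i)"
    by (simp add: psi'_def swap_sco_def reassoc2[OF 1])
  also have "wh [] (a.mult j i) (SB j) = wh [] (a.mult i j) (SB j) \<bullet> wh [] (sym (SA j) (SA i)) (SB j)"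
    by (metis mult_commute wh_cmp)
  also have "(wh [] (a.mult i j) (SB j) \<bullet> wh [] (sym (SA j) (SA i)) (SB j)) \<bullet> sym (SB j) (SA j @ SA i) \<bullet> wh [] (swap_sco j) (SA i)
     = wh [] (a.mult i j) (SB j) \<bullet> sym (SA j @ SB j) (SA i) \<bullet> wh [] ?c (SA i)"
    by (simp add: hexagon hexagon_left wh_cmp cmp_assoc)
  also have "sym (SA j @ SB j) (SA i) \<bullet> wh [] ?c (SA i) = wh (SA i) ?c []"
    using sym_natural[of ?c "SA i"] by simp
  finally show ?thesis by simp
qed

lemma mult_dual_pair: "dual_pair (SA j) (SB j) (swap.sev j \<bullet> sym (SB j) (SA j)) (sym (SB j) (SA j) \<bullet> swap_sco j)"
  unfolding swap_sco_def by (rule dual_pair_swap[OF swap.sym_dual_pair])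

end

section \<open>Strictification\<close>

text \<open>A category with total operations: ill-typed composites are not arrows. The inverses of
  the constraints belong to the data, so that they cancel by rewriting.\<close>

locale monoidal_arrows =
  fixes arr :: "'a \<Rightarrow> bool"
    and src tgt :: "'a \<Rightarrow> 'o"
    and idm :: "'o \<Rightarrow> 'a"
    and cmp :: "'a \<Rightarrow> 'a \<Rightarrow> 'a"  (infixr "\<bullet>" 60)
    and null :: 'a
    and pls :: "'a \<Rightarrow> 'a \<Rightarrow> 'a"
    and scl :: "rat \<Rightarrow> 'a \<Rightarrow> 'a"
    and tno :: "'o \<Rightarrow> 'o \<Rightarrow> 'o"  (infixr "\<odot>" 70)
    and ten :: "'a \<Rightarrow> 'a \<Rightarrow> 'a"  (infixr "\<star>" 70)
    and unt :: 'o
    and as as' :: "'o \<Rightarrow> 'o \<Rightarrow> 'o \<Rightarrow> 'a"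
    and lu lu' ru ru' :: "'o \<Rightarrow> 'a"
    and sy :: "'o \<Rightarrow> 'o \<Rightarrow> 'a"
  assumes null [simp]: "\<not> arr null"
    and arr_idm [simp]: "arr (idm X)"
    and src_idm [simp]: "src (idm X) = X"
    and tgt_idm [simp]: "tgt (idm X) = X"
    and arr_cmp [simp]: "arr (g \<bullet> f) \<longleftrightarrow> arr g \<and> arr f \<and> src g = tgt f"
    and src_cmp [simp]: "arr g \<Longrightarrow> arr f \<Longrightarrow> src g = tgt f \<Longrightarrow> src (g \<bullet> f) = src f"
    and tgt_cmp [simp]: "arr g \<Longrightarrow> arr f \<Longrightarrow> src g = tgt f \<Longrightarrow> tgt (g \<bullet> f) = tgt g"
    and cmp_assoc: "(h \<bullet> g) \<bullet> f = h \<bullet> (g \<bullet> f)"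
    and cmp_idm [simp]: "arr f \<Longrightarrow> src f = X \<Longrightarrow> f \<bullet> idm X = f"
    and idm_cmp [simp]: "arr f \<Longrightarrow> tgt f = X \<Longrightarrow> idm X \<bullet> f = f"
    and arr_ten [simp]: "arr f \<Longrightarrow> arr g \<Longrightarrow> arr (f \<star> g)"
    and src_ten [simp]: "arr f \<Longrightarrow> arr g \<Longrightarrow> src (f \<star> g) = src f \<odot> src g"
    and tgt_ten [simp]: "arr f \<Longrightarrow> arr g \<Longrightarrow> tgt (f \<star> g) = tgt f \<odot> tgt g"
    and ten_idm [simp]: "idm X \<star> idm Y = idm (X \<odot> Y)"
    and ten_cmp: "arr f \<Longrightarrow> arr g \<Longrightarrow> src g = tgt f \<Longrightarrow> arr f' \<Longrightarrow> arr g' \<Longrightarrow> src g' = tgt f' \<Longrightarrow>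
      (g \<star> g') \<bullet> (f \<star> f') = (g \<bullet> f) \<star> (g' \<bullet> f')"
    and as_typ [simp]: "arr (as X Y Z)" "src (as X Y Z) = (X \<odot> Y) \<odot> Z" "tgt (as X Y Z) = X \<odot> (Y \<odot> Z)"
    and as'_typ [simp]: "arr (as' X Y Z)" "tgt (as' X Y Z) = (X \<odot> Y) \<odot> Z" "src (as' X Y Z) = X \<odot> (Y \<odot> Z)"
    and as_as' [simp]: "as X Y Z \<bullet> as' X Y Z = idm (X \<odot> (Y \<odot> Z))" "as' X Y Z \<bullet> as X Y Z = idm ((X \<odot> Y) \<odot> Z)"
    and as_natural: "arr f \<Longrightarrow> arr g \<Longrightarrow> arr h \<Longrightarrow>
      as (tgt f) (tgt g) (tgt h) \<bullet> ((f \<star> g) \<star> h) = (f \<star> (g \<star> h)) \<bullet> as (src f) (src g) (src h)"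
    and lu_typ [simp]: "arr (lu X)" "src (lu X) = unt \<odot> X" "tgt (lu X) = X"
    and lu'_typ [simp]: "arr (lu' X)" "tgt (lu' X) = unt \<odot> X" "src (lu' X) = X"
    and lu_lu' [simp]: "lu X \<bullet> lu' X = idm X" "lu' X \<bullet> lu X = idm (unt \<odot> X)"
    and lu_natural: "arr f \<Longrightarrow> lu (tgt f) \<bullet> (idm unt \<star> f) = f \<bullet> lu (src f)"
    and ru_typ [simp]: "arr (ru X)" "src (ru X) = X \<odot> unt" "tgt (ru X) = X"
    and ru'_typ [simp]: "arr (ru' X)" "tgt (ru' X) = X \<odot> unt" "src (ru' X) = X"
    and ru_ru' [simp]: "ru X \<bullet> ru' X = idm X" "ru' X \<bullet> ru X = idm (X \<odot> unt)"
    and ru_natural: "arr f \<Longrightarrow> ru (tgt f) \<bullet> (f \<star> idm unt) = f \<bullet> ru (src f)"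
    and sy_typ [simp]: "arr (sy X Y)" "src (sy X Y) = X \<odot> Y" "tgt (sy X Y) = Y \<odot> X"
    and sy_natural: "arr f \<Longrightarrow> arr g \<Longrightarrow> sy (tgt f) (tgt g) \<bullet> (f \<star> g) = (g \<star> f) \<bullet> sy (src f) (src g)"
    and sy_sy [simp]: "sy Y X \<bullet> sy X Y = idm (X \<odot> Y)"
    and pentagon: "as W X (Y \<odot> Z) \<bullet> as (W \<odot> X) Y Z =
      (idm W \<star> as X Y Z) \<bullet> as W (X \<odot> Y) Z \<bullet> (as W X Y \<star> idm Z)"
    and triangle: "(idm X \<star> lu Y) \<bullet> as X unt Y = ru X \<star> idm Y"
    and hexagon: "as Y Z X \<bullet> sy X (Y \<odot> Z) \<bullet> as X Y Z =
      (idm Y \<star> sy X Z) \<bullet> as Y X Z \<bullet> (sy X Y \<star> idm Z)"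
begin

lemma reassoc: "a \<bullet> b = c \<Longrightarrow> a \<bullet> (b \<bullet> x) = c \<bullet> x"
  by (metis cmp_assoc)

lemma reassoc2: "a \<bullet> b = c \<bullet> d \<Longrightarrow> a \<bullet> (b \<bullet> x) = c \<bullet> (d \<bullet> x)"
  by (metis cmp_assoc)

lemma inverse_cmp [simp]:
  "arr x \<Longrightarrow> tgt x = X \<odot> (Y \<odot> Z) \<Longrightarrow> as X Y Z \<bullet> (as' X Y Z \<bullet> x) = x"
  "arr x \<Longrightarrow> tgt x = (X \<odot> Y) \<odot> Z \<Longrightarrow> as' X Y Z \<bullet> (as X Y Z \<bullet> x) = x"
  "arr x \<Longrightarrow> tgt x = X \<Longrightarrow> lu X \<bullet> (lu' X \<bullet> x) = x"
  "arr x \<Longrightarrow> tgt x = unt \<odot> X \<Longrightarrow> lu' X \<bullet> (lu X \<bullet> x) = x"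
  "arr x \<Longrightarrow> tgt x = X \<Longrightarrow> ru X \<bullet> (ru' X \<bullet> x) = x"
  "arr x \<Longrightarrow> tgt x = X \<odot> unt \<Longrightarrow> ru' X \<bullet> (ru X \<bullet> x) = x"
  "arr x \<Longrightarrow> tgt x = X \<odot> Y \<Longrightarrow> sy Y X \<bullet> (sy X Y \<bullet> x) = x"
  by (simp_all flip: cmp_assoc)

lemma ten_idm_cmp:
  "arr f \<Longrightarrow> arr g \<Longrightarrow> src g = tgt f \<Longrightarrow> (idm X \<star> g) \<bullet> (idm X \<star> f) = idm X \<star> (g \<bullet> f)"
  "arr f \<Longrightarrow> arr g \<Longrightarrow> src g = tgt f \<Longrightarrow> (g \<star> idm X) \<bullet> (f \<star> idm X) = (g \<bullet> f) \<star> idm X"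
  by (simp_all add: ten_cmp)

lemma ten_idm_cmp_cmp:
  "arr f \<Longrightarrow> arr g \<Longrightarrow> src g = tgt f \<Longrightarrow> (idm X \<star> g) \<bullet> ((idm X \<star> f) \<bullet> x) = (idm X \<star> (g \<bullet> f)) \<bullet> x"
  "arr f \<Longrightarrow> arr g \<Longrightarrow> src g = tgt f \<Longrightarrow> (g \<star> idm X) \<bullet> ((f \<star> idm X) \<bullet> x) = ((g \<bullet> f) \<star> idm X) \<bullet> x"
  by (simp_all add: reassoc ten_idm_cmp)

lemma unt_ten_faithful:
  assumes "arr f" "arr g" "src f = src g" "tgt f = tgt g" "idm unt \<star> f = idm unt \<star> g"
  shows "f = g"
proof -
  have "f \<bullet> lu (src f) = g \<bullet> lu (src f)"
    using lu_natural[of f] lu_natural[of g] assms by simp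
  then have "(f \<bullet> lu (src f)) \<bullet> lu' (src f) = (g \<bullet> lu (src f)) \<bullet> lu' (src f)" by simp
  then show ?thesis using assms by (simp add: cmp_assoc)
qed

lemma ten_unt_faithful:
  assumes "arr f" "arr g" "src f = src g" "tgt f = tgt g" "f \<star> idm unt = g \<star> idm unt"
  shows "f = g"
proof -
  have "f \<bullet> ru (src f) = g \<bullet> ru (src f)"
    using ru_natural[of f] ru_natural[of g] assms by simp
  then have "(f \<bullet> ru (src f)) \<bullet> ru' (src f) = (g \<bullet> ru (src f)) \<bullet> ru' (src f)" by simp
  then show ?thesis using assms by (simp add: cmp_assoc)
qed

text \<open>The classical consequence of pentagon and triangle. Tensored with the unit on the left
  and composed with the isomorphism \<open>?p\<close>, both sides agree; then \<open>?p\<close> is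
  cancelled by \<open>?q\<close> and the unit by faithfulness.\<close>

lemma lu_tensor: "lu (X \<odot> Y) \<bullet> as unt X Y = lu X \<star> idm Y"
proof (rule unt_ten_faithful)
  let ?p = "as unt (unt \<odot> X) Y \<bullet> (as unt unt X \<star> idm Y)"
  let ?q = "(as' unt unt X \<star> idm Y) \<bullet> as' unt (unt \<odot> X) Y"
  have pq: "?p \<bullet> ?q = idm (unt \<odot> ((unt \<odot> X) \<odot> Y))"
    by (simp add: cmp_assoc ten_idm_cmp_cmp)
  have "(idm unt \<star> (lu (X \<odot> Y) \<bullet> as unt X Y)) \<bullet> ?p = (idm unt \<star> lu (X \<odot> Y)) \<bullet> as unt unt (X \<odot> Y) \<bullet> as (unt \<odot> unt) X Y"
    by (simp add: pentagon ten_idm_cmp_cmp)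
  also have "\<dots> = (ru unt \<star> idm (X \<odot> Y)) \<bullet> as (unt \<odot> unt) X Y"
    by (simp add: reassoc[OF triangle])
  also have "\<dots> = as unt X Y \<bullet> ((ru unt \<star> idm X) \<star> idm Y)"
    using as_natural[of "ru unt" "idm X" "idm Y"] by simp
  also have "\<dots> = as unt X Y \<bullet> ((idm unt \<star> lu X) \<star> idm Y) \<bullet> (as unt unt X \<star> idm Y)"
    by (simp add: ten_idm_cmp triangle)
  also have "\<dots> = (idm unt \<star> (lu X \<star> idm Y)) \<bullet> ?p"
    using reassoc2[OF as_natural[of "idm unt" "lu X" "idm Y"]] by simp
  finally have "((idm unt \<star> (lu (X \<odot> Y) \<bullet> as unt X Y)) \<bullet> ?p) \<bullet> ?q = ((idm unt \<star> (lu X \<star> idm Y)) \<bullet> ?p) \<bullet> ?q"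
    by simp
  then show "idm unt \<star> (lu (X \<odot> Y) \<bullet> as unt X Y) = idm unt \<star> (lu X \<star> idm Y)"
    by (subst (asm) (1 2) cmp_assoc) (simp only: pq, simp)
qed auto

lemma ru_tensor: "(idm X \<star> ru Y) \<bullet> as X Y unt = ru (X \<odot> Y)"
proof (rule ten_unt_faithful)
  have "as X Y unt \<bullet> (ru (X \<odot> Y) \<star> idm unt) = as X Y unt \<bullet> (idm (X \<odot> Y) \<star> lu unt) \<bullet> as (X \<odot> Y) unt unt"
    by (simp add: triangle)
  also have "\<dots> = (idm X \<star> (idm Y \<star> lu unt)) \<bullet> as X Y (unt \<odot> unt) \<bullet> as (X \<odot> Y) unt unt"
    using reassoc2[OF as_natural[of "idm X" "idm Y" "lu unt"]] by simp
  also have "\<dots> = (idm X \<star> (ru Y \<star> idm unt)) \<bullet> as X (Y \<odot> unt) unt \<bullet> (as X Y unt \<star> idm unt)"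
    by (simp add: pentagon ten_idm_cmp_cmp triangle)
  also have "\<dots> = as X Y unt \<bullet> (((idm X \<star> ru Y) \<bullet> as X Y unt) \<star> idm unt)"
    using reassoc2[OF as_natural[of "idm X" "ru Y" "idm unt", symmetric]] by (simp add: ten_idm_cmp)
  finally have "as' X Y unt \<bullet> as X Y unt \<bullet> (((idm X \<star> ru Y) \<bullet> as X Y unt) \<star> idm unt) =
      as' X Y unt \<bullet> as X Y unt \<bullet> (ru (X \<odot> Y) \<star> idm unt)" by simp
  then show "((idm X \<star> ru Y) \<bullet> as X Y unt) \<star> idm unt = ru (X \<odot> Y) \<star> idm unt"
    by simp
qed auto

text \<open>Naturality of \<open>lu\<close> at \<open>lu unt\<close> identifies
  \<open>lu (unt \<odot> unt)\<close> with \<open>idm unt \<star> lu unt\<close>. Comparing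
  \<open>lu_tensor\<close> with the triangle then gives the claim tensored with the unit.\<close>

lemma lu_unt: "lu unt = ru unt"
proof (rule ten_unt_faithful)
  have "lu' unt \<bullet> lu unt \<bullet> (idm unt \<star> lu unt) = lu' unt \<bullet> lu unt \<bullet> lu (unt \<odot> unt)"
    using lu_natural[of "lu unt"] by simp
  then have "lu (unt \<odot> unt) = idm unt \<star> lu unt" by simp
  then show "lu unt \<star> idm unt = ru unt \<star> idm unt"
    using lu_tensor[of unt unt] triangle[of unt unt] by simp
qed auto

primrec tnl :: "'o list \<Rightarrow> 'o" where
  "tnl [] = unt"
| "tnl (X # Xs) = X \<odot> tnl Xs"

primrec jn :: "'o list \<Rightarrow> 'o list \<Rightarrow> 'a" where
  "jn [] U = lu (tnl U)"
| "jn (X # Xs) U = (idm X \<star> jn Xs U) \<bullet> as X (tnl Xs) (tnl U)"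

primrec jn' :: "'o list \<Rightarrow> 'o list \<Rightarrow> 'a" where
  "jn' [] U = lu' (tnl U)"
| "jn' (X # Xs) U = as' X (tnl Xs) (tnl U) \<bullet> (idm X \<star> jn' Xs U)"

lemma jn_typ [simp]: "arr (jn Xs U)" "src (jn Xs U) = tnl Xs \<odot> tnl U" "tgt (jn Xs U) = tnl (Xs @ U)"
  by (induction Xs) auto

lemma jn'_typ [simp]: "arr (jn' Xs U)" "tgt (jn' Xs U) = tnl Xs \<odot> tnl U" "src (jn' Xs U) = tnl (Xs @ U)"
  by (induction Xs) auto

lemma jn_jn' [simp]: "jn Xs U \<bullet> jn' Xs U = idm (tnl (Xs @ U))" "jn' Xs U \<bullet> jn Xs U = idm (tnl Xs \<odot> tnl U)"
  by (induction Xs) (auto simp: cmp_assoc ten_idm_cmp ten_idm_cmp_cmp)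

lemma jn_jn'_cmp [simp]:
  "arr x \<Longrightarrow> tgt x = tnl (Xs @ U) \<Longrightarrow> jn Xs U \<bullet> (jn' Xs U \<bullet> x) = x"
  "arr x \<Longrightarrow> tgt x = tnl Xs \<odot> tnl U \<Longrightarrow> jn' Xs U \<bullet> (jn Xs U \<bullet> x) = x"
  by (simp_all flip: cmp_assoc)

text \<open>The coherence that makes concatenation of words a strictly associative model of the
  tensor product: \<open>lu_tensor\<close> at the empty word, the pentagon in the induction
  step.\<close>

lemma jn_assoc:
  "jn (Xs @ U) W \<bullet> (jn Xs U \<star> idm (tnl W)) =
    jn Xs (U @ W) \<bullet> (idm (tnl Xs) \<star> jn U W) \<bullet> as (tnl Xs) (tnl U) (tnl W)"
proof (induction Xs)
  case Nil
  have "lu (tnl (U @ W)) \<bullet> (idm unt \<star> jn U W) = jn U W \<bullet> lu (tnl U \<odot> tnl W)"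
    using lu_natural[of "jn U W"] by simp
  from reassoc2[OF this] show ?case by (simp add: lu_tensor)
next
  case (Cons X Xs)
  let ?U = "tnl U" and ?W = "tnl W" and ?X = "tnl Xs"
  have n1: "as X (tnl (Xs @ U)) ?W \<bullet> ((idm X \<star> jn Xs U) \<star> idm ?W) = (idm X \<star> (jn Xs U \<star> idm ?W)) \<bullet> as X (?X \<odot> ?U) ?W"
    using as_natural[of "idm X" "jn Xs U" "idm ?W"] by simp
  have n2: "as X ?X (tnl (U @ W)) \<bullet> ((idm X \<star> idm ?X) \<star> jn U W) = (idm X \<star> (idm ?X \<star> jn U W)) \<bullet> as X ?X (?U \<odot> ?W)"
    using as_natural[of "idm X" "idm ?X" "jn U W"] by simp
  have "jn ((X # Xs) @ U) W \<bullet> (jn (X # Xs) U \<star> idm ?W) =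
     (idm X \<star> jn (Xs @ U) W) \<bullet> as X (tnl (Xs @ U)) ?W \<bullet> ((idm X \<star> jn Xs U) \<star> idm ?W) \<bullet> (as X ?X ?U \<star> idm ?W)"
    by (simp add: cmp_assoc ten_idm_cmp)
  also have "\<dots> = (idm X \<star> (jn (Xs @ U) W \<bullet> (jn Xs U \<star> idm ?W))) \<bullet> as X (?X \<odot> ?U) ?W \<bullet> (as X ?X ?U \<star> idm ?W)"
    by (simp add: reassoc2[OF n1] ten_idm_cmp_cmp)
  also have "\<dots> = (idm X \<star> jn Xs (U @ W)) \<bullet> (idm X \<star> (idm ?X \<star> jn U W)) \<bullet>
      (idm X \<star> as ?X ?U ?W) \<bullet> as X (?X \<odot> ?U) ?W \<bullet> (as X ?X ?U \<star> idm ?W)"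
    unfolding Cons.IH by (simp add: ten_idm_cmp_cmp)
  also have "\<dots> = (idm X \<star> jn Xs (U @ W)) \<bullet> (idm X \<star> (idm ?X \<star> jn U W)) \<bullet> as X ?X (?U \<odot> ?W) \<bullet> as (X \<odot> ?X) ?U ?W"
    by (simp add: pentagon)
  also have "\<dots> = (idm X \<star> jn Xs (U @ W)) \<bullet> as X ?X (tnl (U @ W)) \<bullet> ((idm X \<star> idm ?X) \<star> jn U W) \<bullet> as (X \<odot> ?X) ?U ?W"
    by (simp only: reassoc2[OF n2])
  finally show ?case by (simp add: cmp_assoc)
qed

lemma jn_Nil: "jn Xs [] = ru (tnl Xs)"
  by (induction Xs) (auto simp: lu_unt ru_tensor)

lemma jn'_assoc:
  "(jn' Xs U \<star> idm (tnl W)) \<bullet> jn' (Xs @ U) W =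
    as' (tnl Xs) (tnl U) (tnl W) \<bullet> (idm (tnl Xs) \<star> jn' U W) \<bullet> jn' Xs (U @ W)"
proof -
  let ?a = "jn (Xs @ U) W \<bullet> (jn Xs U \<star> idm (tnl W))"
  let ?b = "as' (tnl Xs) (tnl U) (tnl W) \<bullet> (idm (tnl Xs) \<star> jn' U W) \<bullet> jn' Xs (U @ W)"
  let ?c = "(jn' Xs U \<star> idm (tnl W)) \<bullet> jn' (Xs @ U) W"
  have 1: "?a \<bullet> ?b = idm (tnl (Xs @ U @ W))"
    unfolding jn_assoc by (simp add: cmp_assoc ten_idm_cmp_cmp)
  have 2: "?c \<bullet> ?a = idm ((tnl Xs \<odot> tnl U) \<odot> tnl W)"
    by (simp add: cmp_assoc ten_idm_cmp)
  have "?c \<bullet> (?a \<bullet> ?b) = (?c \<bullet> ?a) \<bullet> ?b" by (simp only: cmp_assoc)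
  then show ?thesis unfolding 1 2 by simp
qed

text \<open>Words are nested to the right, so whiskering on the left involves no constraints.
  Whiskering on the right, \<open>rwm\<close>, has to be conjugated by \<open>jn\<close>.\<close>

primrec lwm :: "'o list \<Rightarrow> 'a \<Rightarrow> 'a" where
  "lwm [] f = f"
| "lwm (X # U) f = idm X \<star> lwm U f"

lemma lwm_typ [simp]:
  "arr f \<Longrightarrow> src f = tnl Xs \<Longrightarrow> arr (lwm U f)"
  "arr f \<Longrightarrow> src f = tnl Xs \<Longrightarrow> src (lwm U f) = tnl (U @ Xs)"
  "arr f \<Longrightarrow> tgt f = tnl Ys \<Longrightarrow> tgt (lwm U f) = tnl (U @ Ys)"
proof -
  show 1: "arr (lwm U f)" if "arr f" for U using that by (induction U) auto
  show "src (lwm U f) = tnl (U @ Xs)" if "arr f" "src f = tnl Xs" using that 1 by (induction U) auto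
  show "tgt (lwm U f) = tnl (U @ Ys)" if "arr f" "tgt f = tnl Ys" using that 1 by (induction U) auto
qed

lemma lwm_append: "lwm (U @ U') f = lwm U (lwm U' f)"
  by (induction U) auto

definition rwm :: "'o list \<Rightarrow> 'a \<Rightarrow> 'o list \<Rightarrow> 'o list \<Rightarrow> 'a" where
  "rwm Xs f Ys W = jn Ys W \<bullet> (f \<star> idm (tnl W)) \<bullet> jn' Xs W"

context
  fixes f Xs Ys
  assumes f [simp]: "arr f" "src f = tnl Xs" "tgt f = tnl Ys"
begin

lemma rwm_typ [simp]: "arr (rwm Xs f Ys W)" "src (rwm Xs f Ys W) = tnl (Xs @ W)" "tgt (rwm Xs f Ys W) = tnl (Ys @ W)"
  by (auto simp: rwm_def)

lemma rwm_Nil: "rwm Xs f Ys [] = f"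
proof -
  have n: "jn Ys [] \<bullet> (f \<star> idm unt) = f \<bullet> jn Xs []"
    using ru_natural[of f] by (simp add: jn_Nil)
  show ?thesis by (simp add: rwm_def reassoc2[OF n])
qed

lemma rwm_rwm: "rwm (Xs @ U) (rwm Xs f Ys U) (Ys @ U) W = rwm Xs f Ys (U @ W)"
proof -
  let ?U = "tnl U" and ?W = "tnl W" and ?X = "tnl Xs" and ?Y = "tnl Ys"
  have n: "as ?Y ?U ?W \<bullet> ((f \<star> idm ?U) \<star> idm ?W) = (f \<star> idm (?U \<odot> ?W)) \<bullet> as ?X ?U ?W"
    using as_natural[of f "idm ?U" "idm ?W"] by simp
  have "rwm (Xs @ U) (rwm Xs f Ys U) (Ys @ U) W =
    (jn (Ys @ U) W \<bullet> (jn Ys U \<star> idm ?W)) \<bullet> ((f \<star> idm ?U) \<star> idm ?W) \<bullet> ((jn' Xs U \<star> idm ?W) \<bullet> jn' (Xs @ U) W)"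
    by (simp add: rwm_def cmp_assoc ten_idm_cmp_cmp)
  also have "\<dots> = jn Ys (U @ W) \<bullet> (idm ?Y \<star> jn U W) \<bullet> (f \<star> idm (?U \<odot> ?W)) \<bullet> (idm ?X \<star> jn' U W) \<bullet> jn' Xs (U @ W)"
    unfolding jn_assoc jn'_assoc by (simp add: cmp_assoc reassoc2[OF n])
  also have "(idm ?Y \<star> jn U W) \<bullet> (f \<star> idm (?U \<odot> ?W)) \<bullet> (idm ?X \<star> jn' U W) \<bullet> jn' Xs (U @ W) =
      (f \<star> idm (tnl (U @ W))) \<bullet> jn' Xs (U @ W)"
    by (simp add: ten_cmp reassoc[OF ten_cmp])
  finally show ?thesis by (simp add: rwm_def)
qed

lemma rwm_lwm: "rwm (U @ Xs) (lwm U f) (U @ Ys) W = lwm U (rwm Xs f Ys W)"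
proof (induction U)
  case (Cons X U)
  let ?W = "tnl W"
  have n: "as X (tnl (U @ Ys)) ?W \<bullet> ((idm X \<star> lwm U f) \<star> idm ?W) = (idm X \<star> (lwm U f \<star> idm ?W)) \<bullet> as X (tnl (U @ Xs)) ?W"
    using as_natural[of "idm X" "lwm U f" "idm ?W"] by simp
  have "rwm ((X # U) @ Xs) (lwm (X # U) f) ((X # U) @ Ys) W =
     idm X \<star> (jn (U @ Ys) W \<bullet> (lwm U f \<star> idm ?W) \<bullet> jn' (U @ Xs) W)"
    by (simp add: rwm_def cmp_assoc reassoc2[OF n] ten_idm_cmp)
  then show ?case using Cons by (simp add: rwm_def)
qed simp

lemma lwm_eq: "lwm U f = jn U Ys \<bullet> (idm (tnl U) \<star> f) \<bullet> jn' U Xs"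
proof (induction U)
  case Nil
  then show ?case using reassoc2[OF lu_natural[of f]] by simp
next
  case (Cons X U)
  have n: "as X (tnl U) (tnl Ys) \<bullet> (idm (X \<odot> tnl U) \<star> f) = (idm X \<star> (idm (tnl U) \<star> f)) \<bullet> as X (tnl U) (tnl Xs)"
    using as_natural[of "idm X" "idm (tnl U)" f] by simp
  show ?case by (simp add: Cons cmp_assoc reassoc2[OF n] ten_idm_cmp)
qed

end

lemma lwm_idm: "lwm U (idm (tnl Xs)) = idm (tnl (U @ Xs))"
  by (induction U) auto

lemma rwm_idm: "rwm Xs (idm (tnl Xs)) Xs W = idm (tnl (Xs @ W))"
  by (simp add: rwm_def)

lemma lwm_cmp: "arr f \<Longrightarrow> arr g \<Longrightarrow> src g = tgt f \<Longrightarrow> lwm U (g \<bullet> f) = lwm U g \<bullet> lwm U f"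
proof (induction U)
  case (Cons X U)
  have t: "arr (lwm U f)" "tgt (lwm U f) = foldr tno U (tgt f)" "src (lwm U f) = foldr tno U (src f)" if "arr f" for f
    using that by (induction U) auto
  show ?case using Cons t by (simp add: ten_idm_cmp)
qed simp

lemma rwm_cmp:
  "arr f \<Longrightarrow> arr g \<Longrightarrow> src g = tnl Ys \<Longrightarrow> tgt f = tnl Ys \<Longrightarrow> src f = tnl Xs \<Longrightarrow> tgt g = tnl Zs \<Longrightarrow>
    rwm Xs (g \<bullet> f) Zs W = rwm Ys g Zs W \<bullet> rwm Xs f Ys W"
  by (simp add: rwm_def cmp_assoc ten_idm_cmp_cmp)

lemma interchange_m:
  assumes [simp]: "arr f" "src f = tnl Xs" "tgt f = tnl Ys" "arr g" "src g = tnl Us" "tgt g = tnl Vs"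
  shows "rwm Xs f Ys Vs \<bullet> lwm Xs g = lwm Ys g \<bullet> rwm Xs f Ys Us"
  by (simp add: rwm_def lwm_eq[of g Us Vs] cmp_assoc ten_cmp reassoc[OF ten_cmp])

definition sym_m :: "'o list \<Rightarrow> 'o list \<Rightarrow> 'a" where
  "sym_m Xs Ys = jn Ys Xs \<bullet> sy (tnl Xs) (tnl Ys) \<bullet> jn' Xs Ys"

lemma sym_m_typ [simp]: "arr (sym_m Xs Ys)" "src (sym_m Xs Ys) = tnl (Xs @ Ys)" "tgt (sym_m Xs Ys) = tnl (Ys @ Xs)"
  by (auto simp: sym_m_def)

lemma sym_m_sym_m: "sym_m Ys Xs \<bullet> sym_m Xs Ys = idm (tnl (Xs @ Ys))"
  by (simp add: sym_m_def cmp_assoc)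

lemma sym_m_natural:
  assumes [simp]: "arr f" "src f = tnl Xs" "tgt f = tnl Ys"
  shows "sym_m Ys Z \<bullet> rwm Xs f Ys Z = lwm Z f \<bullet> sym_m Xs Z"
  using reassoc2[OF sy_natural[of f "idm (tnl Z)"]]
  by (simp add: sym_m_def rwm_def lwm_eq[of f Xs Ys] cmp_assoc)

lemma hexagon_m: "sym_m X (Y @ Z) = lwm Y (sym_m X Z) \<bullet> rwm (X @ Y) (sym_m X Y) (Y @ X) Z"
proof -
  let ?X = "tnl X" and ?Y = "tnl Y" and ?Z = "tnl Z"
  have 1: "jn' Y (X @ Z) \<bullet> (jn (Y @ X) Z \<bullet> (jn Y X \<star> idm ?Z)) = (idm ?Y \<star> jn X Z) \<bullet> as ?Y ?X ?Z"
    unfolding jn_assoc by simp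
  have 2: "(idm ?Y \<star> jn' X Z) \<bullet> (idm ?Y \<star> jn X Z) = idm (?Y \<odot> (?X \<odot> ?Z))"
    by (simp add: ten_idm_cmp)
  have h: "(idm ?Y \<star> sy ?X ?Z) \<bullet> as ?Y ?X ?Z \<bullet> (sy ?X ?Y \<star> idm ?Z) \<bullet> as' ?X ?Y ?Z \<bullet> x = as ?Y ?Z ?X \<bullet> sy ?X (?Y \<odot> ?Z) \<bullet> x"
    if "arr x" "tgt x = ?X \<odot> (?Y \<odot> ?Z)" for x
  proof -
    have "((idm ?Y \<star> sy ?X ?Z) \<bullet> as ?Y ?X ?Z \<bullet> (sy ?X ?Y \<star> idm ?Z)) \<bullet> as' ?X ?Y ?Z \<bullet> x = as ?Y ?Z ?X \<bullet> sy ?X (?Y \<odot> ?Z) \<bullet> x"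
      unfolding hexagon[symmetric] using that by (simp add: cmp_assoc)
    then show ?thesis by (simp only: cmp_assoc)
  qed
  have n: "sy ?X (tnl (Y @ Z)) \<bullet> (idm ?X \<star> jn Y Z) = (jn Y Z \<star> idm ?X) \<bullet> sy ?X (?Y \<odot> ?Z)"
    using sy_natural[of "idm ?X" "jn Y Z"] by simp
  have "lwm Y (sym_m X Z) \<bullet> rwm (X @ Y) (sym_m X Y) (Y @ X) Z =
     jn Y (Z @ X) \<bullet> (idm ?Y \<star> jn Z X) \<bullet> (idm ?Y \<star> sy ?X ?Z) \<bullet> (idm ?Y \<star> jn' X Z) \<bullet>
     (jn' Y (X @ Z) \<bullet> (jn (Y @ X) Z \<bullet> (jn Y X \<star> idm ?Z))) \<bullet> (sy ?X ?Y \<star> idm ?Z) \<bullet>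
     ((jn' X Y \<star> idm ?Z) \<bullet> jn' (X @ Y) Z)"
    by (simp add: lwm_eq[of _ "X @ Z" "Z @ X"] rwm_def sym_m_def cmp_assoc ten_idm_cmp_cmp)
  also have "\<dots> = jn Y (Z @ X) \<bullet> (idm ?Y \<star> jn Z X) \<bullet> as ?Y ?Z ?X \<bullet> sy ?X (?Y \<odot> ?Z) \<bullet>
     (idm ?X \<star> jn' Y Z) \<bullet> jn' X (Y @ Z)"
    unfolding 1 jn'_assoc by (simp add: cmp_assoc reassoc[OF 2] h)
  also have "\<dots> = (jn (Y @ Z) X \<bullet> (jn Y Z \<star> idm ?X)) \<bullet> sy ?X (?Y \<odot> ?Z) \<bullet>
     (idm ?X \<star> jn' Y Z) \<bullet> jn' X (Y @ Z)"
    unfolding jn_assoc by (simp add: cmp_assoc)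
  also have "\<dots> = jn (Y @ Z) X \<bullet> sy ?X (tnl (Y @ Z)) \<bullet> jn' X (Y @ Z)"
    by (simp add: cmp_assoc reassoc2[OF n[symmetric]] ten_idm_cmp_cmp)
  finally show ?thesis by (simp add: sym_m_def)
qed

end

locale linear_monoidal_arrows = monoidal_arrows +
  assumes pls_typ [simp]: "arr f \<Longrightarrow> arr g \<Longrightarrow> src f = src g \<Longrightarrow> tgt f = tgt g \<Longrightarrow> arr (pls f g)"
      "arr f \<Longrightarrow> arr g \<Longrightarrow> src f = src g \<Longrightarrow> tgt f = tgt g \<Longrightarrow> src (pls f g) = src f"
      "arr f \<Longrightarrow> arr g \<Longrightarrow> src f = src g \<Longrightarrow> tgt f = tgt g \<Longrightarrow> tgt (pls f g) = tgt f"
    and scl_typ [simp]: "arr f \<Longrightarrow> arr (scl q f)" "arr f \<Longrightarrow> src (scl q f) = src f" "arr f \<Longrightarrow> tgt (scl q f) = tgt f"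
    and pls_commute: "arr f \<Longrightarrow> arr g \<Longrightarrow> src f = src g \<Longrightarrow> tgt f = tgt g \<Longrightarrow> pls f g = pls g f"
    and pls_assoc: "arr f \<Longrightarrow> arr g \<Longrightarrow> arr h \<Longrightarrow> src f = src g \<Longrightarrow> tgt f = tgt g \<Longrightarrow>
      src g = src h \<Longrightarrow> tgt g = tgt h \<Longrightarrow> pls (pls f g) h = pls f (pls g h)"
    and scl_add: "arr f \<Longrightarrow> scl (a + b) f = pls (scl a f) (scl b f)"
    and scl_scl: "arr f \<Longrightarrow> scl a (scl b f) = scl (a * b) f"
    and pls_scl_0: "arr f \<Longrightarrow> arr g \<Longrightarrow> src f = src g \<Longrightarrow> tgt f = tgt g \<Longrightarrow> pls f (scl 0 g) = f"
    and scl_1: "arr f \<Longrightarrow> scl 1 f = f"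
    and scl_pls: "arr f \<Longrightarrow> arr g \<Longrightarrow> src f = src g \<Longrightarrow> tgt f = tgt g \<Longrightarrow>
      scl a (pls f g) = pls (scl a f) (scl a g)"
    and cmp_pls: "arr f \<Longrightarrow> arr g \<Longrightarrow> src f = src g \<Longrightarrow> tgt f = tgt g \<Longrightarrow> arr h \<Longrightarrow> src h = tgt f \<Longrightarrow>
      h \<bullet> (pls f g) = pls (h \<bullet> f) (h \<bullet> g)"
    and pls_cmp: "arr f \<Longrightarrow> arr g \<Longrightarrow> src f = src g \<Longrightarrow> tgt f = tgt g \<Longrightarrow> arr h \<Longrightarrow> tgt h = src f \<Longrightarrow>
      (pls f g) \<bullet> h = pls (f \<bullet> h) (g \<bullet> h)"
    and cmp_scl: "arr f \<Longrightarrow> arr h \<Longrightarrow> src h = tgt f \<Longrightarrow> h \<bullet> scl a f = scl a (h \<bullet> f)"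
    and scl_cmp: "arr f \<Longrightarrow> arr h \<Longrightarrow> src h = tgt f \<Longrightarrow> scl a h \<bullet> f = scl a (h \<bullet> f)"
    and ten_pls: "arr f \<Longrightarrow> arr g \<Longrightarrow> src f = src g \<Longrightarrow> tgt f = tgt g \<Longrightarrow> arr h \<Longrightarrow>
      h \<star> (pls f g) = pls (h \<star> f) (h \<star> g)"
    and pls_ten: "arr f \<Longrightarrow> arr g \<Longrightarrow> src f = src g \<Longrightarrow> tgt f = tgt g \<Longrightarrow> arr h \<Longrightarrow>
      (pls f g) \<star> h = pls (f \<star> h) (g \<star> h)"
    and ten_scl: "arr f \<Longrightarrow> arr h \<Longrightarrow> h \<star> scl a f = scl a (h \<star> f)"
    and scl_ten: "arr f \<Longrightarrow> arr h \<Longrightarrow> scl a f \<star> h = scl a (f \<star> h)"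
begin

lemma lwm_pls:
  assumes "arr f" "arr g" "src f = tnl Xs" "src g = tnl Xs" "tgt f = tnl Ys" "tgt g = tnl Ys"
  shows "lwm U (pls f g) = pls (lwm U f) (lwm U g)"
  using assms
proof (induction U)
  case (Cons X U)
  then show ?case using lwm_typ[of f Xs U] lwm_typ[of g Xs U] lwm_typ(3)[of f Ys U] lwm_typ(3)[of g Ys U]
    by (simp add: ten_pls)
qed simp

lemma lwm_scl:
  assumes "arr f" "src f = tnl Xs"
  shows "lwm U (scl a f) = scl a (lwm U f)"
  using assms
proof (induction U)
  case (Cons X U)
  then show ?case using lwm_typ[of f Xs U] by (simp add: ten_scl)
qed simp

lemma rwm_pls:
  assumes "arr f" "arr g" "src f = tnl Xs" "src g = tnl Xs" "tgt f = tnl Ys" "tgt g = tnl Ys"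
  shows "rwm Xs (pls f g) Ys W = pls (rwm Xs f Ys W) (rwm Xs g Ys W)"
  using assms by (simp add: rwm_def pls_ten cmp_pls pls_cmp)

lemma rwm_scl:
  assumes "arr f" "src f = tnl Xs" "tgt f = tnl Ys"
  shows "rwm Xs (scl a f) Ys W = scl a (rwm Xs f Ys W)"
  using assms by (simp add: rwm_def scl_ten cmp_scl scl_cmp)

text \<open>A strict arrow carries its two words, since \<open>tnl\<close> need not be injective and
  the underlying arrow does not determine them.\<close>

fun sarr :: "'b list \<times> 'a \<times> 'b list \<Rightarrow> bool" where
  "sarr (Xs, f, Ys) \<longleftrightarrow> arr f \<and> src f = tnl Xs \<and> tgt f = tnl Ys"

definition ssrc :: "'b list \<times> 'a \<times> 'b list \<Rightarrow> 'b list" where "ssrc t = fst t"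
definition smor :: "'b list \<times> 'a \<times> 'b list \<Rightarrow> 'a" where "smor t = fst (snd t)"
definition stgt :: "'b list \<times> 'a \<times> 'b list \<Rightarrow> 'b list" where "stgt t = snd (snd t)"
definition snull :: "'b list \<times> 'a \<times> 'b list" where "snull = ([], null, [])"
definition sidm :: "'b list \<Rightarrow> 'b list \<times> 'a \<times> 'b list" where "sidm Xs = (Xs, idm (tnl Xs), Xs)"
definition scmp :: "'b list \<times> 'a \<times> 'b list \<Rightarrow> 'b list \<times> 'a \<times> 'b list \<Rightarrow> 'b list \<times> 'a \<times> 'b list" where
  "scmp t u = (if sarr t \<and> sarr u \<and> ssrc t = stgt u then (ssrc u, smor t \<bullet> smor u, stgt t) else snull)"
definition swh :: "'b list \<Rightarrow> 'b list \<times> 'a \<times> 'b list \<Rightarrow> 'b list \<Rightarrow> 'b list \<times> 'a \<times> 'b list" where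
  "swh U t W = (if sarr t then (U @ ssrc t @ W, lwm U (rwm (ssrc t) (smor t) (stgt t) W), U @ stgt t @ W)
     else snull)"
definition ssym :: "'b list \<Rightarrow> 'b list \<Rightarrow> 'b list \<times> 'a \<times> 'b list" where
  "ssym Xs Ys = (Xs @ Ys, sym_m Xs Ys, Ys @ Xs)"
definition spls where "spls t u = (ssrc t, pls (smor t) (smor u), stgt t)"
definition sscl where "sscl a t = (ssrc t, scl a (smor t), stgt t)"

lemma sarr_iff: "sarr t \<longleftrightarrow> arr (smor t) \<and> src (smor t) = tnl (ssrc t) \<and> tgt (smor t) = tnl (stgt t)"
  by (cases t) (auto simp: ssrc_def smor_def stgt_def)

lemma sarr_eqI: "ssrc t = ssrc u \<Longrightarrow> stgt t = stgt u \<Longrightarrow> smor t = smor u \<Longrightarrow> t = u"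
  by (cases t; cases u) (auto simp: ssrc_def smor_def stgt_def)

lemma proj_simps [simp]:
  "ssrc (Xs, f, Ys) = Xs" "smor (Xs, f, Ys) = f" "stgt (Xs, f, Ys) = Ys"
  by (auto simp: ssrc_def smor_def stgt_def)

lemma snull [simp]: "\<not> sarr snull" by (simp add: snull_def)

lemma sarr_cases:
  obtains "\<not> sarr t" | Xs f Ys where "t = (Xs, f, Ys)" "arr f" "src f = tnl Xs" "tgt f = tnl Ys"
  by (cases t) auto

lemma strict_smc: "strict_smc sarr ssrc stgt sidm scmp swh ssym spls sscl"
proof unfold_locales
  show "sarr (sidm X)" "ssrc (sidm X) = X" "stgt (sidm X) = X" for X by (auto simp: sidm_def)
  show "sarr (scmp g f) \<longleftrightarrow> sarr g \<and> sarr f \<and> ssrc g = stgt f" for g f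
    by (auto simp: scmp_def) (auto simp: sarr_iff)
  show "ssrc (scmp g f) = ssrc f" "stgt (scmp g f) = stgt g" if "sarr g" "sarr f" "ssrc g = stgt f" for g f
    using that by (auto simp: scmp_def)
  show "scmp (scmp h g) f = scmp h (scmp g f)" for h g f
    by (auto simp: scmp_def cmp_assoc) (auto simp: sarr_iff)
  show "scmp f (sidm X) = f" if "sarr f" "ssrc f = X" for f X
    using that by (intro sarr_eqI) (auto simp: scmp_def sidm_def sarr_iff)
  show "scmp (sidm X) f = f" if "sarr f" "stgt f = X" for f X
    using that by (intro sarr_eqI) (auto simp: scmp_def sidm_def sarr_iff)
  show "sarr (swh U f U') \<longleftrightarrow> sarr f" for U f U'
    by (cases f rule: sarr_cases) (auto simp: swh_def)
  show "ssrc (swh U f U') = U @ ssrc f @ U'" "stgt (swh U f U') = U @ stgt f @ U'" if "sarr f" for U f U'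
    using that by (auto simp: swh_def)
  show "swh U (scmp g f) U' = scmp (swh U g U') (swh U f U')" for U g f U'
  proof (cases g rule: sarr_cases; cases f rule: sarr_cases)
    fix Xs a Ys Xs' b Ys'
    assume *: "g = (Xs, a, Ys)" "arr a" "src a = tnl Xs" "tgt a = tnl Ys"
      "f = (Xs', b, Ys')" "arr b" "src b = tnl Xs'" "tgt b = tnl Ys'"
    show "swh U (scmp g f) U' = scmp (swh U g U') (swh U f U')"
      using * rwm_typ[of a Xs Ys U'] rwm_typ[of b Xs' Ys' U']
      by (auto simp: swh_def scmp_def rwm_cmp[of b a Xs] lwm_cmp)
  qed (auto simp: swh_def scmp_def)
  show "swh U (sidm X) U' = sidm (U @ X @ U')" for U X U'
    by (simp add: swh_def sidm_def rwm_idm lwm_idm)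
  show "swh U (swh X f Y) U' = swh (U @ X) f (Y @ U')" for U X f Y U'
  proof (cases f rule: sarr_cases)
    fix Xs a Ys assume *: "f = (Xs, a, Ys)" "arr a" "src a = tnl Xs" "tgt a = tnl Ys"
    then show ?thesis
      using rwm_lwm[of "rwm Xs a Ys Y" "Xs @ Y" "Ys @ Y" X U'] lwm_append[of U X "rwm Xs a Ys (Y @ U')"]
        rwm_rwm[of a Xs Ys Y U']
      by (simp add: swh_def)
  qed (simp add: swh_def)
  show "swh [] f [] = f" if "sarr f" for f
    using that by (cases f rule: sarr_cases) (auto simp: swh_def rwm_Nil)
  show "scmp (swh [] f (stgt g)) (swh (ssrc f) g []) = scmp (swh (stgt f) g []) (swh [] f (ssrc g))"
    if "sarr f" "sarr g" for f g
    using that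
    by (cases f rule: sarr_cases; cases g rule: sarr_cases)
      (auto simp: swh_def scmp_def rwm_Nil interchange_m)
  show "sarr (ssym X Y)" "ssrc (ssym X Y) = X @ Y" "stgt (ssym X Y) = Y @ X" for X Y
    by (auto simp: ssym_def)
  show "scmp (ssym (stgt f) Z) (swh [] f Z) = scmp (swh Z f []) (ssym (ssrc f) Z)" if "sarr f" for f Z
    using that by (cases f rule: sarr_cases) (auto simp: swh_def scmp_def ssym_def rwm_Nil sym_m_natural)
  show "scmp (ssym Y X) (ssym X Y) = sidm (X @ Y)" for X Y
    by (simp add: scmp_def ssym_def sidm_def sym_m_sym_m)
  show "ssym X (Y @ Z) = scmp (swh Y (ssym X Z) []) (swh [] (ssym X Y) Z)" for X Y Z
    by (simp add: scmp_def ssym_def swh_def rwm_Nil hexagon_m)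
  show "sarr (spls f g)" "ssrc (spls f g) = ssrc f" "stgt (spls f g) = stgt f"
    if "sarr f" "sarr g" "ssrc f = ssrc g" "stgt f = stgt g" for f g
    using that by (auto simp: spls_def sarr_iff)
  show "sarr (sscl q f)" "ssrc (sscl q f) = ssrc f" "stgt (sscl q f) = stgt f" if "sarr f" for q f
    using that by (auto simp: sscl_def sarr_iff)
  show "spls f g = spls g f" if "sarr f" "sarr g" "ssrc f = ssrc g" "stgt f = stgt g" for f g
    using that pls_commute[of "smor f" "smor g"] by (auto simp: spls_def sarr_iff)
  show "spls (spls f g) h = spls f (spls g h)"
    if "sarr f" "sarr g" "sarr h" "ssrc f = ssrc g" "stgt f = stgt g" "ssrc g = ssrc h" "stgt g = stgt h" for f g h
    using that by (auto simp: spls_def sarr_iff pls_assoc)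
  show "sscl (a + b) f = spls (sscl a f) (sscl b f)" if "sarr f" for a b f
    using that by (auto simp: spls_def sscl_def sarr_iff scl_add)
  show "sscl a (sscl b f) = sscl (a * b) f" if "sarr f" for a b f
    using that by (auto simp: sscl_def sarr_iff scl_scl)
  show "spls f (sscl 0 g) = f" if "sarr f" "sarr g" "ssrc f = ssrc g" "stgt f = stgt g" for f g
    using that by (intro sarr_eqI) (auto simp: spls_def sscl_def sarr_iff pls_scl_0)
  show "sscl 1 f = f" if "sarr f" for f
    using that by (intro sarr_eqI) (auto simp: sscl_def sarr_iff scl_1)
  show "sscl a (spls f g) = spls (sscl a f) (sscl a g)"
    if "sarr f" "sarr g" "ssrc f = ssrc g" "stgt f = stgt g" for a f g
    using that by (auto simp: spls_def sscl_def sarr_iff scl_pls)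
  show "scmp h (spls f g) = spls (scmp h f) (scmp h g)"
    if "sarr f" "sarr g" "ssrc f = ssrc g" "stgt f = stgt g" "sarr h" "ssrc h = stgt f" for f g h
    using that by (auto simp: scmp_def spls_def sarr_iff cmp_pls)
  show "scmp (spls f g) h = spls (scmp f h) (scmp g h)"
    if "sarr f" "sarr g" "ssrc f = ssrc g" "stgt f = stgt g" "sarr h" "stgt h = ssrc f" for f g h
    using that by (auto simp: scmp_def spls_def sarr_iff pls_cmp)
  show "scmp h (sscl a f) = sscl a (scmp h f)" if "sarr f" "sarr h" "ssrc h = stgt f" for a f h
    using that by (auto simp: scmp_def sscl_def sarr_iff cmp_scl)
  show "scmp (sscl a h) f = sscl a (scmp h f)" if "sarr f" "sarr h" "ssrc h = stgt f" for a f h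
    using that by (auto simp: scmp_def sscl_def sarr_iff scl_cmp)
  show "swh U (spls f g) U' = spls (swh U f U') (swh U g U')"
    if "sarr f" "sarr g" "ssrc f = ssrc g" "stgt f = stgt g" for U f g U'
    using that rwm_typ[of "smor f" "ssrc f" "stgt f" U'] rwm_typ[of "smor g" "ssrc g" "stgt g" U']
    by (auto simp: swh_def spls_def sarr_iff rwm_pls lwm_pls[of _ _ "ssrc g @ U'" "stgt g @ U'"])
  show "swh U (sscl a f) U' = sscl a (swh U f U')" if "sarr f" for U a f U'
    using that rwm_typ[of "smor f" "ssrc f" "stgt f" U']
    by (auto simp: swh_def sscl_def sarr_iff rwm_scl lwm_scl[of _ "ssrc f @ U'"])
qed

end

section \<open>The given tensor category as a category with total operations\<close>

lemma hom_module_simps [simp]: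
  "carrier (hom_module C X Y) = Hom C X Y" "zero (hom_module C X Y) = Zero C X Y"
  "add (hom_module C X Y) = Add C" "smult (hom_module C X Y) = Scale C"
  by (auto simp: hom_module_def)

lemma rat_ring_simps [simp]:
  "carrier rat_ring = UNIV" "zero rat_ring = 0" "one rat_ring = 1"
  "add rat_ring = (+)" "monoid.mult rat_ring = (*)"
  by (auto simp: rat_ring_def)

locale rat_tensor_category = rigid_tensor_category + pseudo_abelian_category + rat_linear_category
begin

lemma Zero_in: "Zero C X Y \<in> Hom C X Y"
  using abelian_group.axioms(1)[OF Hom_abelian_group, THEN abelian_monoid.zero_closed, of X Y] by simp

lemma Add_in: "f \<in> Hom C X Y \<Longrightarrow> g \<in> Hom C X Y \<Longrightarrow> f \<^bold>+ g \<in> Hom C X Y"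
  using abelian_monoid.a_closed[OF abelian_group.axioms(1)[OF Hom_abelian_group], of f X Y g] by simp

lemma Add_commute: "f \<in> Hom C X Y \<Longrightarrow> g \<in> Hom C X Y \<Longrightarrow> f \<^bold>+ g = g \<^bold>+ f"
  using abelian_monoid.a_comm[OF abelian_group.axioms(1)[OF Hom_abelian_group], of f X Y g] by simp

lemma Add_assoc: "f \<in> Hom C X Y \<Longrightarrow> g \<in> Hom C X Y \<Longrightarrow> h \<in> Hom C X Y \<Longrightarrow> (f \<^bold>+ g) \<^bold>+ h = f \<^bold>+ (g \<^bold>+ h)"
  using abelian_monoid.a_assoc[OF abelian_group.axioms(1)[OF Hom_abelian_group], of f X Y g h] by simp

lemma Add_Zero: "f \<in> Hom C X Y \<Longrightarrow> f \<^bold>+ Zero C X Y = f"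
  using abelian_monoid.r_zero[OF abelian_group.axioms(1)[OF Hom_abelian_group], of f X Y] by simp

lemma Add_cancel:
  "f \<in> Hom C X Y \<Longrightarrow> g \<in> Hom C X Y \<Longrightarrow> h \<in> Hom C X Y \<Longrightarrow> f \<^bold>+ g = f \<^bold>+ h \<longleftrightarrow> g = h"
  using monoid.Units_l_cancel[OF group.is_monoid[OF abelian_group.a_group[OF Hom_abelian_group]], of f X Y g h]
    group.Units[OF abelian_group.a_group[OF Hom_abelian_group], of X Y] by auto

lemma Scale_in: "f \<in> Hom C X Y \<Longrightarrow> Scale C q f \<in> Hom C X Y"
  using module.smult_closed[OF Hom_module, of q f X Y] by simp

lemma Scale_add: "f \<in> Hom C X Y \<Longrightarrow> Scale C (a + b) f = Scale C a f \<^bold>+ Scale C b f"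
  using module.smult_l_distr[OF Hom_module, of a b f X Y] by simp

lemma Scale_Add: "f \<in> Hom C X Y \<Longrightarrow> g \<in> Hom C X Y \<Longrightarrow> Scale C a (f \<^bold>+ g) = Scale C a f \<^bold>+ Scale C a g"
  using module.smult_r_distr[OF Hom_module, of a f X Y g] by simp

lemma Scale_Scale: "f \<in> Hom C X Y \<Longrightarrow> Scale C a (Scale C b f) = Scale C (a * b) f"
  using module.smult_assoc1[OF Hom_module, of a b f X Y] by simp

lemma Scale_1: "f \<in> Hom C X Y \<Longrightarrow> Scale C 1 f = f"
  using module.smult_one[OF Hom_module, of f X Y] by simp

lemma Scale_0: "f \<in> Hom C X Y \<Longrightarrow> Scale C 0 f = Zero C X Y"
proof -
  assume f: "f \<in> Hom C X Y"
  have "Scale C 0 f \<^bold>+ Scale C 0 f = Scale C 0 f \<^bold>+ Zero C X Y"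
    using Scale_add[OF f, of 0 0] Add_Zero[OF Scale_in[OF f]] by simp
  then show ?thesis using Add_cancel Scale_in[OF f] Zero_in by blast
qed

text \<open>An additive map from the rationals to a rational vector space is linear: integers come
  from addition, denominators from dividing by d after multiplying the argument by d. Applied to
  scaling one tensor factor, it turns biadditivity of the tensor product into rational
  bilinearity.\<close>

lemma additive_Scale:
  assumes cl: "\<And>q. \<phi> q \<in> Hom C X Y" and add: "\<And>a b. \<phi> (a + b) = \<phi> a \<^bold>+ \<phi> b"
  shows "\<phi> q = Scale C q (\<phi> 1)"
proof -
  have z: "\<phi> 0 = Zero C X Y"
  proof -
    have "\<phi> 0 \<^bold>+ \<phi> 0 = \<phi> 0 \<^bold>+ Zero C X Y" using add[of 0 0] Add_Zero[OF cl] by simp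
    then show ?thesis using Add_cancel cl Zero_in by blast
  qed
  have n: "\<phi> (of_nat n * a) = Scale C (of_nat n) (\<phi> a)" for n a
  proof (induction n)
    case 0
    then show ?case using z Scale_0[OF cl] by simp
  next
    case (Suc n)
    have "\<phi> (of_nat (Suc n) * a) = \<phi> a \<^bold>+ \<phi> (of_nat n * a)"
      by (simp add: algebra_simps add)
    also have "\<dots> = Scale C 1 (\<phi> a) \<^bold>+ Scale C (of_nat n) (\<phi> a)"
      using Suc Scale_1[OF cl] by simp
    also have "\<dots> = Scale C (of_nat (Suc n)) (\<phi> a)"
      using Scale_add[OF cl, of 1 "of_nat n" a] by simp
    finally show ?case .
  qed
  have m: "\<phi> (- a) = Scale C (- 1) (\<phi> a)" for a
  proof -
    have "\<phi> a \<^bold>+ \<phi> (- a) = Scale C 1 (\<phi> a) \<^bold>+ Scale C (- 1) (\<phi> a)"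
      using add[of a "- a"] Scale_add[OF cl, of 1 "- 1" a] Scale_0[OF cl] z by simp
    then show ?thesis using Add_cancel[of "\<phi> a" X Y "\<phi> (- a)" "Scale C (- 1) (\<phi> a)"] cl Scale_in[OF cl] Scale_1[OF cl]
      by simp
  qed
  obtain a b where q: "q = of_int a / of_int b" "b > 0"
    by (cases q) (auto simp: Fract_of_int_quotient)
  define d where "d = nat b"
  have d: "of_int b = (of_nat d :: rat)" "d > 0" using q by (auto simp: d_def)
  have i: "\<phi> (of_int a) = Scale C (of_int a) (\<phi> 1)"
  proof (cases "a \<ge> 0")
    case True
    then show ?thesis using n[of "nat a" 1] by simp
  next
    case False
    then have a: "of_int a = - (of_nat (nat (- a)) :: rat)" by simp
    have "\<phi> (of_int a) = Scale C (- 1) (Scale C (of_nat (nat (- a))) (\<phi> 1))"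
      unfolding a m using n[of "nat (- a)" 1] by simp
    then show ?thesis unfolding Scale_Scale[OF cl] by (simp add: a)
  qed
  have "\<phi> q = Scale C (1 / of_nat d) (Scale C (of_nat d) (\<phi> q))"
    using d Scale_Scale[OF cl] Scale_1[OF cl] by simp
  also have "\<dots> = Scale C (1 / of_nat d) (\<phi> (of_nat d * q))" by (simp add: n)
  also have "of_nat d * q = of_int a" using q d by simp
  also have "Scale C (1 / of_nat d) (\<phi> (of_int a)) = Scale C q (\<phi> 1)"
    using Scale_Scale[OF cl] q d by (simp add: i)
  finally show ?thesis .
qed

lemma Tensor_Scale_left:
  assumes "f \<in> Hom C X Y" "h \<in> Hom C X' Y'"
  shows "Scale C a f \<otimes>\<^sub>m h = Scale C a (f \<otimes>\<^sub>m h)"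
  using additive_Scale[of "\<lambda>q. Scale C q f \<otimes>\<^sub>m h" "X \<otimes>\<^sub>o X'" "Y \<otimes>\<^sub>o Y'" a] assms
  by (simp add: Tensor_in Scale_in Scale_add Tensor_Add_left[OF Scale_in Scale_in] Scale_1)

lemma Tensor_Scale_right:
  assumes "f \<in> Hom C X Y" "h \<in> Hom C X' Y'"
  shows "h \<otimes>\<^sub>m Scale C a f = Scale C a (h \<otimes>\<^sub>m f)"
  using additive_Scale[of "\<lambda>q. h \<otimes>\<^sub>m Scale C q f" "X' \<otimes>\<^sub>o X" "Y' \<otimes>\<^sub>o Y" a] assms
  by (simp add: Tensor_in Scale_in Scale_add Tensor_Add_right[OF Scale_in Scale_in] Scale_1)

lemma inverse_unique:
  assumes "is_inverse C X Y f h" "is_inverse C X Y f h'"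
  shows "h = h'"
proof -
  have t: "f \<in> Hom C X Y" "h \<in> Hom C Y X" "h' \<in> Hom C Y X" "h \<cdot> f = \<^bold>1 X" "f \<cdot> h' = \<^bold>1 Y"
    using assms by (auto simp: is_inverse_def)
  have "h = h \<cdot> (f \<cdot> h')" using Comp_Id[OF t(2)] t(5) by simp
  also have "\<dots> = (h \<cdot> f) \<cdot> h'" using Comp_assoc[OF t(3,1,2)] by simp
  also have "\<dots> = h'" using Id_Comp[OF t(3)] t(4) by simp
  finally show ?thesis .
qed

lemma iso_inv_eqI: "is_inverse C X Y f h \<Longrightarrow> iso_inv C X Y f = h"
  unfolding iso_inv_def by (rule the_equality) (auto intro: inverse_unique)

lemma iso_inv: "is_isomorphism C X Y f \<Longrightarrow> is_inverse C X Y f (iso_inv C X Y f)"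
  unfolding is_isomorphism_def using iso_inv_eqI by metis

text \<open>\<open>None\<close> serves as the result of an impossible composition.\<close>

fun narr :: "('a \<times> 'b \<times> 'a) option \<Rightarrow> bool" where
  "narr None = False"
| "narr (Some (X, f, Y)) \<longleftrightarrow> f \<in> Hom C X Y"

definition nsrc :: "('a \<times> 'b \<times> 'a) option \<Rightarrow> 'a" where "nsrc t = fst (the t)"
definition nmor :: "('a \<times> 'b \<times> 'a) option \<Rightarrow> 'b" where "nmor t = fst (snd (the t))"
definition ntgt :: "('a \<times> 'b \<times> 'a) option \<Rightarrow> 'a" where "ntgt t = snd (snd (the t))"
definition nidm where "nidm X = Some (X, \<^bold>1 X, X)"
definition ncmp where
  "ncmp t u = (if narr t \<and> narr u \<and> nsrc t = ntgt u then Some (nsrc u, nmor t \<cdot> nmor u, ntgt t) else None)"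
definition npls where "npls t u = Some (nsrc t, nmor t \<^bold>+ nmor u, ntgt t)"
definition nscl where "nscl a t = Some (nsrc t, Scale C a (nmor t), ntgt t)"
definition nten where "nten t u = Some (nsrc t \<otimes>\<^sub>o nsrc u, nmor t \<otimes>\<^sub>m nmor u, ntgt t \<otimes>\<^sub>o ntgt u)"
definition nas where "nas X Y Z = Some ((X \<otimes>\<^sub>o Y) \<otimes>\<^sub>o Z, Assoc C X Y Z, X \<otimes>\<^sub>o (Y \<otimes>\<^sub>o Z))"
definition nas' where "nas' X Y Z = Some (X \<otimes>\<^sub>o (Y \<otimes>\<^sub>o Z), inv_Assoc C X Y Z, (X \<otimes>\<^sub>o Y) \<otimes>\<^sub>o Z)"
definition nlu where "nlu X = Some (\<I> \<otimes>\<^sub>o X, Lunit C X, X)"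
definition nlu' where "nlu' X = Some (X, iso_inv C (\<I> \<otimes>\<^sub>o X) X (Lunit C X), \<I> \<otimes>\<^sub>o X)"
definition nru where "nru X = Some (X \<otimes>\<^sub>o \<I>, Runit C X, X)"
definition nru' where "nru' X = Some (X, iso_inv C (X \<otimes>\<^sub>o \<I>) X (Runit C X), X \<otimes>\<^sub>o \<I>)"
definition nsy where "nsy X Y = Some (X \<otimes>\<^sub>o Y, \<tau> X Y, Y \<otimes>\<^sub>o X)"

lemma nproj [simp]: "nsrc (Some (X, f, Y)) = X" "nmor (Some (X, f, Y)) = f" "ntgt (Some (X, f, Y)) = Y"
  by (auto simp: nsrc_def nmor_def ntgt_def)

lemma narrE: "narr t \<Longrightarrow> (\<And>X f Y. t = Some (X, f, Y) \<Longrightarrow> f \<in> Hom C X Y \<Longrightarrow> P) \<Longrightarrow> P"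
  by (cases t rule: narr.cases) auto

lemma Assoc_inverse: "is_inverse C ((X \<otimes>\<^sub>o Y) \<otimes>\<^sub>o Z) (X \<otimes>\<^sub>o (Y \<otimes>\<^sub>o Z)) (Assoc C X Y Z) (inv_Assoc C X Y Z)"
  unfolding inv_Assoc_def by (rule iso_inv[OF Assoc_iso])

lemmas Lunit_inverse = iso_inv[OF Lunit_iso]
lemmas Runit_inverse = iso_inv[OF Runit_iso]

lemma Assoc_in: "Assoc C X Y Z \<in> Hom C ((X \<otimes>\<^sub>o Y) \<otimes>\<^sub>o Z) (X \<otimes>\<^sub>o (Y \<otimes>\<^sub>o Z))"
  and Lunit_in: "Lunit C X \<in> Hom C (\<I> \<otimes>\<^sub>o X) X"
  and Runit_in: "Runit C X \<in> Hom C (X \<otimes>\<^sub>o \<I>) X"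
  using Assoc_inverse Lunit_inverse Runit_inverse by (auto simp: is_inverse_def)

lemma ncmp_Some:
  "f \<in> Hom C X Y \<Longrightarrow> g \<in> Hom C Y Z \<Longrightarrow> ncmp (Some (Y, g, Z)) (Some (X, f, Y)) = Some (X, g \<cdot> f, Z)"
  by (simp add: ncmp_def)

lemma nten_Some [simp]: "nten (Some (X, f, Y)) (Some (X', f', Y')) = Some (X \<otimes>\<^sub>o X', f \<otimes>\<^sub>m f', Y \<otimes>\<^sub>o Y')"
  by (simp add: nten_def)

lemma linear_monoidal_arrows:
  "linear_monoidal_arrows narr nsrc ntgt nidm ncmp None npls nscl (TensorO C) nten \<I> nas nas' nlu nlu' nru nru' nsy"
proof unfold_locales
  note t = Id_in Comp_in Tensor_in Assoc_in Lunit_in Runit_in Symm_in Add_in Scale_in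
  note inv = Assoc_inverse Lunit_inverse Runit_inverse
  show "\<not> narr None" by simp
  show "narr (nidm X)" "nsrc (nidm X) = X" "ntgt (nidm X) = X" for X by (auto simp: nidm_def t)
  show "narr (ncmp g f) \<longleftrightarrow> narr g \<and> narr f \<and> nsrc g = ntgt f" for g f
    by (auto simp: ncmp_def elim!: narrE intro: t)
  show "nsrc (ncmp g f) = nsrc f" "ntgt (ncmp g f) = ntgt g" if "narr g" "narr f" "nsrc g = ntgt f" for g f
    using that by (auto simp: ncmp_def)
  show "ncmp (ncmp h g) f = ncmp h (ncmp g f)" for h g f
  proof (cases "narr f \<and> narr g \<and> narr h \<and> nsrc g = ntgt f \<and> nsrc h = ntgt g")
    case True
    then show ?thesis by (auto elim!: narrE simp: ncmp_Some Comp_in Comp_assoc)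
  next
    case False
    then show ?thesis by (auto simp: ncmp_def elim!: narrE)
  qed
  show "ncmp f (nidm X) = f" if "narr f" "nsrc f = X" for f X
    using that by (auto elim!: narrE simp: nidm_def ncmp_Some t Comp_Id)
  show "ncmp (nidm X) f = f" if "narr f" "ntgt f = X" for f X
    using that by (auto elim!: narrE simp: nidm_def ncmp_Some t Id_Comp)
  show "narr (nten f g)" "nsrc (nten f g) = nsrc f \<otimes>\<^sub>o nsrc g" "ntgt (nten f g) = ntgt f \<otimes>\<^sub>o ntgt g"
    if "narr f" "narr g" for f g
    using that by (auto elim!: narrE simp: t)
  show "nten (nidm X) (nidm Y) = nidm (X \<otimes>\<^sub>o Y)" for X Y by (simp add: nidm_def Tensor_Id)
  show "ncmp (nten g g') (nten f f') = nten (ncmp g f) (ncmp g' f')"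
    if "narr f" "narr g" "nsrc g = ntgt f" "narr f'" "narr g'" "nsrc g' = ntgt f'" for f g f' g'
    using that by (auto elim!: narrE simp: ncmp_Some t Tensor_Comp)
  show "narr (nas X Y Z)" "nsrc (nas X Y Z) = (X \<otimes>\<^sub>o Y) \<otimes>\<^sub>o Z" "ntgt (nas X Y Z) = X \<otimes>\<^sub>o Y \<otimes>\<^sub>o Z" for X Y Z
    by (auto simp: nas_def t)
  show "narr (nas' X Y Z)" "ntgt (nas' X Y Z) = (X \<otimes>\<^sub>o Y) \<otimes>\<^sub>o Z" "nsrc (nas' X Y Z) = X \<otimes>\<^sub>o Y \<otimes>\<^sub>o Z" for X Y Z
    using inv(1)[of X Y Z] by (auto simp: nas'_def is_inverse_def)
  show "ncmp (nas X Y Z) (nas' X Y Z) = nidm (X \<otimes>\<^sub>o Y \<otimes>\<^sub>o Z)" "ncmp (nas' X Y Z) (nas X Y Z) = nidm ((X \<otimes>\<^sub>o Y) \<otimes>\<^sub>o Z)" for X Y Z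
    using inv(1)[of X Y Z] by (auto simp: nas_def nas'_def nidm_def is_inverse_def ncmp_Some)
  show "ncmp (nas (ntgt f) (ntgt g) (ntgt h)) (nten (nten f g) h) =
      ncmp (nten f (nten g h)) (nas (nsrc f) (nsrc g) (nsrc h))" if "narr f" "narr g" "narr h" for f g h
    using that by (auto elim!: narrE simp: nas_def ncmp_Some t Assoc_natural)
  show "narr (nlu X)" "nsrc (nlu X) = \<I> \<otimes>\<^sub>o X" "ntgt (nlu X) = X" for X by (auto simp: nlu_def t)
  show "narr (nlu' X)" "ntgt (nlu' X) = \<I> \<otimes>\<^sub>o X" "nsrc (nlu' X) = X" for X
    using inv(2)[of X] by (auto simp: nlu'_def is_inverse_def)
  show "ncmp (nlu X) (nlu' X) = nidm X" "ncmp (nlu' X) (nlu X) = nidm (\<I> \<otimes>\<^sub>o X)" for X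
    using inv(2)[of X] by (auto simp: nlu_def nlu'_def nidm_def is_inverse_def ncmp_Some)
  show "ncmp (nlu (ntgt f)) (nten (nidm \<I>) f) = ncmp f (nlu (nsrc f))" if "narr f" for f
    using that by (auto elim!: narrE simp: nlu_def nidm_def ncmp_Some t Lunit_natural)
  show "narr (nru X)" "nsrc (nru X) = X \<otimes>\<^sub>o \<I>" "ntgt (nru X) = X" for X by (auto simp: nru_def t)
  show "narr (nru' X)" "ntgt (nru' X) = X \<otimes>\<^sub>o \<I>" "nsrc (nru' X) = X" for X
    using inv(3)[of X] by (auto simp: nru'_def is_inverse_def)
  show "ncmp (nru X) (nru' X) = nidm X" "ncmp (nru' X) (nru X) = nidm (X \<otimes>\<^sub>o \<I>)" for X
    using inv(3)[of X] by (auto simp: nru_def nru'_def nidm_def is_inverse_def ncmp_Some)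
  show "ncmp (nru (ntgt f)) (nten f (nidm \<I>)) = ncmp f (nru (nsrc f))" if "narr f" for f
    using that by (auto elim!: narrE simp: nru_def nidm_def ncmp_Some t Runit_natural)
  show "narr (nsy X Y)" "nsrc (nsy X Y) = X \<otimes>\<^sub>o Y" "ntgt (nsy X Y) = Y \<otimes>\<^sub>o X" for X Y
    by (auto simp: nsy_def t)
  show "ncmp (nsy (ntgt f) (ntgt g)) (nten f g) = ncmp (nten g f) (nsy (nsrc f) (nsrc g))"
    if "narr f" "narr g" for f g
    using that by (auto elim!: narrE simp: nsy_def ncmp_Some t Symm_natural)
  show "ncmp (nsy Y X) (nsy X Y) = nidm (X \<otimes>\<^sub>o Y)" for X Y
    by (simp add: nsy_def nidm_def ncmp_Some t Symm_Symm)
  show "ncmp (nas W X (Y \<otimes>\<^sub>o Z)) (nas (W \<otimes>\<^sub>o X) Y Z) =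
      ncmp (nten (nidm W) (nas X Y Z)) (ncmp (nas W (X \<otimes>\<^sub>o Y) Z) (nten (nas W X Y) (nidm Z)))" for W X Y Z
    by (simp add: nas_def nidm_def ncmp_Some t pentagon Comp_in[OF Tensor_in[OF Assoc_in Id_in] Assoc_in])
  show "ncmp (nten (nidm X) (nlu Y)) (nas X \<I> Y) = nten (nru X) (nidm Y)" for X Y
    by (simp add: nas_def nlu_def nru_def nidm_def ncmp_Some t triangle)
  show "ncmp (nas Y Z X) (ncmp (nsy X (Y \<otimes>\<^sub>o Z)) (nas X Y Z)) =
      ncmp (nten (nidm Y) (nsy X Z)) (ncmp (nas Y X Z) (nten (nsy X Y) (nidm Z)))" for X Y Z
    by (simp add: nas_def nsy_def nidm_def ncmp_Some t hexagon Comp_in[OF Tensor_in[OF Symm_in Id_in] Assoc_in]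
        Comp_in[OF Assoc_in Symm_in])
  show "narr (npls f g)" "nsrc (npls f g) = nsrc f" "ntgt (npls f g) = ntgt f"
    if "narr f" "narr g" "nsrc f = nsrc g" "ntgt f = ntgt g" for f g
    using that by (auto elim!: narrE simp: npls_def t)
  show "narr (nscl q f)" "nsrc (nscl q f) = nsrc f" "ntgt (nscl q f) = ntgt f" if "narr f" for q f
    using that by (auto elim!: narrE simp: nscl_def t)
  show "npls f g = npls g f" if "narr f" "narr g" "nsrc f = nsrc g" "ntgt f = ntgt g" for f g
    using that by (auto elim!: narrE simp: npls_def Add_commute)
  show "npls (npls f g) h = npls f (npls g h)"
    if "narr f" "narr g" "narr h" "nsrc f = nsrc g" "ntgt f = ntgt g" "nsrc g = nsrc h" "ntgt g = ntgt h" for f g h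
    using that by (auto elim!: narrE simp: npls_def Add_assoc)
  show "nscl (a + b) f = npls (nscl a f) (nscl b f)" if "narr f" for a b f
    using that by (auto elim!: narrE simp: npls_def nscl_def Scale_add)
  show "nscl a (nscl b f) = nscl (a * b) f" if "narr f" for a b f
    using that by (auto elim!: narrE simp: nscl_def Scale_Scale)
  show "npls f (nscl 0 g) = f" if "narr f" "narr g" "nsrc f = nsrc g" "ntgt f = ntgt g" for f g
    using that by (auto elim!: narrE simp: npls_def nscl_def Scale_0 Add_Zero)
  show "nscl 1 f = f" if "narr f" for f
    using that by (auto elim!: narrE simp: nscl_def Scale_1)
  show "nscl a (npls f g) = npls (nscl a f) (nscl a g)"
    if "narr f" "narr g" "nsrc f = nsrc g" "ntgt f = ntgt g" for a f g
    using that by (auto elim!: narrE simp: npls_def nscl_def Scale_Add)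
  show "ncmp h (npls f g) = npls (ncmp h f) (ncmp h g)"
    if "narr f" "narr g" "nsrc f = nsrc g" "ntgt f = ntgt g" "narr h" "nsrc h = ntgt f" for f g h
    using that by (auto elim!: narrE simp: npls_def ncmp_Some t Comp_Add)
  show "ncmp (npls f g) h = npls (ncmp f h) (ncmp g h)"
    if "narr f" "narr g" "nsrc f = nsrc g" "ntgt f = ntgt g" "narr h" "ntgt h = nsrc f" for f g h
    using that by (auto elim!: narrE simp: npls_def ncmp_Some t Add_Comp)
  show "ncmp h (nscl a f) = nscl a (ncmp h f)" if "narr f" "narr h" "nsrc h = ntgt f" for a f h
    using that by (auto elim!: narrE simp: nscl_def ncmp_Some t Comp_Scale)
  show "ncmp (nscl a h) f = nscl a (ncmp h f)" if "narr f" "narr h" "nsrc h = ntgt f" for a f h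
    using that by (auto elim!: narrE simp: nscl_def ncmp_Some t Scale_Comp)
  show "nten h (npls f g) = npls (nten h f) (nten h g)"
    if "narr f" "narr g" "nsrc f = nsrc g" "ntgt f = ntgt g" "narr h" for f g h
    using that by (auto elim!: narrE simp: npls_def Tensor_Add_right)
  show "nten (npls f g) h = npls (nten f h) (nten g h)"
    if "narr f" "narr g" "nsrc f = nsrc g" "ntgt f = ntgt g" "narr h" for f g h
    using that by (auto elim!: narrE simp: npls_def Tensor_Add_left)
  show "nten h (nscl a f) = nscl a (nten h f)" if "narr f" "narr h" for a f h
    using that by (auto elim!: narrE simp: nscl_def Tensor_Scale_right)
  show "nten (nscl a f) h = nscl a (nten f h)" if "narr f" "narr h" for a f h
    using that by (auto elim!: narrE simp: nscl_def Tensor_Scale_left)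
qed

end

section \<open>Transport to the strict category\<close>

text \<open>
  A term of type \<open>texp\<close> records how an object is built; \<open>un a\<close> is the resulting isomorphism from
  the object to the right-nested tensor product of its list of factors, and \<open>L a b f\<close> is \<open>f\<close> conjugated
  by these isomorphisms. \<open>Word\<close> is for objects that already are right-nested tensor products, so
  \<open>Word [X]\<close> is \<open>X \<otimes> \<I>\<close>, while \<open>Leaf X\<close> is \<open>X\<close> itself.
\<close>

datatype 'o texp = Leaf 'o | Word "'o list" | Tens "'o texp" "'o texp"

primrec flat :: "'o texp \<Rightarrow> 'o list" where
  "flat (Leaf X) = [X]"
| "flat (Word Xs) = Xs"
| "flat (Tens a b) = flat a @ flat b"

context rat_tensor_category
begin

sublocale M: linear_monoidal_arrows narr nsrc ntgt nidm ncmp None npls nscl "TensorO C" nten \<I> nas nas' nlu nlu' nru nru' nsy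
  by (rule linear_monoidal_arrows)

sublocale S: strict_smc M.sarr M.ssrc M.stgt M.sidm M.scmp M.swh M.ssym M.spls M.sscl
  by (rule M.strict_smc)

notation ncmp (infixr "\<diamondop>" 60)
notation M.scmp (infixr "\<bullet>" 60)
notation M.spls (infixl "\<boxplus>" 55)

lemma tnl_eq: "M.tnl Xs = tensor_list C Xs"
  by (induction Xs) auto

primrec obj :: "'a texp \<Rightarrow> 'a" where
  "obj (Leaf X) = X"
| "obj (Word Xs) = tensor_list C Xs"
| "obj (Tens a b) = obj a \<otimes>\<^sub>o obj b"

primrec un :: "'a texp \<Rightarrow> ('a \<times> 'b \<times> 'a) option" where
  "un (Leaf X) = nru' X"
| "un (Word Xs) = nidm (M.tnl Xs)"
| "un (Tens a b) = M.jn (flat a) (flat b) \<diamondop> nten (un a) (un b)"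

primrec un' :: "'a texp \<Rightarrow> ('a \<times> 'b \<times> 'a) option" where
  "un' (Leaf X) = nru X"
| "un' (Word Xs) = nidm (M.tnl Xs)"
| "un' (Tens a b) = nten (un' a) (un' b) \<diamondop> M.jn' (flat a) (flat b)"

lemma un_typ [simp]: "narr (un a)" "nsrc (un a) = obj a" "ntgt (un a) = M.tnl (flat a)"
  by (induction a) (auto simp: tnl_eq)

lemma un'_typ [simp]: "narr (un' a)" "ntgt (un' a) = obj a" "nsrc (un' a) = M.tnl (flat a)"
  by (induction a) (auto simp: tnl_eq)

lemma un_un' [simp]: "un a \<diamondop> un' a = nidm (M.tnl (flat a))" "un' a \<diamondop> un a = nidm (obj a)"
proof (induction a)
  case (Tens a b)
  show 1: "un (Tens a b) \<diamondop> un' (Tens a b) = nidm (M.tnl (flat (Tens a b)))"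
    using Tens by (simp add: M.cmp_assoc M.reassoc[OF M.ten_cmp])
  show "un' (Tens a b) \<diamondop> un (Tens a b) = nidm (obj (Tens a b))"
    using Tens by (simp add: M.cmp_assoc M.ten_cmp)
qed (auto simp: tnl_eq)

lemma un_un'_cmp [simp]:
  "narr x \<Longrightarrow> ntgt x = M.tnl (flat a) \<Longrightarrow> un a \<diamondop> (un' a \<diamondop> x) = x"
  "narr x \<Longrightarrow> ntgt x = obj a \<Longrightarrow> un' a \<diamondop> (un a \<diamondop> x) = x"
  by (simp_all add: M.reassoc[OF un_un'(1)] M.reassoc[OF un_un'(2)])

definition L :: "'a texp \<Rightarrow> 'a texp \<Rightarrow> 'b \<Rightarrow> 'a list \<times> ('a \<times> 'b \<times> 'a) option \<times> 'a list" where
  "L a b f = (flat a, un b \<diamondop> Some (obj a, f, obj b) \<diamondop> un' a, flat b)"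

lemma L_arr [simp]: "f \<in> Hom C (obj a) (obj b) \<Longrightarrow> M.sarr (L a b f)"
  by (simp add: L_def)

lemma L_src [simp]: "M.ssrc (L a b f) = flat a" and L_tgt [simp]: "M.stgt (L a b f) = flat b"
  by (simp_all add: L_def)

lemma L_cmp:
  assumes "f \<in> Hom C (obj a) (obj b)" "g \<in> Hom C (obj b) (obj c)"
  shows "L a c (g \<cdot> f) = L b c g \<bullet> L a b f"
proof -
  have "Some (obj a, g \<cdot> f, obj c) = Some (obj b, g, obj c) \<diamondop> Some (obj a, f, obj b)"
    using ncmp_Some[OF assms] by simp
  then show ?thesis using assms by (simp add: L_def M.scmp_def M.cmp_assoc)
qed

lemma L_Id [simp]: "L a a (\<^bold>1 (obj a)) = M.sidm (flat a)"
  using M.idm_cmp[of "un' a" "obj a"] by (simp add: L_def M.sidm_def nidm_def)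

lemma L_inj:
  assumes "f \<in> Hom C (obj a) (obj b)" "g \<in> Hom C (obj a) (obj b)" "L a b f = L a b g"
  shows "f = g"
proof -
  have "un' b \<diamondop> (un b \<diamondop> Some (obj a, f, obj b) \<diamondop> un' a) \<diamondop> un a =
      un' b \<diamondop> (un b \<diamondop> Some (obj a, g, obj b) \<diamondop> un' a) \<diamondop> un a"
    using assms(3) by (simp add: L_def)
  then show ?thesis using assms(1,2) by (simp add: M.cmp_assoc)
qed

text \<open>With \<open>L_inj\<close> this makes \<open>L\<close> a bijection on hom sets, so that
  inverses and universal arrows found in the strict category come from the given one.\<close>

lemma L_surj:
  assumes "M.sarr t" "M.ssrc t = flat a" "M.stgt t = flat b"
  obtains f where "f \<in> Hom C (obj a) (obj b)" "t = L a b f"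
proof -
  obtain h where t: "t = (flat a, h, flat b)" using assms by (cases t) auto
  have h [simp]: "narr h" "nsrc h = M.tnl (flat a)" "ntgt h = M.tnl (flat b)" using assms t by auto
  define k where "k = un' b \<diamondop> h \<diamondop> un a"
  have "narr k" "nsrc k = obj a" "ntgt k = obj b" by (auto simp: k_def)
  then obtain f where f: "k = Some (obj a, f, obj b)" "f \<in> Hom C (obj a) (obj b)"
    by (auto elim!: narrE)
  have "t = L a b f"
    by (simp add: t L_def f(1)[symmetric] k_def M.cmp_assoc)
  then show ?thesis using f that by blast
qed

lemma L_Tensor:
  assumes "f \<in> Hom C (obj a) (obj b)" "f' \<in> Hom C (obj a') (obj b')"
  shows "L (Tens a a') (Tens b b') (f \<otimes>\<^sub>m f') =
    M.swh [] (L a b f) (flat b') \<bullet> M.swh (flat a) (L a' b' f') []"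
proof -
  let ?f = "un b \<diamondop> Some (obj a, f, obj b) \<diamondop> un' a"
  let ?f' = "un b' \<diamondop> Some (obj a', f', obj b') \<diamondop> un' a'"
  have [simp]: "narr ?f" "nsrc ?f = M.tnl (flat a)" "ntgt ?f = M.tnl (flat b)"
    "narr ?f'" "nsrc ?f' = M.tnl (flat a')" "ntgt ?f' = M.tnl (flat b')"
    using assms by auto
  have "M.swh [] (L a b f) (flat b') \<bullet> M.swh (flat a) (L a' b' f') [] =
      (flat a @ flat a', M.rwm (flat a) ?f (flat b) (flat b') \<diamondop> M.lwm (flat a) ?f', flat b @ flat b')"
    using assms by (simp add: M.swh_def L_def M.scmp_def M.rwm_Nil del: M.cmp_assoc)
  also have "M.rwm (flat a) ?f (flat b) (flat b') \<diamondop> M.lwm (flat a) ?f' =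
      M.jn (flat b) (flat b') \<diamondop> nten ?f ?f' \<diamondop> M.jn' (flat a) (flat a')"
  proof -
    have "M.lwm (flat a) ?f' = M.jn (flat a) (flat b') \<diamondop> nten (nidm (M.tnl (flat a))) ?f' \<diamondop> M.jn' (flat a) (flat a')"
      by (rule M.lwm_eq) (use assms in auto)
    moreover have "nten ?f (nidm (M.tnl (flat b'))) \<diamondop> nten (nidm (M.tnl (flat a))) ?f' = nten ?f ?f'"
      using assms by (simp add: M.ten_cmp)
    ultimately show ?thesis
      unfolding M.rwm_def using assms by (simp add: M.cmp_assoc) (metis M.cmp_assoc)
  qed
  also have "nten ?f ?f' = nten (un b) (un b') \<diamondop> Some (obj a \<otimes>\<^sub>o obj a', f \<otimes>\<^sub>m f', obj b \<otimes>\<^sub>o obj b') \<diamondop> nten (un' a) (un' a')"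
    using assms by (simp add: M.ten_cmp Tensor_in flip: nten_Some)
  finally show ?thesis by (simp add: L_def M.cmp_assoc)
qed

lemma L_Tensor_Id:
  assumes "f \<in> Hom C (obj a) (obj b)"
  shows "L (Tens a c) (Tens b c) (f \<otimes>\<^sub>m \<^bold>1 (obj c)) = M.swh [] (L a b f) (flat c)"
    and "L (Tens c a) (Tens c b) (\<^bold>1 (obj c) \<otimes>\<^sub>m f) = M.swh (flat c) (L a b f) []"
  using L_Tensor[OF assms Id_in, of c] L_Tensor[OF Id_in assms, of c] assms by simp_all

text \<open>Naturality of the associator followed by \<open>jn_assoc\<close>. Consequently
  \<open>L\<close> sends associators to identities.\<close>

lemma un_Assoc: "un (Tens a (Tens b c)) \<diamondop> nas (obj a) (obj b) (obj c) = un (Tens (Tens a b) c)"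
proof -
  let ?a = "flat a" and ?b = "flat b" and ?c = "flat c"
  have 1: "nten (un a) (M.jn ?b ?c \<diamondop> nten (un b) (un c)) = nten (nidm (M.tnl ?a)) (M.jn ?b ?c) \<diamondop> nten (un a) (nten (un b) (un c))"
    by (simp add: M.ten_cmp)
  have 2: "nten (M.jn ?a ?b \<diamondop> nten (un a) (un b)) (un c) = nten (M.jn ?a ?b) (nidm (M.tnl ?c)) \<diamondop> nten (nten (un a) (un b)) (un c)"
    by (simp add: M.ten_cmp)
  have "un (Tens a (Tens b c)) \<diamondop> nas (obj a) (obj b) (obj c) =
     M.jn ?a (?b @ ?c) \<diamondop> nten (nidm (M.tnl ?a)) (M.jn ?b ?c) \<diamondop> nas (M.tnl ?a) (M.tnl ?b) (M.tnl ?c) \<diamondop> nten (nten (un a) (un b)) (un c)"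
    using M.as_natural[of "un a" "un b" "un c"] by (simp add: 1 M.cmp_assoc)
  also have "\<dots> = (M.jn (?a @ ?b) ?c \<diamondop> nten (M.jn ?a ?b) (nidm (M.tnl ?c))) \<diamondop> nten (nten (un a) (un b)) (un c)"
    unfolding M.jn_assoc by (simp add: M.cmp_assoc)
  also have "\<dots> = un (Tens (Tens a b) c)" by (simp add: 2 M.cmp_assoc)
  finally show ?thesis .
qed

lemma L_Assoc [simp]:
  "L (Tens (Tens a b) c) (Tens a (Tens b c)) (Assoc C (obj a) (obj b) (obj c)) = M.sidm (flat a @ flat b @ flat c)"
proof -
  have "un (Tens a (Tens b c)) \<diamondop> nas (obj a) (obj b) (obj c) \<diamondop> un' (Tens (Tens a b) c) =
      un (Tens (Tens a b) c) \<diamondop> un' (Tens (Tens a b) c)"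
    by (simp only: M.reassoc[OF un_Assoc])
  also have "\<dots> = nidm (M.tnl (flat (Tens (Tens a b) c)))" by (rule un_un')
  finally show ?thesis by (simp add: L_def M.sidm_def nas_def del: un.simps un'.simps)
qed

lemma L_Lunit [simp]: "L (Tens (Word []) a) a (Lunit C (obj a)) = M.sidm (flat a)"
proof -
  have "un a \<diamondop> nlu (obj a) = un (Tens (Word []) a)"
    using M.lu_natural[of "un a"] by (simp add: tnl_eq)
  from M.reassoc[OF this] have "un a \<diamondop> nlu (obj a) \<diamondop> un' (Tens (Word []) a) = un (Tens (Word []) a) \<diamondop> un' (Tens (Word []) a)"
    .
  also have "\<dots> = nidm (M.tnl (flat (Tens (Word []) a)))" by (rule un_un')
  finally show ?thesis by (simp add: L_def M.sidm_def nlu_def del: un.simps un'.simps)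
qed

lemma L_Runit [simp]: "L (Tens a (Word [])) a (Runit C (obj a)) = M.sidm (flat a)"
proof -
  have "un a \<diamondop> nru (obj a) = un (Tens a (Word []))"
    using M.ru_natural[of "un a"] by (simp add: tnl_eq M.jn_Nil)
  from M.reassoc[OF this] have "un a \<diamondop> nru (obj a) \<diamondop> un' (Tens a (Word [])) = un (Tens a (Word [])) \<diamondop> un' (Tens a (Word []))"
    .
  also have "\<dots> = nidm (M.tnl (flat (Tens a (Word []))))" by (rule un_un')
  finally show ?thesis by (simp add: L_def M.sidm_def nru_def del: un.simps un'.simps)
qed

lemma L_Symm [simp]: "L (Tens a b) (Tens b a) (\<tau> (obj a) (obj b)) = M.ssym (flat a) (flat b)"
proof -
  have n: "nten (un b) (un a) \<diamondop> nsy (obj a) (obj b) = nsy (M.tnl (flat a)) (M.tnl (flat b)) \<diamondop> nten (un a) (un b)"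
    using M.sy_natural[of "un a" "un b"] by simp
  have "un (Tens b a) \<diamondop> nsy (obj a) (obj b) \<diamondop> un' (Tens a b) = M.sym_m (flat a) (flat b)"
    by (simp add: M.sym_m_def M.cmp_assoc M.reassoc2[OF n] M.reassoc[OF M.ten_cmp])
  then show ?thesis by (simp add: L_def M.ssym_def nsy_def del: un.simps un'.simps)
qed

lemma L_Add:
  assumes "f \<in> Hom C (obj a) (obj b)" "g \<in> Hom C (obj a) (obj b)"
  shows "L a b (f \<^bold>+ g) = L a b f \<boxplus> L a b g"
proof -
  have "Some (obj a, f \<^bold>+ g, obj b) = npls (Some (obj a, f, obj b)) (Some (obj a, g, obj b))"
    by (simp add: npls_def)
  then show ?thesis using assms by (simp add: L_def M.spls_def M.cmp_pls M.pls_cmp)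
qed

lemma L_Scale:
  assumes "f \<in> Hom C (obj a) (obj b)"
  shows "L a b (Scale C q f) = M.sscl q (L a b f)"
proof -
  have "Some (obj a, Scale C q f, obj b) = nscl q (Some (obj a, f, obj b))"
    by (simp add: nscl_def)
  then show ?thesis using assms by (simp add: L_def M.sscl_def M.cmp_scl M.scl_cmp)
qed

lemma L_inverse:
  assumes "is_inverse C (obj a) (obj b) f h"
  shows "L b a h \<bullet> L a b f = M.sidm (flat a)" "L a b f \<bullet> L b a h = M.sidm (flat b)"
    and "f \<in> Hom C (obj a) (obj b)" "h \<in> Hom C (obj b) (obj a)"
  using assms L_cmp[of f a b h a] L_cmp[of h b a f b] by (auto simp: is_inverse_def)

lemma L_inverse_id:
  assumes "is_inverse C (obj a) (obj b) f h" "L a b f = M.sidm (flat b)"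
  shows "L b a h = M.sidm (flat b)"
proof -
  have "flat a = flat b" using assms(2) by (metis L_src S.src_idm)
  then show ?thesis using L_inverse[OF assms(1)] assms(2) by simp
qed

lemma L_iso: "is_isomorphism C (obj a) (obj b) f \<longleftrightarrow> f \<in> Hom C (obj a) (obj b) \<and> S.is_iso (L a b f)"
proof
  assume "is_isomorphism C (obj a) (obj b) f"
  then obtain h where h: "is_inverse C (obj a) (obj b) f h" by (auto simp: is_isomorphism_def)
  show "f \<in> Hom C (obj a) (obj b) \<and> S.is_iso (L a b f)"
    using L_inverse[OF h] by (intro conjI S.is_isoI[of "L a b f" "L b a h"]) simp_all
next
  assume *: "f \<in> Hom C (obj a) (obj b) \<and> S.is_iso (L a b f)"
  obtain t where t: "M.sarr t" "M.ssrc t = flat b" "M.stgt t = flat a"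
    "t \<bullet> L a b f = M.sidm (flat a)" "L a b f \<bullet> t = M.sidm (flat b)"
    using * by (auto simp: S.is_iso_def)
  obtain h where h: "h \<in> Hom C (obj b) (obj a)" "t = L b a h" using t(1-3) by (rule L_surj)
  have "is_inverse C (obj a) (obj b) f h"
    unfolding is_inverse_def
  proof (intro conjI)
    show "h \<cdot> f = \<^bold>1 (obj a)"
      by (rule L_inj[of _ a a]) (use * h t Comp_in[of f "obj a" "obj b" h "obj a"] in \<open>simp_all add: L_cmp[of f a b h a] Id_in\<close>)
    show "f \<cdot> h = \<^bold>1 (obj b)"
      by (rule L_inj[of _ b b]) (use * h t Comp_in[of h "obj b" "obj a" f "obj b"] in \<open>simp_all add: L_cmp[of h b a f b] Id_in\<close>)
  qed (use * h in auto)
  then show "is_isomorphism C (obj a) (obj b) f" by (auto simp: is_isomorphism_def)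
qed

lemma L_inv_Assoc [simp]:
  "L (Tens a (Tens b c)) (Tens (Tens a b) c) (inv_Assoc C (obj a) (obj b) (obj c)) = M.sidm (flat a @ flat b @ flat c)"
proof -
  have "L (Tens a (Tens b c)) (Tens (Tens a b) c) (inv_Assoc C (obj a) (obj b) (obj c)) =
      M.sidm (flat (Tens a (Tens b c)))"
    by (rule L_inverse_id[where f = "Assoc C (obj a) (obj b) (obj c)"]) (simp_all only: obj.simps Assoc_inverse L_Assoc flat.simps)
  then show ?thesis by (simp only: flat.simps)
qed

lemma inv_Assoc_in: "inv_Assoc C X Y Z \<in> Hom C (X \<otimes>\<^sub>o (Y \<otimes>\<^sub>o Z)) ((X \<otimes>\<^sub>o Y) \<otimes>\<^sub>o Z)"
  using Assoc_inverse by (auto simp: is_inverse_def)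

text \<open>\<open>Leaf X\<close> introduces a unit factor and \<open>jn\<close> removes it again;
  by the triangle the net effect is an identity.\<close>

lemma un_Cons: "un (Tens (Leaf X) (Word Xs)) = un (Word (X # Xs))"
  "un' (Tens (Leaf X) (Word Xs)) = un' (Word (X # Xs))"
proof -
  have "nten (nidm X) (nlu (M.tnl Xs)) \<diamondop> nas X \<I> (M.tnl Xs) \<diamondop> nten (nru' X) (nidm (M.tnl Xs)) = nidm (X \<otimes>\<^sub>o M.tnl Xs)"
    by (simp add: M.reassoc[OF M.triangle] M.ten_cmp)
  then show 1: "un (Tens (Leaf X) (Word Xs)) = un (Word (X # Xs))" by (simp add: M.cmp_assoc)
  have "un' (Tens (Leaf X) (Word Xs)) = un' (Tens (Leaf X) (Word Xs)) \<diamondop> un (Tens (Leaf X) (Word Xs))"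
    unfolding 1 by (simp add: M.cmp_assoc del: un.simps(3))
  also have "\<dots> = nidm (obj (Tens (Leaf X) (Word Xs)))" by (rule un_un')
  finally show "un' (Tens (Leaf X) (Word Xs)) = un' (Word (X # Xs))" by (simp add: tnl_eq)
qed

text \<open>Different terms may denote literally the same object with the same flattening, and
  \<open>L\<close> does not distinguish them. This reconciles the recursion of the tensor powers
  with \<open>Word\<close>.\<close>

definition same :: "'a texp \<Rightarrow> 'a texp \<Rightarrow> bool" where
  "same a b \<longleftrightarrow> flat a = flat b \<and> un a = un b \<and> un' a = un' b \<and> obj a = obj b"

lemma same_refl [simp]: "same a a" by (simp add: same_def)

lemma same_Tens: "same a a' \<Longrightarrow> same b b' \<Longrightarrow> same (Tens a b) (Tens a' b')"
  by (simp add: same_def)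

lemma same_Cons [simp]: "same (Tens (Leaf X) (Word Xs)) (Word (X # Xs))"
  using un_Cons[of X Xs] by (simp add: same_def)

lemma L_same: "same a a' \<Longrightarrow> same b b' \<Longrightarrow> L a b f = L a' b' f"
  by (simp add: same_def L_def)

end

context rat_tensor_category
begin

lemmas hom_intros = Comp_in Tensor_in Id_in Assoc_in inv_Assoc_in Lunit_in Runit_in Symm_in Ev_in Scale_in

lemma tensor_list_pw [simp]: "tensor_list C (pw [X] n) = tensor_pow C X n"
  by (induction n) auto

lemma tensor_list_pw_append [simp]: "tensor_list C (pw [X] m @ pw [X] n) = tensor_pow C X (m + n)"
  by (metis pw_add tensor_list_pw)

lemma interchange_in:
  "interchange C A B A' B' \<in> Hom C ((A \<otimes>\<^sub>o B) \<otimes>\<^sub>o (A' \<otimes>\<^sub>o B')) ((A \<otimes>\<^sub>o A') \<otimes>\<^sub>o (B \<otimes>\<^sub>o B'))"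
  unfolding interchange_def by (rule hom_intros)+

lemma L_interchange:
  "L (Tens (Tens a b) (Tens a' b')) (Tens (Tens a a') (Tens b b')) (interchange C (obj a) (obj b) (obj a') (obj b'))
    = M.swh (flat a) (M.ssym (flat b) (flat a')) (flat b')"
proof -
  let ?A = "obj a" and ?B = "obj b" and ?A' = "obj a'" and ?B' = "obj b'"
  let ?i = "Assoc C ?A' ?B ?B' \<cdot> (\<tau> ?B ?A' \<otimes>\<^sub>m \<^bold>1 ?B') \<cdot> inv_Assoc C ?B ?A' ?B'"
  have i_in: "?i \<in> Hom C (obj (Tens b (Tens a' b'))) (obj (Tens a' (Tens b b')))"
    unfolding obj.simps by (rule hom_intros)+
  have i: "L (Tens b (Tens a' b')) (Tens a' (Tens b b')) ?i = M.swh [] (M.ssym (flat b) (flat a')) (flat b')"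
  proof -
    have "L (Tens b (Tens a' b')) (Tens a' (Tens b b')) ?i =
      L (Tens (Tens a' b) b') (Tens a' (Tens b b')) (Assoc C ?A' ?B ?B') \<bullet>
      L (Tens b (Tens a' b')) (Tens (Tens a' b) b') ((\<tau> ?B ?A' \<otimes>\<^sub>m \<^bold>1 ?B') \<cdot> inv_Assoc C ?B ?A' ?B')"
      by (rule L_cmp) (unfold obj.simps, (rule hom_intros)+)
    also have "L (Tens b (Tens a' b')) (Tens (Tens a' b) b') ((\<tau> ?B ?A' \<otimes>\<^sub>m \<^bold>1 ?B') \<cdot> inv_Assoc C ?B ?A' ?B') =
      L (Tens (Tens b a') b') (Tens (Tens a' b) b') (\<tau> ?B ?A' \<otimes>\<^sub>m \<^bold>1 ?B') \<bullet>
      L (Tens b (Tens a' b')) (Tens (Tens b a') b') (inv_Assoc C ?B ?A' ?B')"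
      by (rule L_cmp) (unfold obj.simps, (rule hom_intros)+)
    also have "L (Tens (Tens b a') b') (Tens (Tens a' b) b') (\<tau> ?B ?A' \<otimes>\<^sub>m \<^bold>1 ?B') = M.swh [] (M.ssym (flat b) (flat a')) (flat b')"
      using L_Tensor_Id(1)[of "\<tau> ?B ?A'" "Tens b a'" "Tens a' b" b'] Symm_in by simp
    finally show ?thesis by simp
  qed
  have "L (Tens (Tens a b) (Tens a' b')) (Tens (Tens a a') (Tens b b')) (interchange C ?A ?B ?A' ?B') =
     L (Tens a (Tens a' (Tens b b'))) (Tens (Tens a a') (Tens b b')) (inv_Assoc C ?A ?A' (?B \<otimes>\<^sub>o ?B')) \<bullet>
     L (Tens (Tens a b) (Tens a' b')) (Tens a (Tens a' (Tens b b'))) ((\<^bold>1 ?A \<otimes>\<^sub>m ?i) \<cdot> Assoc C ?A ?B (?A' \<otimes>\<^sub>o ?B'))"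
    unfolding interchange_def by (rule L_cmp) (unfold obj.simps, (rule hom_intros)+)
  also have "L (Tens (Tens a b) (Tens a' b')) (Tens a (Tens a' (Tens b b'))) ((\<^bold>1 ?A \<otimes>\<^sub>m ?i) \<cdot> Assoc C ?A ?B (?A' \<otimes>\<^sub>o ?B')) =
     L (Tens a (Tens b (Tens a' b'))) (Tens a (Tens a' (Tens b b'))) (\<^bold>1 ?A \<otimes>\<^sub>m ?i) \<bullet>
     L (Tens (Tens a b) (Tens a' b')) (Tens a (Tens b (Tens a' b'))) (Assoc C ?A ?B (?A' \<otimes>\<^sub>o ?B'))"
    by (rule L_cmp) (unfold obj.simps, (rule hom_intros)+)
  also have "L (Tens a (Tens b (Tens a' b'))) (Tens a (Tens a' (Tens b b'))) (\<^bold>1 ?A \<otimes>\<^sub>m ?i) =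
      M.swh (flat a) (M.ssym (flat b) (flat a')) (flat b')"
    unfolding L_Tensor_Id(2)[OF i_in] i by simp
  finally show ?thesis
    using L_inv_Assoc[of a a' "Tens b b'"] L_Assoc[of a b "Tens a' b'"] by simp
qed

lemma join_mor: "tensor_pow_join C X m n \<in> Hom C (tensor_pow C X m \<otimes>\<^sub>o tensor_pow C X n) (tensor_pow C X (m + n))
    \<and> M.jn (pw [X] m) (pw [X] n) = Some (tensor_pow C X m \<otimes>\<^sub>o tensor_pow C X n, tensor_pow_join C X m n, tensor_pow C X (m + n))"
proof (induction m)
  case 0
  then show ?case by (simp add: tnl_eq) (simp add: nlu_def Lunit_in)
next
  case (Suc m)
  have 1: "(\<^bold>1 X \<otimes>\<^sub>m tensor_pow_join C X m n) \<in> Hom C (X \<otimes>\<^sub>o (tensor_pow C X m \<otimes>\<^sub>o tensor_pow C X n)) (X \<otimes>\<^sub>o tensor_pow C X (m + n))"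
    by (rule Tensor_in[OF Id_in]) (use Suc in simp)
  have 2: "Assoc C X (tensor_pow C X m) (tensor_pow C X n) \<in> Hom C ((X \<otimes>\<^sub>o tensor_pow C X m) \<otimes>\<^sub>o tensor_pow C X n)
     (X \<otimes>\<^sub>o (tensor_pow C X m \<otimes>\<^sub>o tensor_pow C X n))" by (rule Assoc_in)
  have "M.jn (pw [X] (Suc m)) (pw [X] n) = nten (nidm X) (Some (tensor_pow C X m \<otimes>\<^sub>o tensor_pow C X n,
      tensor_pow_join C X m n, tensor_pow C X (m + n))) \<diamondop> nas X (tensor_pow C X m) (tensor_pow C X n)"
    using Suc by (simp add: tnl_eq)
  also have "\<dots> = Some ((X \<otimes>\<^sub>o tensor_pow C X m) \<otimes>\<^sub>o tensor_pow C X n,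
     (\<^bold>1 X \<otimes>\<^sub>m tensor_pow_join C X m n) \<cdot> Assoc C X (tensor_pow C X m) (tensor_pow C X n), X \<otimes>\<^sub>o tensor_pow C X (m + n))"
    using ncmp_Some[OF 2 1] by (simp add: nidm_def nas_def)
  finally show ?case using Comp_in[OF 2 1] by simp
qed

lemma join_in: "tensor_pow_join C X m n \<in> Hom C (tensor_pow C X m \<otimes>\<^sub>o tensor_pow C X n) (tensor_pow C X (m + n))"
  using join_mor by blast

lemma L_join: "L (Tens (Word (pw [X] m)) (Word (pw [X] n))) (Word (pw [X] (m + n))) (tensor_pow_join C X m n) =
    M.sidm (pw [X] m @ pw [X] n)"
proof -
  have 1: "Some (tensor_pow C X m \<otimes>\<^sub>o tensor_pow C X n, tensor_pow_join C X m n, tensor_pow C X (m + n)) = M.jn (pw [X] m) (pw [X] n)"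
    using join_mor by simp
  have 2: "nten (nidm (M.tnl (pw [X] m))) (nidm (M.tnl (pw [X] n))) \<diamondop> M.jn' (pw [X] m) (pw [X] n) = M.jn' (pw [X] m) (pw [X] n)"
    by simp
  show ?thesis
    using M.jn_jn'[of "pw [X] m" "pw [X] n"] by (simp add: L_def 1 pw_add M.sidm_def)
qed

lemma join_iso: "is_isomorphism C (tensor_pow C X m \<otimes>\<^sub>o tensor_pow C X n) (tensor_pow C X (m + n)) (tensor_pow_join C X m n)"
  using L_iso[of "Tens (Word (pw [X] m)) (Word (pw [X] n))" "Word (pw [X] (m + n))" "tensor_pow_join C X m n"] join_in L_join
  by simp

lemma inv_join_in: "iso_inv C (tensor_pow C X m \<otimes>\<^sub>o tensor_pow C X n) (tensor_pow C X (m + n)) (tensor_pow_join C X m n)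
    \<in> Hom C (tensor_pow C X (m + n)) (tensor_pow C X m \<otimes>\<^sub>o tensor_pow C X n)"
  using iso_inv[OF join_iso] by (auto simp: is_inverse_def)

lemma L_inv_join: "L (Word (pw [X] (m + n))) (Tens (Word (pw [X] m)) (Word (pw [X] n)))
   (iso_inv C (tensor_pow C X m \<otimes>\<^sub>o tensor_pow C X n) (tensor_pow C X (m + n)) (tensor_pow_join C X m n)) =
    M.sidm (pw [X] (m + n))"
proof -
  have "L (Word (pw [X] (m + n))) (Tens (Word (pw [X] m)) (Word (pw [X] n)))
   (iso_inv C (tensor_pow C X m \<otimes>\<^sub>o tensor_pow C X n) (tensor_pow C X (m + n)) (tensor_pow_join C X m n)) =
    M.sidm (flat (Word (pw [X] (m + n))))"
    by (rule L_inverse_id[where f = "tensor_pow_join C X m n"])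
      (simp_all add: iso_inv[OF join_iso] L_join[unfolded pw_add] pw_add)
  then show ?thesis by simp
qed

lemma swap_first_in: "swap_first C X n \<in> Hom C (tensor_pow C X (Suc (Suc n))) (tensor_pow C X (Suc (Suc n)))"
  unfolding swap_first_def tensor_pow.simps by (rule hom_intros)+

lemma same_Cons2: "same (Tens (Leaf X) (Tens (Leaf Y) (Word Xs))) (Word (X # Y # Xs))"
proof -
  have "same (Tens (Leaf X) (Tens (Leaf Y) (Word Xs))) (Tens (Leaf X) (Word (Y # Xs)))"
    by (intro same_Tens) auto
  then show ?thesis using same_Cons[of X "Y # Xs"] unfolding same_def by metis
qed

lemma L_swap_first:
  "L (Word (pw [X] (Suc (Suc n)))) (Word (pw [X] (Suc (Suc n)))) (swap_first C X n) = M.swh [] (M.ssym [X] [X]) (pw [X] n)"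
proof -
  let ?x = "Leaf X" and ?w = "Word (pw [X] n)"
  have "L (Tens ?x (Tens ?x ?w)) (Tens ?x (Tens ?x ?w)) (swap_first C X n) =
     L (Tens (Tens ?x ?x) ?w) (Tens ?x (Tens ?x ?w)) (Assoc C X X (tensor_pow C X n)) \<bullet>
     L (Tens ?x (Tens ?x ?w)) (Tens (Tens ?x ?x) ?w) ((\<tau> X X \<otimes>\<^sub>m \<^bold>1 (tensor_pow C X n)) \<cdot> inv_Assoc C X X (tensor_pow C X n))"
    unfolding swap_first_def by (rule L_cmp) (unfold obj.simps tensor_list_pw, (rule hom_intros)+)
  also have "L (Tens ?x (Tens ?x ?w)) (Tens (Tens ?x ?x) ?w) ((\<tau> X X \<otimes>\<^sub>m \<^bold>1 (tensor_pow C X n)) \<cdot> inv_Assoc C X X (tensor_pow C X n)) =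
     L (Tens (Tens ?x ?x) ?w) (Tens (Tens ?x ?x) ?w) (\<tau> X X \<otimes>\<^sub>m \<^bold>1 (tensor_pow C X n)) \<bullet>
     L (Tens ?x (Tens ?x ?w)) (Tens (Tens ?x ?x) ?w) (inv_Assoc C X X (tensor_pow C X n))"
    by (rule L_cmp) (unfold obj.simps tensor_list_pw, (rule hom_intros)+)
  also have "L (Tens (Tens ?x ?x) ?w) (Tens (Tens ?x ?x) ?w) (\<tau> X X \<otimes>\<^sub>m \<^bold>1 (tensor_pow C X n)) = M.swh [] (M.ssym [X] [X]) (pw [X] n)"
    using L_Tensor_Id(1)[of "\<tau> X X" "Tens ?x ?x" "Tens ?x ?x" ?w] Symm_in L_Symm[of ?x ?x] by simp
  finally have "L (Tens ?x (Tens ?x ?w)) (Tens ?x (Tens ?x ?w)) (swap_first C X n) = M.swh [] (M.ssym [X] [X]) (pw [X] n)"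
    using L_Assoc[of ?x ?x ?w] L_inv_Assoc[of ?x ?x ?w] by simp
  then show ?thesis
    using L_same[OF same_Cons2 same_Cons2] by simp
qed

lemma move_first_in: "k \<le> n \<Longrightarrow> move_first C X k n \<in> Hom C (tensor_pow C X (Suc n)) (tensor_pow C X (Suc n))"
proof (induction k arbitrary: n)
  case 0
  then show ?case using Id_in[of "tensor_pow C X (Suc n)"] by simp
next
  case (Suc k)
  then obtain m where m: "n = Suc m" by (cases n) auto
  have "(\<^bold>1 X \<otimes>\<^sub>m move_first C X k m) \<in> Hom C (tensor_pow C X (Suc (Suc m))) (tensor_pow C X (Suc (Suc m)))"
    using Suc.IH[of m] Suc.prems m unfolding tensor_pow.simps by (intro Tensor_in[OF Id_in]) auto
  then show ?case using Comp_in[OF swap_first_in] m by simp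
qed

end

section \<open>The symmetrizer as an average over permutations\<close>

definition perm_tail :: "(nat \<Rightarrow> nat) \<Rightarrow> nat \<Rightarrow> nat" where
  "perm_tail \<sigma> = (\<lambda>k. if \<sigma> (Suc k) > \<sigma> 0 then \<sigma> (Suc k) - 1 else \<sigma> (Suc k))"

text \<open>Rebuilds a permutation from the image \<open>k\<close> of 0 and the order of the
  remaining values; the values from \<open>k\<close> on are shifted up to make room. It inverts the
  relabelling in the definition of \<open>perm_action\<close>.\<close>

definition perm_cons :: "nat \<Rightarrow> (nat \<Rightarrow> nat) \<Rightarrow> nat \<Rightarrow> nat" where
  "perm_cons k \<pi> = case_nat k (\<lambda>j. if \<pi> j \<ge> k then Suc (\<pi> j) else \<pi> j)"

lemma perm_tail_cons [simp]: "perm_tail (perm_cons k \<pi>) = \<pi>"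
  by (auto simp: perm_tail_def perm_cons_def)

lemma perm_cons_0 [simp]: "perm_cons k \<pi> 0 = k"
  by (simp add: perm_cons_def)

lemma perm_cons_tail:
  assumes "inj \<sigma>"
  shows "perm_cons (\<sigma> 0) (perm_tail \<sigma>) = \<sigma>"
proof
  fix j show "perm_cons (\<sigma> 0) (perm_tail \<sigma>) j = \<sigma> j"
  proof (cases j)
    case (Suc i)
    have "\<sigma> (Suc i) \<noteq> \<sigma> 0" using assms by (metis injD nat.distinct(1))
    then show ?thesis using Suc by (auto simp: perm_cons_def perm_tail_def)
  qed (simp add: perm_cons_def)
qed

lemma permutes_finiteI:
  assumes "finite S" "inj_on f S" "\<And>x. x \<in> S \<Longrightarrow> f x \<in> S" "\<And>x. x \<notin> S \<Longrightarrow> f x = x"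
  shows "f permutes S"
  by (rule bij_imp_permutes) (use assms endo_inj_surj[of S f] in \<open>auto simp: bij_betw_def\<close>)

lemma perm_cons_permutes:
  assumes k: "k \<le> n" and p: "\<pi> permutes {..<n}"
  shows "perm_cons k \<pi> permutes {..<Suc n}"
proof (rule permutes_finiteI)
  have inj: "inj \<pi>" using p by (rule permutes_inj)
  show "inj_on (perm_cons k \<pi>) {..<Suc n}"
  proof (rule inj_onI)
    fix x y assume e: "perm_cons k \<pi> x = perm_cons k \<pi> y"
    show "x = y"
      using e inj_eq[OF inj] by (cases x; cases y) (auto simp: perm_cons_def split: if_splits)
  qed
  fix x assume "x \<in> {..<Suc n}"
  then show "perm_cons k \<pi> x \<in> {..<Suc n}"
    using k permutes_in_image[OF p] by (auto simp: perm_cons_def split: nat.splits)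
next
  fix x assume x: "x \<notin> {..<Suc n}"
  then obtain y where "x = Suc y" "y \<ge> n" by (cases x) auto
  then show "perm_cons k \<pi> x = x"
    using permutes_not_in[OF p, of y] k by (auto simp: perm_cons_def)
qed auto

lemma perm_tail_permutes:
  assumes p: "\<sigma> permutes {..<Suc n}"
  shows "perm_tail \<sigma> permutes {..<n}"
proof (rule permutes_finiteI)
  have inj: "inj \<sigma>" using p by (rule permutes_inj)
  have ne: "\<sigma> (Suc i) \<noteq> \<sigma> 0" for i using inj by (metis injD nat.distinct(1))
  have s0: "\<sigma> 0 \<le> n" using permutes_in_image[OF p, of 0] by simp
  have inj': "\<sigma> (Suc i) = \<sigma> (Suc j) \<Longrightarrow> i = j" for i j using inj by (metis injD nat.inject)
  show "inj_on (perm_tail \<sigma>) {..<n}"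
  proof (rule inj_onI)
    fix x y assume "perm_tail \<sigma> x = perm_tail \<sigma> y"
    then have "\<sigma> (Suc x) = \<sigma> (Suc y)"
      using ne[of x] ne[of y] by (auto simp: perm_tail_def split: if_splits)
    then show "x = y" by (rule inj')
  qed
  fix x assume "x \<in> {..<n}"
  then have "\<sigma> (Suc x) \<le> n" using permutes_in_image[OF p, of "Suc x"] by simp
  then show "perm_tail \<sigma> x \<in> {..<n}" using s0 ne[of x] by (auto simp: perm_tail_def)
next
  fix x assume "x \<notin> {..<n}"
  then have "\<sigma> (Suc x) = Suc x" "\<sigma> 0 \<le> n"
    using permutes_not_in[OF p, of "Suc x"] permutes_in_image[OF p, of 0] by auto
  then show "perm_tail \<sigma> x = x" using \<open>x \<notin> {..<n}\<close> by (auto simp: perm_tail_def)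
qed auto

text \<open>The permutations are sorted by the image of 0, which gives the coset decomposition
  behind the recursion of \<open>symmer\<close>.\<close>

lemma permutations_Suc:
  "{\<sigma>. \<sigma> permutes {..<Suc n}} = (\<Union>k\<in>{..n}. perm_cons k ` {\<pi>. \<pi> permutes {..<n}})"
proof (intro equalityI subsetI)
  fix \<sigma> assume "\<sigma> \<in> {\<sigma>. \<sigma> permutes {..<Suc n}}"
  then have p: "\<sigma> permutes {..<Suc n}" by simp
  have "\<sigma> = perm_cons (\<sigma> 0) (perm_tail \<sigma>)" using perm_cons_tail[OF permutes_inj[OF p]] by simp
  moreover have "\<sigma> 0 \<le> n" using permutes_in_image[OF p, of 0] by simp
  ultimately show "\<sigma> \<in> (\<Union>k\<in>{..n}. perm_cons k ` {\<pi>. \<pi> permutes {..<n}})"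
    using perm_tail_permutes[OF p] by blast
qed (auto intro: perm_cons_permutes)

context rat_tensor_category
begin

lemma perm_action_Suc: "perm_action C X (Suc n) \<sigma> = move_first C X (\<sigma> 0) n \<cdot> (\<^bold>1 X \<otimes>\<^sub>m perm_action C X n (perm_tail \<sigma>))"
  by (simp add: perm_tail_def)

lemma perm_action_in: "\<sigma> permutes {..<n} \<Longrightarrow> perm_action C X n \<sigma> \<in> Hom C (tensor_pow C X n) (tensor_pow C X n)"
proof (induction n arbitrary: \<sigma>)
  case 0
  then show ?case by (simp add: Id_in)
next
  case (Suc n)
  have "\<sigma> 0 \<le> n" using permutes_in_image[OF Suc.prems, of 0] by simp
  then show ?case
    unfolding perm_action_Suc
    using Comp_in[OF Tensor_in[OF Id_in Suc.IH[OF perm_tail_permutes[OF Suc.prems]]] move_first_in[unfolded tensor_pow.simps]]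
    by simp
qed

abbreviation hsum :: "'a \<Rightarrow> 'a \<Rightarrow> ('i \<Rightarrow> 'b) \<Rightarrow> 'i set \<Rightarrow> 'b" where
  "hsum X Y f A \<equiv> finsum (hom_module C X Y) f A"

lemma hom_monoid: "abelian_monoid (hom_module C X Y)"
  using Hom_abelian_group by (rule abelian_group.axioms(1))

lemma hsum_in: "(\<And>a. a \<in> A \<Longrightarrow> f a \<in> Hom C X Y) \<Longrightarrow> hsum X Y f A \<in> Hom C X Y"
  using abelian_monoid.finsum_closed[OF hom_monoid, of f A X Y] by auto

lemma Comp_Zero: "g \<in> Hom C Y Z \<Longrightarrow> g \<cdot> Zero C X Y = Zero C X Z"
  using Comp_Scale[OF Zero_in[of X Y], of g Z 0] Scale_0 Zero_in Comp_in by metis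

lemma Zero_Comp: "f \<in> Hom C X Y \<Longrightarrow> Zero C Y Z \<cdot> f = Zero C X Z"
  using Scale_Comp[OF _ Zero_in[of Y Z], of f X 0] Scale_0 Zero_in Comp_in by metis

lemma Tensor_Zero: "g \<in> Hom C X' Y' \<Longrightarrow> g \<otimes>\<^sub>m Zero C X Y = Zero C (X' \<otimes>\<^sub>o X) (Y' \<otimes>\<^sub>o Y)"
  using Tensor_Scale_right[OF Zero_in[of X Y], of g X' Y' 0] Scale_0 Zero_in Tensor_in by metis

lemma hsum_additive:
  assumes "finite A" "\<And>a. a \<in> A \<Longrightarrow> f a \<in> Hom C X Y"
    and cl: "\<And>x. x \<in> Hom C X Y \<Longrightarrow> F x \<in> Hom C X' Y'"
    and z: "F (Zero C X Y) = Zero C X' Y'"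
    and ad: "\<And>x y. x \<in> Hom C X Y \<Longrightarrow> y \<in> Hom C X Y \<Longrightarrow> F (x \<^bold>+ y) = F x \<^bold>+ F y"
  shows "F (hsum X Y f A) = hsum X' Y' (\<lambda>a. F (f a)) A"
  using assms(1,2)
proof (induction A rule: finite_induct)
  case empty
  then show ?case
    using z by (simp add: abelian_monoid.finsum_empty[OF hom_monoid])
next
  case (insert a A)
  have "hsum X Y f (insert a A) = f a \<^bold>+ hsum X Y f A"
    using insert abelian_monoid.finsum_insert[OF hom_monoid, of A a f X Y] by auto
  moreover have "hsum X' Y' (\<lambda>a. F (f a)) (insert a A) = F (f a) \<^bold>+ hsum X' Y' (\<lambda>a. F (f a)) A"
    using insert cl abelian_monoid.finsum_insert[OF hom_monoid, of A a "\<lambda>a. F (f a)" X' Y'] by auto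
  ultimately show ?case using insert ad hsum_in[of A f X Y] by auto
qed

end

context rat_tensor_category
begin

abbreviation Pw :: "'a \<Rightarrow> nat \<Rightarrow> 'a texp" where "Pw X n \<equiv> Word (pw [X] n)"

abbreviation (input) psum :: "'a \<Rightarrow> nat \<Rightarrow> 'b" where
  "psum X n \<equiv> hsum (tensor_pow C X n) (tensor_pow C X n) (perm_action C X n) {\<sigma>. \<sigma> permutes {..<n}}"

abbreviation (input) msum :: "'a \<Rightarrow> nat \<Rightarrow> 'b" where
  "msum X n \<equiv> hsum (tensor_pow C X (Suc n)) (tensor_pow C X (Suc n)) (\<lambda>k. move_first C X k n) {..n}"

lemma finite_perms: "finite {\<sigma>. \<sigma> permutes {..<n::nat}}"
  by (rule finite_permutations) simp

lemma psum_in: "psum X n \<in> Hom C (tensor_pow C X n) (tensor_pow C X n)"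
  by (rule hsum_in) (auto intro: perm_action_in)

lemma msum_in: "msum X n \<in> Hom C (tensor_pow C X (Suc n)) (tensor_pow C X (Suc n))"
  by (rule hsum_in) (auto intro: move_first_in simp del: tensor_pow.simps)

text \<open>The action of a permutation is a factor depending on the image of 0 only, after a factor
  depending on its tail only. The double sum therefore becomes a composite of two sums.\<close>

lemma psum_Suc: "psum X (Suc n) = msum X n \<cdot> (\<^bold>1 X \<otimes>\<^sub>m psum X n)"
proof -
  let ?T = "tensor_pow C X (Suc n)" and ?t = "tensor_pow C X n"
  let ?P = "{\<pi>. \<pi> permutes {..<n}}"
  let ?f = "perm_action C X (Suc n)"
  have disj: "pairwise (\<lambda>i j. disjnt (perm_cons i ` ?P) (perm_cons j ` ?P)) {..n}"
    unfolding pairwise_def disjnt_def by (auto) (metis perm_cons_0)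
  have cl: "?f \<sigma> \<in> Hom C ?T ?T" if "k \<in> {..n}" "\<sigma> \<in> perm_cons k ` ?P" for k \<sigma>
    using that perm_action_in[OF perm_cons_permutes] by auto
  have pa: "?f (perm_cons k \<pi>) = move_first C X k n \<cdot> (\<^bold>1 X \<otimes>\<^sub>m perm_action C X n \<pi>)" for k \<pi>
    unfolding perm_action_Suc by simp
  have in1: "(\<^bold>1 X \<otimes>\<^sub>m y) \<in> Hom C ?T ?T" if "y \<in> Hom C ?t ?t" for y
    using Tensor_in[OF Id_in that] by simp
  have "psum X (Suc n) = hsum ?T ?T (\<lambda>k. hsum ?T ?T ?f (perm_cons k ` ?P)) {..n}"
    unfolding permutations_Suc finsum_def
    by (rule comm_monoid.finprod_UN_disjoint[OF abelian_monoid.a_comm_monoid[OF hom_monoid]])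
      (use disj cl finite_perms in auto)
  also have "\<dots> = hsum ?T ?T (\<lambda>k. hsum ?T ?T (\<lambda>\<pi>. move_first C X k n \<cdot> (\<^bold>1 X \<otimes>\<^sub>m perm_action C X n \<pi>)) ?P) {..n}"
  proof (rule abelian_monoid.finsum_cong'[OF hom_monoid refl])
    show "(\<lambda>k. hsum ?T ?T (\<lambda>\<pi>. move_first C X k n \<cdot> (\<^bold>1 X \<otimes>\<^sub>m perm_action C X n \<pi>)) ?P) \<in> {..n} \<rightarrow> carrier (hom_module C ?T ?T)"
      by (auto intro!: hsum_in Comp_in[OF in1[OF perm_action_in] move_first_in] simp del: tensor_pow.simps)
    fix k assume k: "k \<in> {..n}"
    have "inj_on (perm_cons k) ?P" by (rule inj_on_inverseI[of _ perm_tail]) simp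
    moreover have "?f \<in> perm_cons k ` ?P \<rightarrow> carrier (hom_module C ?T ?T)"
      using cl[OF k] by (auto simp del: tensor_pow.simps perm_action.simps)
    ultimately show "hsum ?T ?T ?f (perm_cons k ` ?P) = hsum ?T ?T (\<lambda>\<pi>. move_first C X k n \<cdot> (\<^bold>1 X \<otimes>\<^sub>m perm_action C X n \<pi>)) ?P"
      using abelian_monoid.finsum_reindex[OF hom_monoid, of ?f "perm_cons k" ?P] unfolding pa by blast
  qed
  also have "\<dots> = hsum ?T ?T (\<lambda>k. move_first C X k n \<cdot> (\<^bold>1 X \<otimes>\<^sub>m psum X n)) {..n}"
  proof (rule abelian_monoid.finsum_cong'[OF hom_monoid refl])
    show "(\<lambda>k. move_first C X k n \<cdot> (\<^bold>1 X \<otimes>\<^sub>m psum X n)) \<in> {..n} \<rightarrow> carrier (hom_module C ?T ?T)"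
      using Comp_in[OF in1[OF psum_in] move_first_in] by (auto simp del: tensor_pow.simps)
    fix k assume "k \<in> {..n}"
    then have k: "k \<le> n" by simp
    have m: "move_first C X k n \<in> Hom C ?T ?T" by (rule move_first_in[OF k])
    show "hsum ?T ?T (\<lambda>\<pi>. move_first C X k n \<cdot> (\<^bold>1 X \<otimes>\<^sub>m perm_action C X n \<pi>)) ?P = move_first C X k n \<cdot> (\<^bold>1 X \<otimes>\<^sub>m psum X n)"
    proof (rule hsum_additive[symmetric, where F = "\<lambda>y. move_first C X k n \<cdot> (\<^bold>1 X \<otimes>\<^sub>m y)"])
      show "move_first C X k n \<cdot> (\<^bold>1 X \<otimes>\<^sub>m Zero C ?t ?t) = Zero C ?T ?T"
        using Comp_Zero[OF m] by (simp add: Tensor_Zero[OF Id_in])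
      show "move_first C X k n \<cdot> (\<^bold>1 X \<otimes>\<^sub>m (x \<^bold>+ y)) =
        move_first C X k n \<cdot> (\<^bold>1 X \<otimes>\<^sub>m x) \<^bold>+ move_first C X k n \<cdot> (\<^bold>1 X \<otimes>\<^sub>m y)"
        if "x \<in> Hom C ?t ?t" "y \<in> Hom C ?t ?t" for x y
        using that Comp_Add[OF in1 in1 m] by (simp add: Tensor_Add_right[OF _ _ Id_in])
    qed (use finite_perms perm_action_in Comp_in[OF in1 m] in \<open>auto simp del: tensor_pow.simps\<close>)
  qed
  also have "\<dots> = msum X n \<cdot> (\<^bold>1 X \<otimes>\<^sub>m psum X n)"
  proof (rule hsum_additive[symmetric, where F = "\<lambda>y. y \<cdot> (\<^bold>1 X \<otimes>\<^sub>m psum X n)"])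
    show "Zero C ?T ?T \<cdot> (\<^bold>1 X \<otimes>\<^sub>m psum X n) = Zero C ?T ?T"
      by (rule Zero_Comp[OF in1[OF psum_in]])
    show "(x \<^bold>+ y) \<cdot> (\<^bold>1 X \<otimes>\<^sub>m psum X n) = x \<cdot> (\<^bold>1 X \<otimes>\<^sub>m psum X n) \<^bold>+ y \<cdot> (\<^bold>1 X \<otimes>\<^sub>m psum X n)"
      if "x \<in> Hom C ?T ?T" "y \<in> Hom C ?T ?T" for x y
      by (rule Add_Comp[OF in1[OF psum_in] that])
  qed (use move_first_in Comp_in[OF in1[OF psum_in]] in \<open>auto simp del: tensor_pow.simps\<close>)
  finally show ?thesis .
qed

lemma obj_Pw: "obj (Pw X n) = tensor_pow C X n" by simp

lemma L_Id_Tensor_Pw: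
  assumes "f \<in> Hom C (tensor_pow C X m) (tensor_pow C X n)"
  shows "L (Pw X (Suc m)) (Pw X (Suc n)) (\<^bold>1 X \<otimes>\<^sub>m f) = M.swh [X] (L (Pw X m) (Pw X n) f) []"
  using L_Tensor_Id(2)[of f "Pw X m" "Pw X n" "Leaf X"] assms L_same[OF same_Cons same_Cons, of X "pw [X] m" X "pw [X] n"]
  by simp

text \<open>The term for position 0 is the identity; all others begin with the swap of the first two
  factors and continue with a move in the tail. This is the recursion of
  \<open>coset_sum\<close>.\<close>

lemma L_msum: "L (Pw X (Suc n)) (Pw X (Suc n)) (msum X n) = S.coset_sum [X] n"
proof (induction n)
  case 0
  have "msum X 0 = \<^bold>1 (obj (Pw X (Suc 0)))"
    using abelian_monoid.finsum_insert[OF hom_monoid, of "{}" 0 "\<lambda>k. move_first C X k 0" "tensor_pow C X 1" "tensor_pow C X 1"]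
      Add_Zero[OF Id_in] Id_in
    by (simp add: abelian_monoid.finsum_empty[OF hom_monoid])
  then show ?case using L_Id[of "Pw X (Suc 0)"] by simp
next
  case (Suc n)
  let ?T = "tensor_pow C X (Suc n)" and ?TT = "tensor_pow C X (Suc (Suc n))"
  let ?s = "swap_first C X n"
  have in1: "(\<^bold>1 X \<otimes>\<^sub>m y) \<in> Hom C ?TT ?TT" if "y \<in> Hom C ?T ?T" for y
    using Tensor_in[OF Id_in that] by simp
  have in2: "(\<^bold>1 X \<otimes>\<^sub>m y) \<cdot> ?s \<in> Hom C ?TT ?TT" if "y \<in> Hom C ?T ?T" for y
    using Comp_in[OF swap_first_in in1[OF that]] .
  have "msum X (Suc n) = hsum ?TT ?TT (\<lambda>k. move_first C X (Suc k) (Suc n)) {..n} \<^bold>+ move_first C X 0 (Suc n)"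
    using abelian_monoid.finsum_Suc2[OF hom_monoid, of "\<lambda>k. move_first C X k (Suc n)" n ?TT ?TT] move_first_in[of _ "Suc n" X]
    by (simp del: tensor_pow.simps move_first.simps add: Pi_def)
  also have "hsum ?TT ?TT (\<lambda>k. move_first C X (Suc k) (Suc n)) {..n} =
      hsum ?TT ?TT (\<lambda>k. (\<^bold>1 X \<otimes>\<^sub>m move_first C X k n) \<cdot> ?s) {..n}"
    by (simp del: tensor_pow.simps)
  also have "\<dots> = (\<^bold>1 X \<otimes>\<^sub>m msum X n) \<cdot> ?s"
  proof (rule hsum_additive[symmetric, where F = "\<lambda>y. (\<^bold>1 X \<otimes>\<^sub>m y) \<cdot> ?s"])
    show "(\<^bold>1 X \<otimes>\<^sub>m Zero C ?T ?T) \<cdot> ?s = Zero C ?TT ?TT"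
      using Zero_Comp[OF swap_first_in] by (simp add: Tensor_Zero[OF Id_in])
    show "(\<^bold>1 X \<otimes>\<^sub>m (x \<^bold>+ y)) \<cdot> ?s = (\<^bold>1 X \<otimes>\<^sub>m x) \<cdot> ?s \<^bold>+ (\<^bold>1 X \<otimes>\<^sub>m y) \<cdot> ?s"
      if "x \<in> Hom C ?T ?T" "y \<in> Hom C ?T ?T" for x y
      using Add_Comp[OF swap_first_in in1[OF that(1)] in1[OF that(2)]] Tensor_Add_right[OF that Id_in[of X]] by simp
  qed (use move_first_in in2 in \<open>auto simp del: tensor_pow.simps\<close>)
  finally have e: "msum X (Suc n) = (\<^bold>1 X \<otimes>\<^sub>m msum X n) \<cdot> ?s \<^bold>+ \<^bold>1 ?TT" by simp
  have "L (Pw X (Suc (Suc n))) (Pw X (Suc (Suc n))) (msum X (Suc n)) =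
      L (Pw X (Suc (Suc n))) (Pw X (Suc (Suc n))) ((\<^bold>1 X \<otimes>\<^sub>m msum X n) \<cdot> ?s) \<boxplus> L (Pw X (Suc (Suc n))) (Pw X (Suc (Suc n))) (\<^bold>1 ?TT)"
    unfolding e by (rule L_Add) (unfold obj_Pw, rule in2[OF msum_in], rule Id_in)
  also have "L (Pw X (Suc (Suc n))) (Pw X (Suc (Suc n))) (\<^bold>1 ?TT) = M.sidm (pw [X] (Suc (Suc n)))"
    using L_Id[of "Pw X (Suc (Suc n))"] by (simp only: obj_Pw flat.simps)
  also have "L (Pw X (Suc (Suc n))) (Pw X (Suc (Suc n))) ((\<^bold>1 X \<otimes>\<^sub>m msum X n) \<cdot> ?s) =
     M.swh [X] (S.coset_sum [X] n) [] \<bullet> M.swh [] (M.ssym [X] [X]) (pw [X] n)"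
    unfolding Suc.IH[symmetric] L_Id_Tensor_Pw[OF msum_in, symmetric] L_swap_first[symmetric]
    by (rule L_cmp) (unfold obj_Pw, rule swap_first_in, rule in1[OF msum_in])
  also have "M.swh [X] (S.coset_sum [X] n) [] \<bullet> M.swh [] (M.ssym [X] [X]) (pw [X] n) \<boxplus> M.sidm (pw [X] (Suc (Suc n))) =
     S.coset_sum [X] (Suc n)"
    by (subst S.pls_commute) simp_all
  finally show ?case .
qed

lemma L_psum: "L (Pw X n) (Pw X n) (psum X n) = M.sscl (fact n) (S.symmer [X] n)"
proof (induction n)
  case 0
  have "{\<sigma>. \<sigma> permutes {..<0::nat}} = {id}" by auto
  then have p: "psum X 0 = \<^bold>1 (obj (Pw X 0))"
    using abelian_monoid.finsum_insert[OF hom_monoid, of "{}" id "perm_action C X 0" "tensor_pow C X 0" "tensor_pow C X 0"]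
      Add_Zero[OF Id_in] Id_in
    by (simp add: abelian_monoid.finsum_empty[OF hom_monoid])
  have "L (Pw X 0) (Pw X 0) (psum X 0) = M.sidm (flat (Pw X 0))"
    unfolding p by (rule L_Id)
  also have "\<dots> = M.sscl (fact 0) (S.symmer [X] 0)" by simp
  finally show ?case .
next
  case (Suc n)
  have "L (Pw X (Suc n)) (Pw X (Suc n)) (psum X (Suc n)) =
     L (Pw X (Suc n)) (Pw X (Suc n)) (msum X n) \<bullet> L (Pw X (Suc n)) (Pw X (Suc n)) (\<^bold>1 X \<otimes>\<^sub>m psum X n)"
    unfolding psum_Suc
    by (rule L_cmp) (unfold obj_Pw, simp add: Tensor_in[OF Id_in psum_in], rule msum_in)
  also have "\<dots> = S.coset_sum [X] n \<bullet> M.swh [X] (M.sscl (fact n) (S.symmer [X] n)) []"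
    unfolding L_msum L_Id_Tensor_Pw[OF psum_in] Suc.IH ..
  also have "\<dots> = M.sscl (fact (Suc n)) (S.symmer [X] (Suc n))"
    by (simp add: S.wh_scl S.cmp_scl S.scl_scl)
  finally show ?case .
qed

lemma symmetrizer_in: "symmetrizer C X n \<in> Hom C (tensor_pow C X n) (tensor_pow C X n)"
  unfolding symmetrizer_def by (rule Scale_in[OF psum_in])

lemma L_symmetrizer: "L (Pw X n) (Pw X n) (symmetrizer C X n) = S.symmer [X] n"
  unfolding symmetrizer_def using L_Scale[of "psum X n" "Pw X n" "Pw X n" "1 / fact n"] psum_in[of X n]
  by (simp add: L_psum S.scl_scl)

text \<open>Idempotency is proved in the strict category and brought back by injectivity of
  \<open>L\<close>. Only then is the choice in the definition known to yield a splitting.\<close>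

lemma sym_splitting: "is_splitting C (tensor_pow C X n) (symmetrizer C X n) (sym_splitting C X n)"
proof -
  have "symmetrizer C X n \<cdot> symmetrizer C X n = symmetrizer C X n"
  proof (rule L_inj[of _ "Pw X n" "Pw X n"])
    show "L (Pw X n) (Pw X n) (symmetrizer C X n \<cdot> symmetrizer C X n) = L (Pw X n) (Pw X n) (symmetrizer C X n)"
      using L_cmp[of "symmetrizer C X n" "Pw X n" "Pw X n" "symmetrizer C X n" "Pw X n"] symmetrizer_in[of X n]
      by (simp add: L_symmetrizer S.symmer_idem)
  qed (unfold obj_Pw, rule Comp_in[OF symmetrizer_in symmetrizer_in], rule symmetrizer_in)
  then show ?thesis
    unfolding sym_splitting_def by (rule someI_ex[OF idempotent_splits[OF symmetrizer_in]])
qed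

lemma sym_inj_in: "sym_inj C X n \<in> Hom C (sym_pow C X n) (tensor_pow C X n)"
  and sym_proj_in: "sym_proj C X n \<in> Hom C (tensor_pow C X n) (sym_pow C X n)"
  and sym_proj_inj: "sym_proj C X n \<cdot> sym_inj C X n = \<^bold>1 (sym_pow C X n)"
  and sym_inj_proj: "sym_inj C X n \<cdot> sym_proj C X n = symmetrizer C X n"
  using sym_splitting[of X n]
  by (auto simp: is_splitting_def sym_inj_def sym_proj_def sym_pow_def split: prod.splits)

abbreviation Sp :: "'a \<Rightarrow> nat \<Rightarrow> 'a texp" where "Sp X n \<equiv> Leaf (sym_pow C X n)"
definition SP where "SP X n = [sym_pow C X n]"
definition LI where "LI X n = L (Sp X n) (Pw X n) (sym_inj C X n)"
definition LP where "LP X n = L (Pw X n) (Sp X n) (sym_proj C X n)"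

lemma sym_split: "sym_split M.sarr M.ssrc M.stgt M.sidm M.scmp M.swh M.ssym M.spls M.sscl [X] (SP X) (LI X) (LP X)"
proof unfold_locales
  show "M.sarr (LI X n)" "M.ssrc (LI X n) = SP X n" "M.stgt (LI X n) = pw [X] n" for n
    using sym_inj_in[of X n] by (auto simp: LI_def SP_def)
  show "M.sarr (LP X n)" "M.ssrc (LP X n) = pw [X] n" "M.stgt (LP X n) = SP X n" for n
    using sym_proj_in[of X n] by (auto simp: LP_def SP_def)
  show "LP X n \<bullet> LI X n = M.sidm (SP X n)" for n
    using L_cmp[of "sym_inj C X n" "Sp X n" "Pw X n" "sym_proj C X n" "Sp X n"] sym_inj_in[of X n] sym_proj_in[of X n]
      L_Id[of "Sp X n"]
    by (simp add: LI_def LP_def SP_def sym_proj_inj)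
  show "LI X n \<bullet> LP X n = S.symmer [X] n" for n
    using L_cmp[of "sym_proj C X n" "Pw X n" "Sp X n" "sym_inj C X n" "Pw X n"] sym_inj_in[of X n] sym_proj_in[of X n]
    by (simp add: LI_def LP_def sym_inj_proj L_symmetrizer)
qed

section \<open>Internal homs and the map \<alpha> in the strict category\<close>

lemma curry_mor: 
  assumes "f \<in> Hom C (Z \<otimes>\<^sub>o X) Y"
  shows "curry_mor C Z X Y f \<in> Hom C Z (IHom C X Y)" "Ev C X Y \<cdot> (curry_mor C Z X Y f \<otimes>\<^sub>m \<^bold>1 X) = f"
  using theI'[OF Ev_universal[OF assms]] unfolding curry_mor_def by blast+

text \<open>Indexed by terms: compound arguments of the internal hom are flattened to their factors,
  while the hom object itself remains one letter.\<close>

definition evS :: "'a texp \<Rightarrow> 'a texp \<Rightarrow> 'a list \<times> ('a \<times> 'b \<times> 'a) option \<times> 'a list" where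
  "evS x y = L (Tens (Leaf (IHom C (obj x) (obj y))) x) y (Ev C (obj x) (obj y))"

lemma L_Ev:
  assumes "h \<in> Hom C (obj z) (IHom C (obj x) (obj y))"
  shows "L (Tens z x) y (Ev C (obj x) (obj y) \<cdot> (h \<otimes>\<^sub>m \<^bold>1 (obj x))) =
    evS x y \<bullet> M.swh [] (L z (Leaf (IHom C (obj x) (obj y))) h) (flat x)"
  using L_cmp[of "h \<otimes>\<^sub>m \<^bold>1 (obj x)" "Tens z x" "Tens (Leaf (IHom C (obj x) (obj y))) x" "Ev C (obj x) (obj y)" y]
    L_Tensor_Id(1)[of h z "Leaf (IHom C (obj x) (obj y))" x] assms Tensor_in[OF assms Id_in[of "obj x"]] Ev_in[of "obj x" "obj y"]
  by (simp add: evS_def)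

text \<open>Every word is the flattening of a term, so the universal property in the given category
  covers all sources in the strict one.\<close>

lemma universal_evS: "S.universal [IHom C (obj x) (obj y)] (flat x) (flat y) (evS x y)"
  unfolding S.universal_def
proof (intro conjI allI impI)
  let ?K = "IHom C (obj x) (obj y)"
  show "M.sarr (evS x y)" "M.ssrc (evS x y) = [?K] @ flat x" "M.stgt (evS x y) = flat y"
    using Ev_in[of "obj x" "obj y"] by (auto simp: evS_def)
  fix X t assume "M.sarr t \<and> M.ssrc t = X @ flat x \<and> M.stgt t = flat y"
  then obtain f where f: "f \<in> Hom C (obj (Tens (Word X) x)) (obj y)" "t = L (Tens (Word X) x) y f"
    using L_surj[of t "Tens (Word X) x" y] by auto
  then have f': "f \<in> Hom C (obj (Word X) \<otimes>\<^sub>o obj x) (obj y)" by simp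
  show "\<exists>!h. M.sarr h \<and> M.ssrc h = X \<and> M.stgt h = [?K] \<and> evS x y \<bullet> M.swh [] h (flat x) = t"
  proof (rule ex1I)
    let ?h = "curry_mor C (obj (Word X)) (obj x) (obj y) f"
    show "M.sarr (L (Word X) (Leaf ?K) ?h) \<and> M.ssrc (L (Word X) (Leaf ?K) ?h) = X \<and> M.stgt (L (Word X) (Leaf ?K) ?h) = [?K] \<and>
        evS x y \<bullet> M.swh [] (L (Word X) (Leaf ?K) ?h) (flat x) = t"
      using curry_mor[OF f'] L_Ev[of ?h "Word X" x y] f(2) by simp
    fix h assume h: "M.sarr h \<and> M.ssrc h = X \<and> M.stgt h = [?K] \<and> evS x y \<bullet> M.swh [] h (flat x) = t"
    then obtain k where k: "k \<in> Hom C (obj (Word X)) (obj (Leaf ?K))" "h = L (Word X) (Leaf ?K) k"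
      using L_surj[of h "Word X" "Leaf ?K"] by auto
    have k': "k \<in> Hom C (obj (Word X)) (IHom C (obj x) (obj y))" using k(1) by simp
    have "L (Tens (Word X) x) y (Ev C (obj x) (obj y) \<cdot> (k \<otimes>\<^sub>m \<^bold>1 (obj x))) = L (Tens (Word X) x) y f"
      using L_Ev[OF k'] h k f(2) by simp
    then have "Ev C (obj x) (obj y) \<cdot> (k \<otimes>\<^sub>m \<^bold>1 (obj x)) = f"
      by (rule L_inj[rotated 2]) (use f(1) Comp_in[OF Tensor_in[OF k' Id_in[of "obj x"]] Ev_in] in simp_all)
    then have "k = ?h"
      using Ev_universal[OF f'] k' curry_mor[OF f'] by blast
    then show "h = L (Word X) (Leaf ?K) ?h" using k(2) by simp
  qed
qed

lemma L_curry:
  assumes "f \<in> Hom C (obj z \<otimes>\<^sub>o obj x) (obj y)"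
  shows "evS x y \<bullet> M.swh [] (L z (Leaf (IHom C (obj x) (obj y))) (curry_mor C (obj z) (obj x) (obj y) f)) (flat x) = L (Tens z x) y f"
  using L_Ev[OF curry_mor(1)[OF assms]] curry_mor(2)[OF assms] by simp

lemma curry_isomorphism:
  assumes f: "f \<in> Hom C (obj z \<otimes>\<^sub>o obj x) (obj y)" and dp: "S.dual_pair (flat x) Y' e c"
    and m: "S.is_iso (M.swh [] (L (Tens z x) y f) Y' \<bullet> M.swh (flat z) c [])"
  shows "is_isomorphism C (obj z) (IHom C (obj x) (obj y)) (curry_mor C (obj z) (obj x) (obj y) f)"
proof -
  let ?h = "curry_mor C (obj z) (obj x) (obj y) f"
  have h: "?h \<in> Hom C (obj z) (obj (Leaf (IHom C (obj x) (obj y))))"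
    using curry_mor(1)[OF f] by simp
  have "S.is_iso (L z (Leaf (IHom C (obj x) (obj y))) ?h)"
    by (rule S.curry_iso[OF universal_evS dp _ _ _ L_curry[OF f] m]) (use h in auto)
  then show ?thesis using L_iso[of z "Leaf (IHom C (obj x) (obj y))" ?h] h by simp
qed

lemma alpha_via_in:
  assumes "e \<in> Hom C (X' \<otimes>\<^sub>o X) \<I>"
  shows "Runit C Y \<cdot> (\<^bold>1 Y \<otimes>\<^sub>m e) \<cdot> Assoc C Y X' X \<in> Hom C ((Y \<otimes>\<^sub>o X') \<otimes>\<^sub>o X) Y"
  by (rule hom_intros assms)+

lemma L_alpha_via:
  assumes e: "e \<in> Hom C (X' \<otimes>\<^sub>o X) \<I>"
  shows "evS (Leaf X) (Leaf Y) \<bullet> M.swh [] (L (Tens (Leaf Y) (Leaf X')) (Leaf (IHom C X Y)) (alpha_via C X Y X' e)) [X] =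
    M.swh [Y] (L (Tens (Leaf X') (Leaf X)) (Word []) e) []"
proof -
  let ?y = "Leaf Y" and ?x' = "Leaf X'" and ?x = "Leaf X"
  have "evS ?x ?y \<bullet> M.swh [] (L (Tens ?y ?x') (Leaf (IHom C X Y)) (alpha_via C X Y X' e)) [X] =
     L (Tens (Tens ?y ?x') ?x) ?y (Runit C Y \<cdot> (\<^bold>1 Y \<otimes>\<^sub>m e) \<cdot> Assoc C Y X' X)"
    using L_curry[of _ "Tens ?y ?x'" ?x ?y] alpha_via_in[OF e] by (simp add: alpha_via_def)
  also have "\<dots> = L (Tens ?y (Word [])) ?y (Runit C Y) \<bullet> L (Tens (Tens ?y ?x') ?x) (Tens ?y (Word [])) ((\<^bold>1 Y \<otimes>\<^sub>m e) \<cdot> Assoc C Y X' X)"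
    by (rule L_cmp) (unfold obj.simps tensor_list.simps, (rule hom_intros e)+)
  also have "L (Tens (Tens ?y ?x') ?x) (Tens ?y (Word [])) ((\<^bold>1 Y \<otimes>\<^sub>m e) \<cdot> Assoc C Y X' X) =
     L (Tens ?y (Tens ?x' ?x)) (Tens ?y (Word [])) (\<^bold>1 Y \<otimes>\<^sub>m e) \<bullet> L (Tens (Tens ?y ?x') ?x) (Tens ?y (Tens ?x' ?x)) (Assoc C Y X' X)"
    by (rule L_cmp) (unfold obj.simps tensor_list.simps, (rule hom_intros e)+)
  also have "L (Tens ?y (Tens ?x' ?x)) (Tens ?y (Word [])) (\<^bold>1 Y \<otimes>\<^sub>m e) = M.swh [Y] (L (Tens ?x' ?x) (Word []) e) []"
    using L_Tensor_Id(2)[of e "Tens ?x' ?x" "Word []" ?y] e by simp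
  finally show ?thesis
    using L_Assoc[of ?y ?x' ?x] L_Runit[of ?y] e L_arr[of e "Tens ?x' ?x" "Word []"] by simp
qed

lemma alpha_via_iso:
  assumes e: "e \<in> Hom C (X' \<otimes>\<^sub>o X) \<I>" and dp: "S.dual_pair [X] [X'] (L (Tens (Leaf X') (Leaf X)) (Word []) e) c"
  shows "is_isomorphism C (Y \<otimes>\<^sub>o X') (IHom C X Y) (alpha_via C X Y X' e)"
    and "L (Leaf (IHom C X Y)) (Tens (Leaf Y) (Leaf X')) (iso_inv C (Y \<otimes>\<^sub>o X') (IHom C X Y) (alpha_via C X Y X' e)) =
      M.swh [] (evS (Leaf X) (Leaf Y)) [X'] \<bullet> M.swh [IHom C X Y] c []"
proof -
  let ?al = "L (Tens (Leaf Y) (Leaf X')) (Leaf (IHom C X Y)) (alpha_via C X Y X' e)"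
  let ?b = "M.swh [] (evS (Leaf X) (Leaf Y)) [X'] \<bullet> M.swh [IHom C X Y] c []"
  have al: "alpha_via C X Y X' e \<in> Hom C (Y \<otimes>\<^sub>o X') (IHom C X Y)"
    unfolding alpha_via_def by (rule curry_mor(1)[OF alpha_via_in[OF e]])
  have un: "S.universal [IHom C X Y] [X] [Y] (evS (Leaf X) (Leaf Y))"
    using universal_evS[of "Leaf X" "Leaf Y"] by simp
  have "M.sarr ?al" "M.ssrc ?al = [Y] @ [X']" "M.stgt ?al = [IHom C X Y]" using al by auto
  note ai = S.alpha_iso[OF un dp this L_alpha_via[OF e]]
  have c: "M.sarr c" "M.ssrc c = []" "M.stgt c = [X, X']" using dp by (auto simp: S.dual_pair_def)
  have ev: "M.sarr (evS (Leaf X) (Leaf Y))" "M.ssrc (evS (Leaf X) (Leaf Y)) = [IHom C X Y, X]" "M.stgt (evS (Leaf X) (Leaf Y)) = [Y]"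
    using un by (auto simp: S.universal_def)
  have "S.is_iso ?al"
    using ai c ev al by (intro S.is_isoI[of ?al ?b]) auto
  then show iso: "is_isomorphism C (Y \<otimes>\<^sub>o X') (IHom C X Y) (alpha_via C X Y X' e)"
    using L_iso[of "Tens (Leaf Y) (Leaf X')" "Leaf (IHom C X Y)" "alpha_via C X Y X' e"] al by simp
  let ?i = "L (Leaf (IHom C X Y)) (Tens (Leaf Y) (Leaf X')) (iso_inv C (Y \<otimes>\<^sub>o X') (IHom C X Y) (alpha_via C X Y X' e))"
  have ia: "?i \<bullet> ?al = M.sidm [Y, X']" and i_in: "M.sarr ?i"
    using L_inverse[of "Tens (Leaf Y) (Leaf X')" "Leaf (IHom C X Y)" "alpha_via C X Y X' e"] iso_inv[OF iso] by simp_all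
  have "?i = ?i \<bullet> (?al \<bullet> ?b)" using ai(1) i_in by simp
  also have "\<dots> = ?b" using S.reassoc[OF ia] c ev by simp
  finally show "?i = ?b" .
qed

lemma isomorphism_Comp:
  assumes "is_isomorphism C X Y f" "is_isomorphism C Y Z g"
  shows "is_isomorphism C X Z (g \<cdot> f)"
  using assms L_iso[of "Leaf X" "Leaf Y" f] L_iso[of "Leaf Y" "Leaf Z" g] L_iso[of "Leaf X" "Leaf Z" "g \<cdot> f"]
    L_cmp[of f "Leaf X" "Leaf Y" g "Leaf Z"] Comp_in[of f X Y g Z]
    S.is_iso_cmp[of "L (Leaf Y) (Leaf Z) g" "L (Leaf X) (Leaf Y) f"]
  by simp

lemma isomorphism_inv:
  "is_isomorphism C X Y f \<Longrightarrow> is_isomorphism C Y X (iso_inv C X Y f)"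
  using iso_inv[of X Y f] unfolding is_isomorphism_def is_inverse_def by blast

end

context rat_tensor_category
begin

section \<open>Duals, contractions and the theorem\<close>

lemma family_ev_in:
  "family_ev C ps \<in> Hom C (tensor_list C (map (\<lambda>(X, Y). IHom C X Y) ps) \<otimes>\<^sub>o tensor_list C (map fst ps)) (tensor_list C (map snd ps))"
proof (induction ps)
  case Nil
  then show ?case by (simp add: Lunit_in)
next
  case (Cons p ps)
  obtain X Y where p: "p = (X, Y)" by (cases p)
  show ?case
    unfolding p by simp (rule Comp_in[OF interchange_in Tensor_in[OF Ev_in Cons.IH]])
qed

lemma L_family_ev_Cons:
  defines "hs \<equiv> \<lambda>ps. map (\<lambda>(X, Y). IHom C X Y) ps"
  shows "L (Tens (Word (hs ((X, Y) # ps))) (Word (map fst ((X, Y) # ps)))) (Word (map snd ((X, Y) # ps))) (family_ev C ((X, Y) # ps)) =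
    M.swh [] (evS (Leaf X) (Leaf Y)) (map snd ps) \<bullet>
    M.swh [IHom C X Y, X] (L (Tens (Word (hs ps)) (Word (map fst ps))) (Word (map snd ps)) (family_ev C ps)) [] \<bullet>
    M.swh [IHom C X Y] (M.ssym (hs ps) [X]) (map fst ps)"
proof -
  let ?h = "Leaf (IHom C X Y)" and ?x = "Leaf X" and ?y = "Leaf Y"
  let ?H = "Word (hs ps)" and ?X = "Word (map fst ps)" and ?Y = "Word (map snd ps)"
  have f: "family_ev C ps \<in> Hom C (obj (Tens ?H ?X)) (obj ?Y)"
    using family_ev_in[of ps] by (simp add: hs_def)
  have "L (Tens (Word (hs ((X, Y) # ps))) (Word (map fst ((X, Y) # ps)))) (Word (map snd ((X, Y) # ps))) (family_ev C ((X, Y) # ps)) =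
    L (Tens (Tens ?h ?H) (Tens ?x ?X)) (Tens ?y ?Y) (family_ev C ((X, Y) # ps))"
    using L_same[OF same_Tens[OF same_Cons same_Cons] same_Cons, of "IHom C X Y" "hs ps" X "map fst ps" Y "map snd ps"]
    by (simp add: hs_def)
  also have "\<dots> = L (Tens (Tens ?h ?x) (Tens ?H ?X)) (Tens ?y ?Y) (Ev C X Y \<otimes>\<^sub>m family_ev C ps) \<bullet>
     L (Tens (Tens ?h ?H) (Tens ?x ?X)) (Tens (Tens ?h ?x) (Tens ?H ?X)) (interchange C (IHom C X Y) (tensor_list C (hs ps)) X (tensor_list C (map fst ps)))"
    unfolding family_ev.simps fst_conv snd_conv hs_def
    by (rule L_cmp) (unfold obj.simps, rule interchange_in, rule Tensor_in[OF Ev_in family_ev_in])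
  also have "L (Tens (Tens ?h ?x) (Tens ?H ?X)) (Tens ?y ?Y) (Ev C X Y \<otimes>\<^sub>m family_ev C ps) =
     M.swh [] (evS ?x ?y) (map snd ps) \<bullet> M.swh [IHom C X Y, X] (L (Tens ?H ?X) ?Y (family_ev C ps)) []"
    using L_Tensor[of "Ev C X Y" "Tens ?h ?x" ?y "family_ev C ps" "Tens ?H ?X" ?Y] f Ev_in by (simp add: evS_def)
  also have "L (Tens (Tens ?h ?H) (Tens ?x ?X)) (Tens (Tens ?h ?x) (Tens ?H ?X)) (interchange C (IHom C X Y) (tensor_list C (hs ps)) X (tensor_list C (map fst ps))) =
     M.swh [IHom C X Y] (M.ssym (hs ps) [X]) (map fst ps)"
    using L_interchange[of ?h ?H ?x ?X] by simp
  finally show ?thesis by (simp add: S.cmp_assoc)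
qed

definition LE where "LE X = L (Tens (Leaf (dual C X)) (Leaf X)) (Word []) (dual_ev C X)"
definition LC where "LC X = L (Word []) (Tens (Leaf X) (Leaf (dual C X))) (coev C X)"

lemma dual_ev_in: "dual_ev C X \<in> Hom C (dual C X \<otimes>\<^sub>o X) \<I>"
  unfolding dual_ev_def dual_def by (rule Ev_in)

lemma universal_LE: "S.universal [dual C X] [X] [] (LE X)"
  using universal_evS[of "Leaf X" "Word []"] by (simp add: LE_def evS_def dual_def dual_ev_def)

text \<open>Rigidity enters only here: applied to the family \<open>(\<I>, X), (X, \<I>)\<close>, it identifies the
  exchange isomorphism \<open>\<I> \<otimes> X \<rightarrow> X \<otimes> \<I>\<close> with an element of \<open>X \<otimes> X\<^sup>\<or>\<close>.\<close>

lemma ex_coevaluation: "\<exists>c. S.dual_pair [X] [dual C X] (LE X) c"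
proof -
  define H1 where "H1 = IHom C \<I> X"
  define H2 where "H2 = IHom C X \<I>"
  let ?ps = "[(\<I>, X), (X, \<I>)]"
  let ?I = "Leaf \<I>"
  define K where "K = IHom C (obj (Word [\<I>, X])) (obj (Word [X, \<I>]))"
  define E1 where "E1 = evS ?I (Leaf X)"
  define E2 where "E2 = evS (Leaf X) ?I"
  define EK where "EK = evS (Word [\<I>, X]) (Word [X, \<I>])"
  \<comment> \<open>The unit object occurs both as a one-letter word and as the empty word.
    \<open>io\<close> and \<open>io'\<close> are its identity seen as an arrow between the
    two.\<close>
  define io where "io = L ?I (Word []) (\<^bold>1 \<I>)"
  define io' where "io' = L (Word []) ?I (\<^bold>1 \<I>)"
  have E1 [simp]: "M.sarr E1" "M.ssrc E1 = [H1, \<I>]" "M.stgt E1 = [X]"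
    using universal_evS[of ?I "Leaf X"] by (auto simp: S.universal_def E1_def H1_def)
  have E2 [simp]: "M.sarr E2" "M.ssrc E2 = [H2, X]" "M.stgt E2 = [\<I>]"
    using universal_evS[of "Leaf X" ?I] by (auto simp: S.universal_def E2_def H2_def)
  have unK: "S.universal [K] [\<I>, X] [X, \<I>] EK"
    using universal_evS[of "Word [\<I>, X]" "Word [X, \<I>]"] by (simp add: K_def EK_def)
  then have EK [simp]: "M.sarr EK" "M.ssrc EK = [K, \<I>, X]" "M.stgt EK = [X, \<I>]"
    by (auto simp: S.universal_def)
  have io [simp]: "M.sarr io" "M.ssrc io = [\<I>]" "M.stgt io = []" "M.sarr io'" "M.ssrc io' = []" "M.stgt io' = [\<I>]"
    using Id_in[of \<I>] by (auto simp: io_def io'_def)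
  have io_io': "io \<bullet> io' = M.sidm []"
    using L_cmp[of "\<^bold>1 \<I>" "Word []" ?I "\<^bold>1 \<I>" "Word []"] Id_in[of \<I>] Id_Comp[OF Id_in[of \<I>]] L_Id[of "Word []"]
    by (simp add: io_def io'_def)
  define fam where "fam = M.swh [] E1 [\<I>] \<bullet> M.swh [H1, \<I>] E2 [] \<bullet> M.swh [H1] (M.ssym [H2] [\<I>]) [X]"
  have nil: "L (Tens (Word []) (Word [])) (Word []) (family_ev C []) = M.sidm []"
    using L_Lunit[of "Word []"] by simp
  have fam2: "L (Tens (Word [H2]) (Word [X])) (Word [\<I>]) (family_ev C [(X, \<I>)]) = E2"
    using L_family_ev_Cons[of X \<I> "[]"] nil by (simp add: E2_def[symmetric] H2_def[symmetric])
  have fam_eq: "L (Tens (Word [H1, H2]) (Word [\<I>, X])) (Word [X, \<I>]) (family_ev C ?ps) = fam"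
    using L_family_ev_Cons[of \<I> X "[(X, \<I>)]"] fam2
    by (simp add: fam_def E1_def[symmetric] H1_def[symmetric] H2_def[symmetric])
  define F where "F = L (Word [H1, H2]) (Leaf K) (family_hom_map C ?ps)"
  have F_iso: "S.is_iso F"
    using family_hom_iso[of ?ps] L_iso[of "Word [H1, H2]" "Leaf K" "family_hom_map C ?ps"]
    by (simp add: F_def K_def H1_def H2_def)
  then have F [simp]: "M.sarr F" "M.ssrc F = [H1, H2]" "M.stgt F = [K]"
    using S.is_iso_arr[OF F_iso] by (auto simp: F_def)
  have FE: "EK \<bullet> M.swh [] F [\<I>, X] = fam"
    using L_curry[of "family_ev C ?ps" "Word [H1, H2]" "Word [\<I>, X]" "Word [X, \<I>]"] family_ev_in[of ?ps] fam_eq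
    by (simp add: EK_def F_def K_def H1_def H2_def family_hom_map_def)
  \<comment> \<open>The element of hom(\<I> \<otimes> X, X \<otimes> \<I>) that names the canonical
    exchange: remove the letter \<I> on the left and insert it on the right.\<close>
  obtain k where k: "M.sarr k" "M.ssrc k = []" "M.stgt k = [K]"
    "EK \<bullet> M.swh [] k [\<I>, X] = M.swh [X] io' [] \<bullet> M.swh [] io [X]"
    using S.universal_exists[OF unK, of "M.swh [X] io' [] \<bullet> M.swh [] io [X]" "[]"] by auto
  obtain F' where F': "M.sarr F'" "M.ssrc F' = [K]" "M.stgt F' = [H1, H2]" "F \<bullet> F' = M.sidm [K]"
    using S.is_isoE[OF F_iso] F by metis
  define c0 where "c0 = F' \<bullet> k"
  have c0 [simp]: "M.sarr c0" "M.ssrc c0 = []" "M.stgt c0 = [H1, H2]" using F' k by (auto simp: c0_def)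
  have "F \<bullet> c0 = k" using F' k by (simp add: c0_def S.reassoc[OF F'(4)])
  then have famc: "fam \<bullet> M.swh [] c0 [\<I>, X] = M.swh [X] io' [] \<bullet> M.swh [] io [X]"
    using k by (simp add: FE[symmetric] S.cmp_assoc flip: S.wh_cmp)
  \<comment> \<open>Evaluating the factor hom(\<I>, X) at the unit turns the element
    \<open>c0\<close> of hom(\<I>, X) \<otimes> hom(X, \<I>) into a candidate coevaluation.\<close>
  define c where "c = M.swh [] E1 [H2] \<bullet> M.swh [H1] io' [H2] \<bullet> c0"
  have c [simp]: "M.sarr c" "M.ssrc c = []" "M.stgt c = [X, H2]" by (auto simp: c_def)
  define e where "e = io \<bullet> E2"
  have e [simp]: "M.sarr e" "M.ssrc e = [H2, X]" "M.stgt e = []" by (auto simp: e_def)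
  have e_LE: "e = LE X"
    using L_cmp[of "dual_ev C X" "Tens (Leaf (dual C X)) (Leaf X)" ?I "\<^bold>1 \<I>" "Word []"] Id_in[of \<I>]
      dual_ev_in[of X] Id_Comp[OF dual_ev_in[of X]]
    by (simp add: e_def io_def E2_def LE_def evS_def dual_def dual_ev_def)
  have sy: "M.ssym [H2] [\<I>] \<bullet> M.swh [H2] io' [] = M.swh [] io' [H2]"
    using S.sym_natural_wh'[of io' "[]" "[\<I>]" "[]" "[H2]" "[]"] by simp
  have sy': "M.swh [H1] (M.ssym [H2] [\<I>]) [X] \<bullet> M.swh [H1, H2] io' [X] = M.swh [H1] io' [H2, X]"
  proof -
    have "M.swh [H1] (M.ssym [H2] [\<I>] \<bullet> M.swh [H2] io' []) [X] = M.swh [H1] (M.swh [] io' [H2]) [X]"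
      by (simp only: sy)
    then show ?thesis by (simp add: S.wh_cmp)
  qed
  have z: "M.swh [X] e [] \<bullet> M.swh [] c [X] = M.sidm [X]"
  proof -
    have ic1: "M.swh [] c0 [\<I>, X] \<bullet> M.swh [] io' [X] = M.swh [H1, H2] io' [X] \<bullet> M.swh [] c0 [X]"
      using S.exchange[of c0 io' "[]" "[]" "[X]"] by simp
    have ic2: "M.swh [] E1 [\<I>] \<bullet> M.swh [H1, \<I>] E2 [] = M.swh [X] E2 [] \<bullet> M.swh [] E1 [H2, X]"
      using S.exchange[of E1 E2 "[]" "[]" "[]"] by simp
    have "M.swh [X] E2 [] \<bullet> M.swh [] c [X] = (M.swh [] E1 [\<I>] \<bullet> M.swh [H1, \<I>] E2 []) \<bullet> M.swh [H1] io' [H2, X] \<bullet> M.swh [] c0 [X]"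
      unfolding ic2 by (simp add: c_def S.wh_cmp S.cmp_assoc)
    also have "\<dots> = fam \<bullet> M.swh [H1, H2] io' [X] \<bullet> M.swh [] c0 [X]"
      by (simp add: fam_def S.cmp_assoc S.reassoc[OF sy'])
    also have "\<dots> = (fam \<bullet> M.swh [] c0 [\<I>, X]) \<bullet> M.swh [] io' [X]"
      by (simp add: S.cmp_assoc ic1)
    also have "\<dots> = M.swh [X] io' [] \<bullet> M.swh [] (io \<bullet> io') [X]"
      unfolding famc by (simp add: S.wh_cmp S.cmp_assoc)
    finally have 1: "M.swh [X] E2 [] \<bullet> M.swh [] c [X] = M.swh [X] io' []"
      by (simp add: io_io')
    have "M.swh [X] e [] \<bullet> M.swh [] c [X] = M.swh [X] io [] \<bullet> (M.swh [X] E2 [] \<bullet> M.swh [] c [X])"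
      by (simp add: e_def S.wh_cmp S.cmp_assoc)
    also have "\<dots> = M.swh [X] (io \<bullet> io') []"
      unfolding 1 by (simp add: S.wh_cmp)
    finally show ?thesis by (simp add: io_io')
  qed
  have un: "S.universal [H2] [X] [] e"
    using universal_LE[of X] by (simp add: e_LE H2_def dual_def)
  \<comment> \<open>The second zigzag follows from the first because arrows into the dual are
    determined by their pairing with \<open>X\<close>.\<close>
  have "M.swh [] e [H2] \<bullet> M.swh [H2] c [] = M.sidm [H2]"
  proof (rule S.universal_unique[OF un])
    have "e \<bullet> M.swh [] (M.swh [] e [H2] \<bullet> M.swh [H2] c []) [X] = (e \<bullet> M.swh [] e [H2, X]) \<bullet> M.swh [H2] c [X]"
      by (simp add: S.wh_cmp S.cmp_assoc)
    also have "e \<bullet> M.swh [] e [H2, X] = e \<bullet> M.swh [H2, X] e []"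
      using S.exchange[of e e "[]" "[]" "[]"] by simp
    also have "(e \<bullet> M.swh [H2, X] e []) \<bullet> M.swh [H2] c [X] = e \<bullet> M.swh [H2] (M.swh [X] e [] \<bullet> M.swh [] c [X]) []"
      by (simp add: S.wh_cmp S.cmp_assoc)
    finally show "e \<bullet> M.swh [] (M.swh [] e [H2] \<bullet> M.swh [H2] c []) [X] = e \<bullet> M.swh [] (M.sidm [H2]) [X]"
      by (simp add: z)
  qed auto
  then have "S.dual_pair [X] [H2] e c"
    using z by (simp add: S.dual_pair_def)
  then show ?thesis unfolding e_LE H2_def dual_def by blast
qed

text \<open>\<open>coev\<close> is the inverse of \<alpha> applied to the name of the identity. By
  the mate formula this is the mate of an identity, hence the coevaluation just constructed.\<close>

lemma coev_in: "coev C X \<in> Hom C \<I> (X \<otimes>\<^sub>o dual C X)"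
  and dual_pair: "S.dual_pair [X] [dual C X] (LE X) (LC X)"
proof -
  obtain c where dp: "S.dual_pair [X] [dual C X] (LE X) c" using ex_coevaluation by blast
  have iso: "is_isomorphism C (X \<otimes>\<^sub>o dual C X) (IHom C X X) (alpha C X X)"
    unfolding alpha_def using alpha_via_iso(1)[OF dual_ev_in dp[unfolded LE_def]] .
  have inv: "L (Leaf (IHom C X X)) (Tens (Leaf X) (Leaf (dual C X))) (iso_inv C (X \<otimes>\<^sub>o dual C X) (IHom C X X) (alpha C X X)) =
      M.swh [] (evS (Leaf X) (Leaf X)) [dual C X] \<bullet> M.swh [IHom C X X] c []"
    unfolding alpha_def using alpha_via_iso(2)[OF dual_ev_in dp[unfolded LE_def]] .
  have ii: "iso_inv C (X \<otimes>\<^sub>o dual C X) (IHom C X X) (alpha C X X) \<in> Hom C (IHom C X X) (X \<otimes>\<^sub>o dual C X)"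
    using iso_inv[OF iso] by (simp add: is_inverse_def)
  have h: "curry_mor C \<I> X X (Lunit C X) \<in> Hom C \<I> (IHom C X X)" by (rule curry_mor(1)[OF Lunit_in])
  show "coev C X \<in> Hom C \<I> (X \<otimes>\<^sub>o dual C X)"
    unfolding coev_def by (rule Comp_in[OF h ii])
  let ?h = "L (Word []) (Leaf (IHom C X X)) (curry_mor C \<I> X X (Lunit C X))"
  have "LC X = (M.swh [] (evS (Leaf X) (Leaf X)) [dual C X] \<bullet> M.swh [IHom C X X] c []) \<bullet> ?h"
    using L_cmp[of "curry_mor C \<I> X X (Lunit C X)" "Word []" "Leaf (IHom C X X)" _ "Tens (Leaf X) (Leaf (dual C X))"] h ii inv
    by (simp add: LC_def coev_def)
  also have "\<dots> = M.swh [] (M.sidm [X]) [dual C X] \<bullet> M.swh [] c []"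
  proof (rule S.mate_eq)
    show "S.universal [IHom C X X] [X] [X] (evS (Leaf X) (Leaf X))" using universal_evS[of "Leaf X" "Leaf X"] by simp
    show "S.dual_pair [X] [dual C X] (LE X) c" by (rule dp)
    show "evS (Leaf X) (Leaf X) \<bullet> M.swh [] ?h [X] = M.sidm [X]"
      using L_curry[of "Lunit C X" "Word []" "Leaf X" "Leaf X"] Lunit_in[of X] L_Lunit[of "Leaf X"] by simp
  qed (use h in auto)
  also have "\<dots> = c" using dp by (simp add: S.dual_pair_def)
  finally show "S.dual_pair [X] [dual C X] (LE X) (LC X)" using dp by simp
qed

lemma sym_dual: "sym_dual_objects M.sarr M.ssrc M.stgt M.sidm M.scmp M.swh M.ssym M.spls M.sscl
    [X] [dual C X] (LE X) (LC X) (SP X) (LI X) (LP X) (SP (dual C X)) (LI (dual C X)) (LP (dual C X))"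
proof -
  interpret a: sym_split M.sarr M.ssrc M.stgt M.sidm M.scmp M.swh M.ssym M.spls M.sscl "[X]" "SP X" "LI X" "LP X"
    by (rule sym_split)
  interpret b: sym_split M.sarr M.ssrc M.stgt M.sidm M.scmp M.swh M.ssym M.spls M.sscl "[dual C X]" "SP (dual C X)" "LI (dual C X)" "LP (dual C X)"
    by (rule sym_split)
  show ?thesis by unfold_locales (rule dual_pair)
qed

lemma sym_mult_in: "sym_mult C X m n \<in> Hom C (sym_pow C X m \<otimes>\<^sub>o sym_pow C X n) (sym_pow C X (m + n))"
  unfolding sym_mult_def
  by (rule Comp_in[OF Comp_in[OF Tensor_in[OF sym_inj_in sym_inj_in] join_in] sym_proj_in])

lemma L_sym_mult: "L (Tens (Sp X m) (Sp X n)) (Sp X (m + n)) (sym_mult C X m n) =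
    sym_split.mult M.scmp M.swh [X] (SP X) (LI X) (LP X) m n"
proof -
  interpret a: sym_split M.sarr M.ssrc M.stgt M.sidm M.scmp M.swh M.ssym M.spls M.sscl "[X]" "SP X" "LI X" "LP X"
    by (rule sym_split)
  let ?i = "sym_inj C X m \<otimes>\<^sub>m sym_inj C X n"
  have "L (Tens (Sp X m) (Sp X n)) (Sp X (m + n)) (sym_mult C X m n) =
     L (Pw X (m + n)) (Sp X (m + n)) (sym_proj C X (m + n)) \<bullet>
     L (Tens (Sp X m) (Sp X n)) (Pw X (m + n)) (tensor_pow_join C X m n \<cdot> ?i)"
    unfolding sym_mult_def
    by (rule L_cmp) (unfold obj.simps tensor_list_pw, rule Comp_in[OF Tensor_in[OF sym_inj_in sym_inj_in] join_in], rule sym_proj_in)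
  also have "L (Tens (Sp X m) (Sp X n)) (Pw X (m + n)) (tensor_pow_join C X m n \<cdot> ?i) =
     L (Tens (Pw X m) (Pw X n)) (Pw X (m + n)) (tensor_pow_join C X m n) \<bullet> L (Tens (Sp X m) (Sp X n)) (Tens (Pw X m) (Pw X n)) ?i"
    by (rule L_cmp) (unfold obj.simps tensor_list_pw, rule Tensor_in[OF sym_inj_in sym_inj_in], rule join_in)
  also have "L (Tens (Sp X m) (Sp X n)) (Tens (Pw X m) (Pw X n)) ?i =
     M.swh [] (LI X m) (pw [X] n) \<bullet> M.swh (SP X m) (LI X n) []"
    using L_Tensor[of "sym_inj C X m" "Sp X m" "Pw X m" "sym_inj C X n" "Sp X n" "Pw X n"] sym_inj_in
    by (simp add: LI_def SP_def)
  finally show ?thesis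
    unfolding L_join a.mult_def LP_def[symmetric] by (simp add: SP_def)
qed

lemma tensor_pow_ev_in: "tensor_pow_ev C X n \<in> Hom C (tensor_pow C (dual C X) n \<otimes>\<^sub>o tensor_pow C X n) \<I>"
proof (induction n)
  case 0
  then show ?case by (simp add: Lunit_in)
next
  case (Suc n)
  show ?case unfolding tensor_pow_ev.simps tensor_pow.simps
    by (rule Comp_in[OF Comp_in[OF interchange_in Tensor_in[OF dual_ev_in Suc]] Lunit_in])
qed

lemma LE_typ [simp]: "M.sarr (LE X)" "M.ssrc (LE X) = [dual C X, X]" "M.stgt (LE X) = []"
  using dual_pair[of X] by (auto simp: S.dual_pair_def)

lemma L_tensor_pow_ev:
  "L (Tens (Pw (dual C X) n) (Pw X n)) (Word []) (tensor_pow_ev C X n) = S.pow_ev [X] [dual C X] (LE X) n"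
proof (induction n)
  case 0
  then show ?case using L_Lunit[of "Word []"] by simp
next
  case (Suc n)
  let ?D = "dual C X"
  let ?d = "Leaf ?D" and ?x = "Leaf X" and ?dn = "Pw ?D n" and ?xn = "Pw X n" and ?o = "Word [] :: 'a texp"
  have "L (Tens (Pw ?D (Suc n)) (Pw X (Suc n))) ?o (tensor_pow_ev C X (Suc n)) =
     L (Tens (Tens ?d ?dn) (Tens ?x ?xn)) ?o (tensor_pow_ev C X (Suc n))"
    using L_same[OF same_Tens[OF same_Cons same_Cons] same_refl, of ?D "pw [?D] n" X "pw [X] n"] by simp
  also have "\<dots> = L (Tens ?o ?o) ?o (Lunit C \<I>) \<bullet> L (Tens (Tens ?d ?dn) (Tens ?x ?xn)) (Tens ?o ?o)
     ((dual_ev C X \<otimes>\<^sub>m tensor_pow_ev C X n) \<cdot> interchange C ?D (tensor_pow C ?D n) X (tensor_pow C X n))"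
    unfolding tensor_pow_ev.simps
    by (rule L_cmp) (unfold obj.simps tensor_list_pw tensor_list.simps,
        rule Comp_in[OF interchange_in Tensor_in[OF dual_ev_in tensor_pow_ev_in]], rule Lunit_in)
  also have "L (Tens (Tens ?d ?dn) (Tens ?x ?xn)) (Tens ?o ?o)
       ((dual_ev C X \<otimes>\<^sub>m tensor_pow_ev C X n) \<cdot> interchange C ?D (tensor_pow C ?D n) X (tensor_pow C X n)) =
     L (Tens (Tens ?d ?x) (Tens ?dn ?xn)) (Tens ?o ?o) (dual_ev C X \<otimes>\<^sub>m tensor_pow_ev C X n) \<bullet>
     L (Tens (Tens ?d ?dn) (Tens ?x ?xn)) (Tens (Tens ?d ?x) (Tens ?dn ?xn)) (interchange C ?D (tensor_pow C ?D n) X (tensor_pow C X n))"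
    by (rule L_cmp) (unfold obj.simps tensor_list_pw tensor_list.simps, rule interchange_in, rule Tensor_in[OF dual_ev_in tensor_pow_ev_in])
  also have "L (Tens (Tens ?d ?x) (Tens ?dn ?xn)) (Tens ?o ?o) (dual_ev C X \<otimes>\<^sub>m tensor_pow_ev C X n) =
     LE X \<bullet> M.swh [?D, X] (S.pow_ev [X] [?D] (LE X) n) []"
    using L_Tensor[of "dual_ev C X" "Tens ?d ?x" ?o "tensor_pow_ev C X n" "Tens ?dn ?xn" ?o] dual_ev_in tensor_pow_ev_in[of X n] Suc
    by (simp add: LE_def[symmetric])
  also have "LE X \<bullet> M.swh [?D, X] (S.pow_ev [X] [?D] (LE X) n) [] =
      S.pow_ev [X] [?D] (LE X) n \<bullet> M.swh [] (LE X) (pw [?D] n @ pw [X] n)"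
    using S.exchange[of "LE X" "S.pow_ev [X] [?D] (LE X) n" "[]" "[]" "[]"] S.pow_ev_typ[of "LE X" "[?D]" "[X]" n] by simp
  also have "L (Tens (Tens ?d ?dn) (Tens ?x ?xn)) (Tens (Tens ?d ?x) (Tens ?dn ?xn)) (interchange C ?D (tensor_pow C ?D n) X (tensor_pow C X n)) =
     M.swh [?D] (M.ssym (pw [?D] n) [X]) (pw [X] n)"
    using L_interchange[of ?d ?dn ?x ?xn] by simp
  finally show ?case
    using L_Lunit[of ?o] S.pow_ev_typ[of "LE X" "[?D]" "[X]" n] by (simp add: S.cmp_assoc)
qed

lemma L_tensor_pow_ev_symm:
  "L (Tens (Pw X n) (Pw (dual C X) n)) (Word []) (tensor_pow_ev_symm C X n) =
    S.pow_ev [dual C X] [X] (LE X \<bullet> M.ssym [X] [dual C X]) n"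
proof -
  have "L (Tens (Pw X n) (Pw (dual C X) n)) (Word []) (tensor_pow_ev_symm C X n) =
     S.pow_ev [X] [dual C X] (LE X) n \<bullet> M.ssym (pw [X] n) (pw [dual C X] n)"
    unfolding tensor_pow_ev_symm_def
    using L_cmp[of "\<tau> (tensor_pow C X n) (tensor_pow C (dual C X) n)" "Tens (Pw X n) (Pw (dual C X) n)" "Tens (Pw (dual C X) n) (Pw X n)"
        "tensor_pow_ev C X n" "Word []"] Symm_in tensor_pow_ev_in[of X n] L_Symm[of "Pw X n" "Pw (dual C X) n"]
    by (simp add: L_tensor_pow_ev)
  then show ?thesis using S.pow_ev_swap[of "LE X" "[dual C X]" "[X]" n] by simp
qed

lemma tensor_pow_ev_symm_in: "tensor_pow_ev_symm C X n \<in> Hom C (tensor_pow C X n \<otimes>\<^sub>o tensor_pow C (dual C X) n) \<I>"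
  unfolding tensor_pow_ev_symm_def by (rule Comp_in[OF Symm_in tensor_pow_ev_in])

lemma sym_ev_in: "sym_ev C X n \<in> Hom C (sym_pow C (dual C X) n \<otimes>\<^sub>o sym_pow C X n) \<I>"
  unfolding sym_ev_def by (rule Comp_in[OF Tensor_in[OF sym_inj_in sym_inj_in] tensor_pow_ev_in])

text \<open>\<open>sym_ev\<close> is built from the factorwise pairing; restricted to symmetric
  powers it equals \<open>sev\<close>.\<close>

lemma sym_ev_dual_pair:
  "\<exists>c. S.dual_pair [sym_pow C X n] [sym_pow C (dual C X) n] (L (Tens (Sp (dual C X) n) (Sp X n)) (Word []) (sym_ev C X n)) c"
proof -
  interpret v: sym_dual_objects M.sarr M.ssrc M.stgt M.sidm M.scmp M.swh M.ssym M.spls M.sscl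
    "[X]" "[dual C X]" "LE X" "LC X" "SP X" "LI X" "LP X" "SP (dual C X)" "LI (dual C X)" "LP (dual C X)"
    by (rule sym_dual)
  let ?D = "dual C X"
  have "L (Tens (Sp ?D n) (Sp X n)) (Word []) (sym_ev C X n) =
     S.pow_ev [X] [?D] (LE X) n \<bullet> M.swh [] (LI ?D n) (pw [X] n) \<bullet> M.swh (SP ?D n) (LI X n) []"
    unfolding sym_ev_def
    using L_cmp[of "sym_inj C ?D n \<otimes>\<^sub>m sym_inj C X n" "Tens (Sp ?D n) (Sp X n)" "Tens (Pw ?D n) (Pw X n)" "tensor_pow_ev C X n" "Word []"]
      L_Tensor[of "sym_inj C ?D n" "Sp ?D n" "Pw ?D n" "sym_inj C X n" "Sp X n" "Pw X n"]
      tensor_pow_ev_in[of X n] sym_inj_in Tensor_in[OF sym_inj_in[of ?D n] sym_inj_in[of X n]]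
    by (simp add: L_tensor_pow_ev LI_def SP_def)
  also have "\<dots> = v.sev n"
    unfolding v.sev_def by (simp add: S.reassoc2[OF v.pow_ev_iB])
  finally show ?thesis using v.sym_dual_pair[of n] unfolding SP_def by metis
qed

lemma contract_in:
  assumes "e \<in> Hom C (A \<otimes>\<^sub>o tensor_pow C X m) \<I>"
  shows "contract C A X m (m + k) e \<in> Hom C (A \<otimes>\<^sub>o tensor_pow C X (m + k)) (tensor_pow C X k)"
  unfolding contract_def add_diff_cancel_left'
  by (rule hom_intros assms inv_join_in)+

lemma L_contract:
  assumes e: "e \<in> Hom C (obj a \<otimes>\<^sub>o tensor_pow C X m) \<I>"
  shows "L (Tens a (Pw X (m + k))) (Pw X k) (contract C (obj a) X m (m + k) e) =
    M.swh [] (L (Tens a (Pw X m)) (Word []) e) (pw [X] k)"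
proof -
  let ?m = "Pw X m" and ?k = "Pw X k" and ?n = "Pw X (m + k)" and ?o = "Word [] :: 'a texp"
  let ?j = "iso_inv C (tensor_pow C X m \<otimes>\<^sub>o tensor_pow C X k) (tensor_pow C X (m + k)) (tensor_pow_join C X m k)"
  let ?A = "inv_Assoc C (obj a) (tensor_pow C X m) (tensor_pow C X k)"
  let ?u = "\<^bold>1 (tensor_pow C X k)"
  note us = obj.simps tensor_list_pw tensor_list.simps
  have "L (Tens a ?n) ?k (contract C (obj a) X m (m + k) e) =
     L (Tens ?o ?k) ?k (Lunit C (tensor_pow C X k)) \<bullet> L (Tens a ?n) (Tens ?o ?k) ((e \<otimes>\<^sub>m ?u) \<cdot> ?A \<cdot> (\<^bold>1 (obj a) \<otimes>\<^sub>m ?j))"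
    unfolding contract_def add_diff_cancel_left'
    by (rule L_cmp) (unfold us, (rule hom_intros e inv_join_in)+)
  also have "L (Tens a ?n) (Tens ?o ?k) ((e \<otimes>\<^sub>m ?u) \<cdot> ?A \<cdot> (\<^bold>1 (obj a) \<otimes>\<^sub>m ?j)) =
     L (Tens (Tens a ?m) ?k) (Tens ?o ?k) (e \<otimes>\<^sub>m ?u) \<bullet> L (Tens a ?n) (Tens (Tens a ?m) ?k) (?A \<cdot> (\<^bold>1 (obj a) \<otimes>\<^sub>m ?j))"
    by (rule L_cmp) (unfold us, (rule hom_intros e inv_join_in)+)
  also have "L (Tens a ?n) (Tens (Tens a ?m) ?k) (?A \<cdot> (\<^bold>1 (obj a) \<otimes>\<^sub>m ?j)) =
     L (Tens a (Tens ?m ?k)) (Tens (Tens a ?m) ?k) ?A \<bullet> L (Tens a ?n) (Tens a (Tens ?m ?k)) (\<^bold>1 (obj a) \<otimes>\<^sub>m ?j)"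
    by (rule L_cmp) (unfold us, (rule hom_intros e inv_join_in)+)
  also have "L (Tens (Tens a ?m) ?k) (Tens ?o ?k) (e \<otimes>\<^sub>m ?u) = M.swh [] (L (Tens a ?m) ?o e) (pw [X] k)"
    using L_Tensor_Id(1)[of e "Tens a ?m" ?o ?k] e by simp
  also have "L (Tens a ?n) (Tens a (Tens ?m ?k)) (\<^bold>1 (obj a) \<otimes>\<^sub>m ?j) = M.sidm (flat a @ pw [X] (m + k))"
    using L_Tensor_Id(2)[of ?j ?n "Tens ?m ?k" a] inv_join_in[of X m k] by (simp add: L_inv_join)
  also have "L (Tens a (Tens ?m ?k)) (Tens (Tens a ?m) ?k) ?A = M.sidm (flat a @ pw [X] (m + k))"
    using L_inv_Assoc[of a ?m ?k] by (simp add: pw_add)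
  finally show ?thesis
    using L_Lunit[of ?k] L_arr[of e "Tens a ?m" ?o] e by (simp add: pw_add)
qed

end

section \<open>Contraction maps and binomials in the endomorphisms of the unit\<close>

context rat_tensor_category
begin

text \<open>The pairing \<open>e0\<close> is left open so that one computation serves
  \<open>iota_lower\<close>, with \<open>tensor_pow_ev\<close>, and \<open>iota_upper\<close>, with
  \<open>tensor_pow_ev_symm\<close>.\<close>

lemma contraction_map:
  fixes X Y :: 'a and i j :: nat
  defines "F \<equiv> \<lambda>e0. sym_proj C X i \<cdot> contract C (tensor_pow C Y j) X j (j + i) e0 \<cdot> (sym_inj C Y j \<otimes>\<^sub>m sym_inj C X (j + i))"
  assumes e: "e0 \<in> Hom C (tensor_pow C Y j \<otimes>\<^sub>o tensor_pow C X j) \<I>"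
  shows "F e0 \<in> Hom C (sym_pow C Y j \<otimes>\<^sub>o sym_pow C X (j + i)) (sym_pow C X i)"
    and "L (Tens (Sp Y j) (Sp X (j + i))) (Sp X i) (F e0) =
      LP X i \<bullet> M.swh [] (L (Tens (Pw Y j) (Pw X j)) (Word []) e0) (pw [X] i) \<bullet>
      M.swh [] (LI Y j) (pw [X] (j + i)) \<bullet> M.swh (SP Y j) (LI X (j + i)) []"
proof -
  let ?ct = "contract C (tensor_pow C Y j) X j (j + i) e0"
  let ?ii = "sym_inj C Y j \<otimes>\<^sub>m sym_inj C X (j + i)"
  note ii = Tensor_in[OF sym_inj_in sym_inj_in, of Y j X "j + i"]
  note ct = contract_in[OF e, of i]
  show "F e0 \<in> Hom C (sym_pow C Y j \<otimes>\<^sub>o sym_pow C X (j + i)) (sym_pow C X i)"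
    unfolding F_def by (rule Comp_in[OF Comp_in[OF ii ct] sym_proj_in])
  have "L (Tens (Sp Y j) (Sp X (j + i))) (Sp X i) (F e0) =
     L (Pw X i) (Sp X i) (sym_proj C X i) \<bullet> L (Tens (Sp Y j) (Sp X (j + i))) (Pw X i) (?ct \<cdot> ?ii)"
    unfolding F_def by (rule L_cmp) (unfold obj.simps tensor_list_pw, rule Comp_in[OF ii ct], rule sym_proj_in)
  also have "L (Tens (Sp Y j) (Sp X (j + i))) (Pw X i) (?ct \<cdot> ?ii) =
     L (Tens (Pw Y j) (Pw X (j + i))) (Pw X i) ?ct \<bullet> L (Tens (Sp Y j) (Sp X (j + i))) (Tens (Pw Y j) (Pw X (j + i))) ?ii"
    by (rule L_cmp) (unfold obj.simps tensor_list_pw, rule ii, rule ct)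
  also have "L (Tens (Sp Y j) (Sp X (j + i))) (Tens (Pw Y j) (Pw X (j + i))) ?ii =
      M.swh [] (LI Y j) (pw [X] (j + i)) \<bullet> M.swh (SP Y j) (LI X (j + i)) []"
    using L_Tensor[of "sym_inj C Y j" "Sp Y j" "Pw Y j" "sym_inj C X (j + i)" "Sp X (j + i)" "Pw X (j + i)"] sym_inj_in
    by (simp add: LI_def SP_def)
  also have "L (Tens (Pw Y j) (Pw X (j + i))) (Pw X i) ?ct =
      M.swh [] (L (Tens (Pw Y j) (Pw X j)) (Word []) e0) (pw [X] i)"
    using L_contract[of e0 "Pw Y j" X j i] e by simp
  finally show "L (Tens (Sp Y j) (Sp X (j + i))) (Sp X i) (F e0) =
      LP X i \<bullet> M.swh [] (L (Tens (Pw Y j) (Pw X j)) (Word []) e0) (pw [X] i) \<bullet>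
      M.swh [] (LI Y j) (pw [X] (j + i)) \<bullet> M.swh (SP Y j) (LI X (j + i)) []"
    by (simp add: LP_def)
qed

lemma unit_scalar_in: "unit_scalar C q \<in> Hom C \<I> \<I>"
  unfolding unit_scalar_def by (rule Scale_in[OF Id_in])

lemma L_unit_scalar: "L (Word []) (Word []) (unit_scalar C q) = M.sscl q (M.sidm [])"
  unfolding unit_scalar_def using L_Scale[of "\<^bold>1 \<I>" "Word []" "Word []" q] Id_in[of \<I>] L_Id[of "Word []"] by simp

lemma falling_factorial:
  assumes t: "t \<in> Hom C \<I> \<I>"
  shows "falling_factorial C t k \<in> Hom C \<I> \<I> \<and>
    L (Word []) (Word []) (falling_factorial C t k) = S.fall (L (Word []) (Word []) t) k"
proof (induction k)
  case 0
  then show ?case using Id_in[of \<I>] L_Id[of "Word []"] by simp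
next
  case (Suc k)
  let ?s = "t \<^bold>+ unit_scalar C (- of_nat k)"
  have s: "?s \<in> Hom C \<I> \<I>" using Add_in[OF t unit_scalar_in] .
  have "L (Word []) (Word []) ?s = L (Word []) (Word []) t \<boxplus> M.sscl (- of_nat k) (M.sidm [])"
    using L_Add[of t "Word []" "Word []"] t unit_scalar_in by (simp add: L_unit_scalar)
  then show ?case
    using L_cmp[of ?s "Word []" "Word []" "falling_factorial C t k" "Word []"] s Suc Comp_in[OF s] by simp
qed

lemma unit_binomial:
  assumes t: "t \<in> Hom C \<I> \<I>"
  shows "L (Word []) (Word []) (unit_binomial C t k) = M.sscl (1 / fact k) (S.fall (L (Word []) (Word []) t) k)"
  unfolding unit_binomial_def
  using L_Scale[of "falling_factorial C t k" "Word []" "Word []"] falling_factorial[OF t, of k] by simp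

lemma unit_binomial_iso:
  assumes t: "t \<in> Hom C \<I> \<I>" and iso: "is_isomorphism C \<I> \<I> (unit_binomial C t k)"
  shows "S.is_iso (S.fall (L (Word []) (Word []) t) k)"
proof -
  have [simp]: "M.sarr (S.fall (L (Word []) (Word []) t) k)"
    using falling_factorial[OF t, of k] by (metis L_arr obj.simps(2) tensor_list.simps(1))
  have "S.is_iso (M.sscl (1 / fact k) (S.fall (L (Word []) (Word []) t) k))"
    using L_iso[of "Word []" "Word []" "unit_binomial C t k"] iso unit_binomial[OF t] by simp
  then have "S.is_iso (M.sscl (fact k) (M.sscl (1 / fact k) (S.fall (L (Word []) (Word []) t) k)))"
    by (rule S.is_iso_scl) simp
  then show ?thesis by (simp add: S.scl_scl)
qed

lemma unit_scalar_Add: "unit_scalar C a \<^bold>+ unit_scalar C b = unit_scalar C (a + b)"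
  by (simp add: unit_scalar_def Scale_add[OF Id_in])

lemma unit_scalar_Comp: "unit_scalar C a \<cdot> unit_scalar C b = unit_scalar C (a * b)"
  using Comp_Scale[OF Id_in[of \<I>] unit_scalar_in[of a], of b] Comp_Id[OF unit_scalar_in[of a]]
  by (simp add: unit_scalar_def Scale_Scale[OF Id_in] mult.commute)

text \<open>The factors -1, -2, ..., -k multiply to (-1)^k k!.\<close>

lemma unit_binomial_minus_1: "unit_binomial C (unit_scalar C (- 1)) k = unit_scalar C ((- 1) ^ k)"
proof -
  have "falling_factorial C (unit_scalar C (- 1)) k = unit_scalar C ((- 1) ^ k * fact k)"
  proof (induction k)
    case 0
    then show ?case by (simp add: unit_scalar_def Scale_1[OF Id_in])
  next
    case (Suc k)
    have "(- 1 :: rat) ^ k * fact k * (- 1 + - of_nat k) = (- 1) ^ Suc k * fact (Suc k)"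
      by (simp add: algebra_simps)
    then show ?case by (simp only: falling_factorial.simps Suc unit_scalar_Add unit_scalar_Comp)
  qed
  then show ?thesis
    by (simp add: unit_binomial_def unit_scalar_def Scale_Scale[OF Id_in])
qed

end

text \<open>Instantiated below both for an object with its dual and for the dual with the object
  itself as its dual, so that each statement about \<open>V\<close> also covers its dual.\<close>

locale dual_object_pair = rat_tensor_category +
  fixes X Y e c
  assumes sym_dual_objects: "sym_dual_objects M.sarr M.ssrc M.stgt M.sidm M.scmp M.swh M.ssym M.spls M.sscl
    [X] [Y] e c (SP X) (LI X) (LP X) (SP Y) (LI Y) (LP Y)"
begin

sublocale d: sym_dual_objects M.sarr M.ssrc M.stgt M.sidm M.scmp M.swh M.ssym M.spls M.sscl
    "[X]" "[Y]" e c "SP X" "LI X" "LP X" "SP Y" "LI Y" "LP Y"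
  by (rule sym_dual_objects)

lemma sym_mult_commute: "sym_mult C X i j \<cdot> \<tau> (sym_pow C X j) (sym_pow C X i) = sym_mult C X j i"
proof (rule L_inj[of _ "Tens (Sp X j) (Sp X i)" "Sp X (j + i)"])
  have "L (Tens (Sp X j) (Sp X i)) (Sp X (i + j)) (sym_mult C X i j \<cdot> \<tau> (sym_pow C X j) (sym_pow C X i)) =
      d.a.mult i j \<bullet> M.ssym (SP X j) (SP X i)"
    using L_cmp[of "\<tau> (sym_pow C X j) (sym_pow C X i)" "Tens (Sp X j) (Sp X i)" "Tens (Sp X i) (Sp X j)" "sym_mult C X i j" "Sp X (i + j)"]
      sym_mult_in[of X i j] Symm_in L_Symm[of "Sp X j" "Sp X i"]
    by (simp add: L_sym_mult SP_def)
  then show "L (Tens (Sp X j) (Sp X i)) (Sp X (j + i)) (sym_mult C X i j \<cdot> \<tau> (sym_pow C X j) (sym_pow C X i)) =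
      L (Tens (Sp X j) (Sp X i)) (Sp X (j + i)) (sym_mult C X j i)"
    using L_sym_mult[of X j i] by (simp add: d.mult_commute add.commute)
qed (use Comp_in[OF Symm_in sym_mult_in, of X i j] sym_mult_in[of X j i] in \<open>simp_all add: add.commute\<close>)

text \<open>The test uses the j-th power of \<open>Y\<close> as dual of the j-th power of
  \<open>X\<close>. By \<open>mult_mate\<close> the mate of the multiplication is
  \<open>d.psi' j i\<close> followed by a symmetry.\<close>

lemma curry_mult_iso:
  assumes "S.is_iso (d.psi' j i)"
  shows "is_isomorphism C (sym_pow C X i) (IHom C (sym_pow C X j) (sym_pow C X (i + j)))
    (curry_mor C (sym_pow C X i) (sym_pow C X j) (sym_pow C X (i + j)) (sym_mult C X i j))"
proof -
  have "S.is_iso (M.swh [] (L (Tens (Sp X i) (Sp X j)) (Sp X (i + j)) (sym_mult C X i j)) (SP Y j) \<bullet>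
      M.swh (flat (Sp X i)) (M.ssym (SP Y j) (SP X j) \<bullet> d.swap_sco j) [])"
    using d.mult_mate[of i j] S.is_iso_cmp[OF S.is_iso_sym assms(1), of "SP Y j" "SP X (i + j)"]
    by (simp add: L_sym_mult SP_def add.commute)
  then show ?thesis
    using curry_isomorphism[of "sym_mult C X i j" "Sp X i" "Sp X j" "Sp X (i + j)"] d.mult_dual_pair[of j] sym_mult_in[of X i j]
    by (simp add: SP_def)
qed

lemma perfect_pairing_mult:
  assumes "S.is_iso (d.psi' j i)" "S.is_iso (d.psi' i j)"
  shows "perfect_pairing C (sym_pow C X i) (sym_pow C X j) (sym_pow C X (i + j)) (sym_mult C X i j)"
  \<comment> \<open>Commutativity turns the exchanged multiplication into the one with
    \<open>i\<close> and \<open>j\<close> exchanged, so both conditions are instances of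
    \<open>curry_mult_iso\<close>.\<close>
  unfolding perfect_pairing_def sym_mult_commute
  using sym_mult_in[of X i j] curry_mult_iso[OF assms(1)] curry_mult_iso[OF assms(2)] by (simp add: add.commute)

lemma curry_contraction_iso:
  assumes e0: "e0 \<in> Hom C (tensor_pow C Y j \<otimes>\<^sub>o tensor_pow C X j) \<I>"
    and L_e0: "L (Tens (Pw Y j) (Pw X j)) (Word []) e0 = S.pow_ev [X] [Y] e j"
    and iso: "S.is_iso (d.psi i j)"
  shows "is_isomorphism C (sym_pow C Y j) (IHom C (sym_pow C X (j + i)) (sym_pow C X i))
    (curry_mor C (sym_pow C Y j) (sym_pow C X (j + i)) (sym_pow C X i)
      (sym_proj C X i \<cdot> contract C (tensor_pow C Y j) X j (j + i) e0 \<cdot> (sym_inj C Y j \<otimes>\<^sub>m sym_inj C X (j + i))))"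
proof -
  note m = contraction_map[OF e0, of i]
  have "L (Tens (Sp Y j) (Sp X (j + i))) (Sp X i)
     (sym_proj C X i \<cdot> contract C (tensor_pow C Y j) X j (j + i) e0 \<cdot> (sym_inj C Y j \<otimes>\<^sub>m sym_inj C X (j + i))) =
     d.contraction j i"
    unfolding m(2) L_e0 d.contraction_def ..
  then show ?thesis
    using curry_isomorphism[of _ "Sp Y j" "Sp X (j + i)" "Sp X i"] m(1) d.sym_dual_pair[of "j + i"] d.contraction_mate[of j i] iso
    by (simp add: SP_def)
qed

end

section \<open>Assembling the isomorphisms and the perfect pairings\<close>

context rat_tensor_category
begin

lemma iso_alpha_iso:
  assumes "is_isomorphism C Z (IHom C X Y) h" "e \<in> Hom C (X' \<otimes>\<^sub>o X) \<I>"
    and "\<exists>c. S.dual_pair [X] [X'] (L (Tens (Leaf X') (Leaf X)) (Word []) e) c"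
  shows "is_isomorphism C Z (Y \<otimes>\<^sub>o X') (iso_inv C (Y \<otimes>\<^sub>o X') (IHom C X Y) (alpha_via C X Y X' e) \<cdot> h)"
proof -
  obtain t where dp: "S.dual_pair [X] [X'] (L (Tens (Leaf X') (Leaf X)) (Word []) e) t"
    using assms(3) by blast
  show ?thesis
    by (rule isomorphism_Comp[OF assms(1) isomorphism_inv[OF alpha_via_iso(1)[OF assms(2) dp]]])
qed

context
  fixes V g
  assumes sr: "has_symmetric_rank C V g"
begin

interpretation v: dual_object_pair C V "dual C V" "LE V" "LC V"
  by (rule dual_object_pair.intro[OF rat_tensor_category_axioms dual_object_pair_axioms.intro[OF sym_dual]])

interpretation w: dual_object_pair C "dual C V" V "LE V \<bullet> M.ssym [V] [dual C V]" "M.ssym [V] [dual C V] \<bullet> LC V"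
  by (rule dual_object_pair.intro[OF rat_tensor_category_axioms
        dual_object_pair_axioms.intro[OF v.d.swap_sym_dual_objects]])

lemma rank_in: "tensor_rank C V \<in> Hom C \<I> \<I>"
  unfolding tensor_rank_def dual_ev_symm_def by (rule Comp_in[OF coev_in Comp_in[OF Symm_in dual_ev_in]])

lemma L_rank: "L (Word []) (Word []) (tensor_rank C V) = v.d.rk"
proof -
  have "L (Word []) (Word []) (tensor_rank C V) =
     L (Tens (Leaf V) (Leaf (dual C V))) (Word []) (dual_ev_symm C V) \<bullet> LC V"
    unfolding tensor_rank_def LC_def dual_ev_symm_def
    by (rule L_cmp) (unfold obj.simps tensor_list.simps, rule coev_in, rule Comp_in[OF Symm_in dual_ev_in])
  also have "L (Tens (Leaf V) (Leaf (dual C V))) (Word []) (dual_ev_symm C V) = LE V \<bullet> M.ssym [V] [dual C V]"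
    using L_cmp[of "\<tau> V (dual C V)" "Tens (Leaf V) (Leaf (dual C V))" "Tens (Leaf (dual C V)) (Leaf V)" "dual_ev C V" "Word []"] Symm_in dual_ev_in
      L_Symm[of "Leaf V" "Leaf (dual C V)"]
    by (simp add: dual_ev_symm_def LE_def)
  finally show ?thesis by (simp add: v.d.rk_def S.cmp_assoc)
qed

lemma shifted_rank_in: "shifted_rank C V g \<in> Hom C \<I> \<I>"
  unfolding shifted_rank_def by (rule Add_in[OF rank_in unit_scalar_in])

lemma L_shifted_rank:
  "L (Word []) (Word []) (shifted_rank C V g) = v.d.rk \<boxplus> M.sscl (of_nat g - 1) (M.sidm [])"
  unfolding shifted_rank_def
  using L_Add[of "tensor_rank C V" "Word []" "Word []"] rank_in unit_scalar_in by (simp add: L_rank L_unit_scalar)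

lemma psi_isos:
  assumes "i + j = g"
  shows "S.is_iso (v.d.psi i j)" "S.is_iso (v.d.psi' j i)"
proof -
  obtain L' f where f: "is_isomorphism C (sym_pow C V g \<otimes>\<^sub>o L') \<I> f"
    using sr by (auto simp: has_symmetric_rank_def invertible_object_def)
  let ?f = "L (Tens (Sp V g) (Leaf L')) (Word []) f"
  have 1: "S.is_iso ?f" "M.ssrc ?f = SP V g @ [L']" "M.stgt ?f = []"
    using f L_iso[of "Tens (Sp V g) (Leaf L')" "Word []" f] by (simp_all add: SP_def)
  have 2: "S.is_iso (S.fall (v.d.rk \<boxplus> M.sscl (of_nat g - 1) (M.sidm [])) k)" if "k \<le> g" for k
  proof -
    have "is_isomorphism C \<I> \<I> (unit_binomial C (shifted_rank C V g) k)"
      using sr that unfolding has_symmetric_rank_def by blast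
    from unit_binomial_iso[OF shifted_rank_in this] show ?thesis unfolding L_shifted_rank .
  qed
  show "S.is_iso (v.d.psi i j)" "S.is_iso (v.d.psi' j i)"
    by (rule v.d.psi_iso[OF 1 2 assms[symmetric]], assumption)+
qed

lemma D_lower_iso:
  assumes "i + j = g"
  shows "is_isomorphism C (sym_pow C (dual C V) j) (sym_pow C V i \<otimes>\<^sub>o sym_pow C (dual C V) g) (D_lower C V j g)"
proof -
  have g: "g = j + i" using assms by simp
  have "is_isomorphism C (sym_pow C (dual C V) j) (IHom C (sym_pow C V (j + i)) (sym_pow C V i)) (iota_lower C V j (j + i))"
    unfolding iota_lower_def add_diff_cancel_left'
    by (rule v.curry_contraction_iso[OF tensor_pow_ev_in L_tensor_pow_ev psi_isos(1)[OF assms]])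
  from iso_alpha_iso[OF this sym_ev_in sym_ev_dual_pair] show ?thesis
    unfolding D_lower_def g add_diff_cancel_left' .
qed

text \<open>Invertibility of \<open>iota_upper\<close> comes from the pair \<open>w\<close>, in
  which \<open>V\<close> is the dual of its dual. The powers of the bidual enter afterwards, through
  the inverse of \<alpha>.\<close>

lemma D_upper_iso:
  assumes "i + j = g"
  shows "is_isomorphism C (sym_pow C V i) (sym_pow C (dual C V) j \<otimes>\<^sub>o sym_pow C (dual C (dual C V)) g) (D_upper C V i g)"
proof -
  have g: "g = i + j" using assms by simp
  have "S.is_iso (w.d.psi j i)"
    unfolding v.d.swap_psi by (rule psi_isos(2)[OF assms])
  from w.curry_contraction_iso[OF tensor_pow_ev_symm_in L_tensor_pow_ev_symm this]
  have "is_isomorphism C (sym_pow C V i) (IHom C (sym_pow C (dual C V) (i + j)) (sym_pow C (dual C V) j)) (iota_upper C V i (i + j))"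
    unfolding iota_upper_def add_diff_cancel_left' .
  from iso_alpha_iso[OF this sym_ev_in sym_ev_dual_pair] show ?thesis
    unfolding D_upper_def g add_diff_cancel_left' .
qed

lemma perfect_pairing_sym_mult:
  assumes "i + j = g"
  shows "perfect_pairing C (sym_pow C V i) (sym_pow C V j) (sym_pow C V g) (sym_mult C V i j)"
    and "perfect_pairing C (sym_pow C (dual C V) i) (sym_pow C (dual C V) j) (sym_pow C (dual C V) g) (sym_mult C (dual C V) i j)"
proof -
  have j: "j + i = g" using assms by simp
  show "perfect_pairing C (sym_pow C V i) (sym_pow C V j) (sym_pow C V g) (sym_mult C V i j)"
    using v.perfect_pairing_mult[OF psi_isos(2)[OF assms] psi_isos(2)[OF j]] assms by simp
  have "S.is_iso (w.d.psi' j i)" "S.is_iso (w.d.psi' i j)"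
    unfolding v.d.swap_psi' by (rule psi_isos(1)[OF j], rule psi_isos(1)[OF assms])
  then show "perfect_pairing C (sym_pow C (dual C V) i) (sym_pow C (dual C V) j) (sym_pow C (dual C V) g) (sym_mult C (dual C V) i j)"
    using w.perfect_pairing_mult[of j i] assms by simp
qed

text \<open>With r = -g the upper entry r + g - 1 of the binomial is -1.\<close>

lemma strong_binomial:
  assumes "has_strong_symmetric_rank C V g"
  shows "unit_binomial C (shifted_rank C V g) k = unit_scalar C ((- 1) ^ k)"
proof -
  have "shifted_rank C V g = unit_scalar C (- 1)"
    using assms by (simp add: has_strong_symmetric_rank_def shifted_rank_def unit_scalar_Add)
  then show ?thesis by (simp add: unit_binomial_minus_1)
qed

end

end

theorem corollary6p3:
  fixes C :: "('o, 'm) tensor_cat" (structure) and V :: 'o and g :: nat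
  assumes "rigid_tensor_category C"
    and "pseudo_abelian_category C"
    and "rat_linear_category C"
    and "has_symmetric_rank C V g"
  shows "(\<forall>i\<le>g.
      is_isomorphism C (sym_pow C V i) (sym_pow C (dual C V) (g - i) \<otimes>\<^sub>o sym_pow C (dual C (dual C V)) g)
        (D_upper C V i g) \<and>
      is_isomorphism C (sym_pow C (dual C V) (g - i)) (sym_pow C V i \<otimes>\<^sub>o sym_pow C (dual C V) g)
        (D_lower C V (g - i) g) \<and>
      is_isomorphism C (sym_pow C V (g - i)) (sym_pow C (dual C V) i \<otimes>\<^sub>o sym_pow C (dual C (dual C V)) g)
        (D_upper C V (g - i) g) \<and>
      is_isomorphism C (sym_pow C (dual C V) i) (sym_pow C V (g - i) \<otimes>\<^sub>o sym_pow C (dual C V) g)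
        (D_lower C V i g) \<and>
      perfect_pairing C (sym_pow C V i) (sym_pow C V (g - i)) (sym_pow C V g)
        (sym_mult C V i (g - i)) \<and>
      perfect_pairing C (sym_pow C V (g - i)) (sym_pow C V i) (sym_pow C V g)
        (sym_mult C V (g - i) i) \<and>
      perfect_pairing C (sym_pow C (dual C V) i) (sym_pow C (dual C V) (g - i))
        (sym_pow C (dual C V) g) (sym_mult C (dual C V) i (g - i)) \<and>
      perfect_pairing C (sym_pow C (dual C V) (g - i)) (sym_pow C (dual C V) i)
        (sym_pow C (dual C V) g) (sym_mult C (dual C V) (g - i) i)) \<and>
    (has_strong_symmetric_rank C V g \<longrightarrow>
      (\<forall>i\<le>g. unit_binomial C (shifted_rank C V g) (g - i) = unit_scalar C ((- 1) ^ (g - i)) \<and>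
             unit_binomial C (shifted_rank C V g) i = unit_scalar C ((- 1) ^ i)))"
proof -
  interpret rat_tensor_category C
    by (intro rat_tensor_category.intro assms)
  note sr = assms(4)
  show ?thesis
    by (intro conjI allI impI; (rule D_upper_iso[OF sr] D_lower_iso[OF sr] perfect_pairing_sym_mult[OF sr]
        strong_binomial[OF sr])) simp_all
qed

end
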